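(* Let $T:J\to J$, $J=[0,z)$, be a 3-IET which is the first return map to $J$ of the rotation $R$ by $\alpha$, and suppose that $T$ satisfies the assumptions (A0)-(A9) listed in the context. Then there exists $\kappa>1$ such that for all integers $n>0$ the set $$B_n=\{m\in\mathbb{N}: 0<m<n,\ T^m\text{ is not disjoint from }T^n\}$$ has the property that if $m_1<m_2$ are both in $B_n$ then $\frac{m_2}{m_1}>\kappa$.
   Context: Disjointness: two measure preserving maps of probability spaces are disjoint if their only joining (invariant measure of the product map projecting to the given measure in each factor) is the product measure. Here $T^m,T^n$ preserve normalized Lebesgue measure on $J$. Setup: $\alpha\in(0,1)$ is irrational, $R:[0,1)\to[0,1)$ is $R(x)=x+\alpha \bmod 1$, $\lambda$ is Lebesgue measure, $d(x,y)=\min\{|x-y|,1-|x-y|\}$, and $\|y\|$ denotes the distance from $y\in\mathbb{R}$ to $\mathbb{Z}$. Let $a_0,a_1,\dots$ be the continued fraction expansion of $\alpha$ and $p_k/q_k$ its convergents, so $q_{k+1}=a_{k+1}q_k+q_{k-1}$. $J=[0,z)\subset[0,1)$ is an interval such that $x\notin J$ implies $Rx\in J$, and $T:J\to J$ is the first return (induced) map of $R$ to $J$; it is a 3-interval exchange transformation (3-IET). For $r\in\mathbb{N}$ put $\psi_r(x)=\sum_{j=0}^{r-1}\chi_J(R^jx)$, $x\in[0,1)$. The associated torus is $\hat X=\mathbb{R}^2/\Lambda$, with $\Lambda$ the lattice generated by $(1,0)$ and $(-\alpha,1)$; the two marked points are the endpoints $(0,0)$ and $(z,0)$ of the horizontal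 segment of length $z$. Assumptions (A0)-(A9): there exist constants $C_1,C_2,C_3,C_4>1$ such that for every $\ell\in\mathbb{N}$ and every sufficiently small $\eta>0$ there exist $\hat c_\eta>0$ (depending on $\eta$) and $c_\ell>0$ (depending on $\ell$) such that for every $0<c<c_\ell$ there exist a constant $k_c\in\mathbb{N}$ and infinite sequences of natural numbers $(L_i)$, $(k_i)$ such that: (A0) $q_{k_i-1}<cL_i<q_{k_i}$. (A1) $a_{k_i}<C_1$. (A2) $a_{k_i+1}<C_2$. (A3) $a_{k_i+2}<C_3$. (A4) The shortest vertical trajectory on the torus from one marked point to a $\|q_{k_i}\alpha\|$-neighborhood of the other has length at least $q_{k_i}/C_4$. (A5) There exists $u_i$ such that either $\lambda(\psi_{L_i}^{-1}(u_i))>\hat c_\eta$ and $\lambda(\psi_{L_i}^{-1}((-\infty,u_i)))<\eta\hat c_\eta$, or $\lambda(\psi_{L_i}^{-1}(u_i))>\hat c_\eta$ and $\lambda(\psi_{L_i}^{-1}((u_i,\infty)))<\eta\hat c_\eta$. (A6) $\lim_{i\to\infty}\int_0^1 d(R^{L_i}x,x)\,d\lambda(x)=0$. (A7) $L_i>q_{k_i+\ell}$. (A8) $\max\{j:\psi_{L_i}^{-1}(j)\neq\emptyset\}-\min\{j:\psi_{L_i}^{-1}(j)\ne\emptyset\}<k_c$. (A9) There exists $v_i$ such that $q_{v_i}\le L_i<q_{v_i+1}$ and either $L_i=q_{v_i}$, or $a_{v_i+1}>4$ and $L_i=pq_{v_i}$ for some positive integer $p\le\lfloor a_{v_i+1}/4\rfloor$.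 *)

theory Defs
  imports "HOL-Analysis.Analysis"
begin

section \<open>Joinings and disjointness\<close>

definition joining ::
  "'a measure \<Rightarrow> ('a \<Rightarrow> 'a) \<Rightarrow> 'b measure \<Rightarrow> ('b \<Rightarrow> 'b) \<Rightarrow> ('a \<times> 'b) measure \<Rightarrow> bool" where
  "joining M S N U \<nu> \<longleftrightarrow>
     sets \<nu> = sets (M \<Otimes>\<^sub>M N) \<and>
     distr \<nu> M fst = M \<and> distr \<nu> N snd = N \<and>
     distr \<nu> (M \<Otimes>\<^sub>M N) (map_prod S U) = \<nu>"

text \<open>Intended for measure preserving maps \<open>S\<close>, \<open>U\<close> of probability spaces \<open>M\<close>, \<open>N\<close>;
  a joining is then automatically a probability measure.\<close>

definition disjoint_maps ::
  "'a measure \<Rightarrow> ('a \<Rightarrow> 'a) \<Rightarrow> 'b measure \<Rightarrow> ('b \<Rightarrow> 'b) \<Rightarrow> bool" where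
  "disjoint_maps M S N U \<longleftrightarrow> (\<forall>\<nu>. joining M S N U \<nu> \<longrightarrow> \<nu> = M \<Otimes>\<^sub>M N)"

text \<open>Normalized Lebesgue measure, with \<open>J\<close> itself (rather than the whole line) as its space,
  so that the values of a map outside \<open>J\<close> are irrelevant.\<close>

definition normalized_lebesgue :: "real set \<Rightarrow> real measure" where
  "normalized_lebesgue J = uniform_measure (restrict_space lborel J) J"


section \<open>Rotations, first return maps, interval exchanges\<close>

definition rotation :: "real \<Rightarrow> real \<Rightarrow> real" where
  "rotation \<alpha> x = frac (x + \<alpha>)"

definition first_return :: "('a \<Rightarrow> 'a) \<Rightarrow> 'a set \<Rightarrow> 'a \<Rightarrow> 'a" where
  "first_return R J x = (R ^^ (LEAST n. 0 < n \<and> (R ^^ n) x \<in> J)) x"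

text \<open>A \<open>d\<close>-interval exchange of \<open>[0,z)\<close>: the consecutive half-open intervals of positive
  lengths \<open>l 0, \<dots>, l (d - 1)\<close> are translated so that the \<open>j\<close>-th one
  becomes the \<open>\<pi> j\<close>-th one (both counted from 0).\<close>

definition interval_exchange :: "nat \<Rightarrow> real \<Rightarrow> (real \<Rightarrow> real) \<Rightarrow> bool" where
  "interval_exchange d z T \<longleftrightarrow>
     (\<exists>l \<pi>. (\<forall>j<d. 0 < l j) \<and> (\<Sum>j<d. l j) = z \<and> \<pi> permutes {..<d} \<and>
        (\<forall>j<d. \<forall>x \<in> {(\<Sum>i<j. l i) ..< (\<Sum>i<Suc j. l i)}.
           T x = x - (\<Sum>i<j. l i) + (\<Sum>i | i < d \<and> \<pi> i < \<pi> j. l i)))"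

definition circle_dist :: "real \<Rightarrow> real \<Rightarrow> real" where
  "circle_dist x y = min \<bar>x - y\<bar> (1 - \<bar>x - y\<bar>)"

definition dist_to_int :: "real \<Rightarrow> real" where
  "dist_to_int y = infdist y \<int>"

definition visits :: "real \<Rightarrow> real set \<Rightarrow> nat \<Rightarrow> real \<Rightarrow> real" where
  "visits \<alpha> J r x = (\<Sum>j<r. indicator J ((rotation \<alpha> ^^ j) x))"


section \<open>Continued fractions\<close>

fun cf_complete_quotient :: "real \<Rightarrow> nat \<Rightarrow> real" where
  "cf_complete_quotient \<alpha> 0 = \<alpha>"
| "cf_complete_quotient \<alpha> (Suc k) = 1 / frac (cf_complete_quotient \<alpha> k)"

text \<open>Partial quotients as natural numbers: for irrational \<open>\<alpha>\<close> in \<open>(0,1)\<close> the zeroth one is 0 and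
  the others are positive.\<close>

definition cf_quotient :: "real \<Rightarrow> nat \<Rightarrow> nat" where
  "cf_quotient \<alpha> k = nat \<lfloor>cf_complete_quotient \<alpha> k\<rfloor>"

fun cf_denom :: "real \<Rightarrow> nat \<Rightarrow> nat" where
  "cf_denom \<alpha> 0 = 1"
| "cf_denom \<alpha> (Suc 0) = cf_quotient \<alpha> 1"
| "cf_denom \<alpha> (Suc (Suc k)) =
     cf_quotient \<alpha> (Suc (Suc k)) * cf_denom \<alpha> (Suc k) + cf_denom \<alpha> k"


section \<open>The torus\<close>

text \<open>Points of the torus are represented by points of the plane modulo the lattice generated by
  \<open>(1,0)\<close> and \<open>(-\<alpha>,1)\<close>. The vertical flow at time 1 acts on the horizontal axis as the
  rotation by \<open>\<alpha>\<close>.\<close>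

definition torus_lattice :: "real \<Rightarrow> (real \<times> real) set" where
  "torus_lattice \<alpha> =
     range (\<lambda>(m::int, n::int). of_int m *\<^sub>R (1, 0) + of_int n *\<^sub>R (-\<alpha>, 1))"

definition torus_dist :: "real \<Rightarrow> real \<times> real \<Rightarrow> real \<times> real \<Rightarrow> real" where
  "torus_dist \<alpha> P Q = infdist P ((\<lambda>v. Q + v) ` torus_lattice \<alpha>)"

text \<open>Every vertical trajectory from \<open>P\<close> to the open \<open>\<epsilon>\<close>-neighbourhood of \<open>Q\<close> has length at
  least \<open>h\<close>. Only upward trajectories appear: a downward one from \<open>P\<close> to near \<open>Q\<close> is, after a
  translation, an upward one from \<open>Q\<close> to near \<open>P\<close>.\<close>

definition vertical_length_ge ::
  "real \<Rightarrow> real \<times> real \<Rightarrow> real \<times> real \<Rightarrow> real \<Rightarrow> real \<Rightarrow> bool" where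
  "vertical_length_ge \<alpha> P Q \<epsilon> h \<longleftrightarrow>
     (\<forall>t\<ge>0. torus_dist \<alpha> (P + (0, t)) Q < \<epsilon> \<longrightarrow> h \<le> t)"


section \<open>The assumptions (A0)--(A9)\<close>

text \<open>In (A0) the truncated subtraction is harmless: \<open>k i = 0\<close> would require
  \<open>cf_denom \<alpha> 0 < c * L i < cf_denom \<alpha> 0\<close>.\<close>

definition conditions_A ::
  "real \<Rightarrow> real \<Rightarrow> real \<Rightarrow> real \<Rightarrow> real \<Rightarrow> real \<Rightarrow> nat \<Rightarrow> real \<Rightarrow> real \<Rightarrow> real \<Rightarrow> nat \<Rightarrow>
    (nat \<Rightarrow> nat) \<Rightarrow> (nat \<Rightarrow> nat) \<Rightarrow> bool" where
  "conditions_A \<alpha> z C1 C2 C3 C4 l \<eta> chat c kc L k \<longleftrightarrow>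
    (let a = cf_quotient \<alpha>; q = cf_denom \<alpha>; \<psi> = visits \<alpha> {0..<z};
         X = {0..<1::real}; leb = measure lborel in
     \<comment> \<open>A0\<close> (\<forall>i. real (q (k i - 1)) < c * real (L i) \<and> c * real (L i) < real (q (k i))) \<and>
     \<comment> \<open>A1\<close> (\<forall>i. real (a (k i)) < C1) \<and>
     \<comment> \<open>A2\<close> (\<forall>i. real (a (k i + 1)) < C2) \<and>
     \<comment> \<open>A3\<close> (\<forall>i. real (a (k i + 2)) < C3) \<and>
     \<comment> \<open>A4\<close> (\<forall>i. let \<epsilon> = dist_to_int (real (q (k i)) * \<alpha>); h = real (q (k i)) / C4 in
             vertical_length_ge \<alpha> (0, 0) (z, 0) \<epsilon> h \<and>
             vertical_length_ge \<alpha> (z, 0) (0, 0) \<epsilon> h) \<and>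
     \<comment> \<open>A5\<close> (\<forall>i. \<exists>u.
             (leb (\<psi> (L i) -` {u} \<inter> X) > chat \<and> leb (\<psi> (L i) -` {..<u} \<inter> X) < \<eta> * chat) \<or>
             (leb (\<psi> (L i) -` {u} \<inter> X) > chat \<and> leb (\<psi> (L i) -` {u<..} \<inter> X) < \<eta> * chat)) \<and>
     \<comment> \<open>A6\<close> (\<lambda>i. LINT x:X|lborel. circle_dist ((rotation \<alpha> ^^ L i) x) x) \<longlonglongrightarrow> 0 \<and>
     \<comment> \<open>A7\<close> (\<forall>i. L i > q (k i + l)) \<and>
     \<comment> \<open>A8\<close> (\<forall>i. Max (\<psi> (L i) ` X) - Min (\<psi> (L i) ` X) < real kc) \<and>
     \<comment> \<open>A9\<close> (\<forall>i. \<exists>v. q v \<le> L i \<and> L i < q (v + 1) \<and>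
             (L i = q v \<or>
              (a (v + 1) > 4 \<and> (\<exists>p. 0 < p \<and> p \<le> a (v + 1) div 4 \<and> L i = p * q v)))))"

text \<open>\<open>chat\<close> and \<open>cl\<close> are functions because \<open>chat \<eta>\<close> depends only on \<open>\<eta>\<close> and \<open>cl l\<close> only
  on \<open>l\<close>; plain nested quantifiers cannot express this. The remaining data may depend on \<open>l\<close>, \<open>\<eta>\<close>
  and \<open>c\<close>.\<close>

definition assumptions_A :: "real \<Rightarrow> real \<Rightarrow> bool" where
  "assumptions_A \<alpha> z \<longleftrightarrow>
    (\<exists>C1>1. \<exists>C2>1. \<exists>C3>1. \<exists>C4>1.
     \<exists>(chat :: real \<Rightarrow> real) (cl :: nat \<Rightarrow> real). \<exists>\<eta>0>0.
       \<forall>l \<eta>. 0 < \<eta> \<and> \<eta> < \<eta>0 \<longrightarrow> chat \<eta> > 0 \<and> cl l > 0 \<and>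
         (\<forall>c. 0 < c \<and> c < cl l \<longrightarrow>
           (\<exists>kc L k. conditions_A \<alpha> z C1 C2 C3 C4 l \<eta> (chat \<eta>) c kc L k)))"


definition nondisjoint_powers :: "real \<Rightarrow> (real \<Rightarrow> real) \<Rightarrow> nat \<Rightarrow> nat set" where
  "nondisjoint_powers z T n =
     {m. 0 < m \<and> m < n \<and>
        \<not> disjoint_maps (normalized_lebesgue {0..<z}) (T ^^ m)
                        (normalized_lebesgue {0..<z}) (T ^^ n)}"

end

theory Submission
  imports Defs "HOL-Computational_Algebra.Fundamental_Theorem_Algebra"
begin

text \<open>
  In fact \<open>T\<^sup>m\<close> and \<open>T\<^sup>n\<close> are disjoint for all \<open>0 < m < n\<close>, so every \<open>B\<^sub>n\<close> is empty.

  Let \<open>t\<close> be a multiple of \<open>q\<^sub>k\<close>, \<open>k = k\<^sub>i\<close>. Since \<open>R\<^sup>t\<close> is close to the identity and, by the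
  Denjoy--Koksma inequality, the number of visits to \<open>J\<close> before time \<open>t\<close> is almost constant, a power
  \<open>T\<^sup>K\<close> with \<open>K\<close> close to \<open>t z\<close> moves \<open>x\<close> close to \<open>T\<^sup>e x\<close> with a bounded drift \<open>e = e(x)\<close>. The level
  sets of the drift are almost invariant, hence equidistributed, so that \<open>T\<^sup>K\<close> converges weakly to
  \<open>\<Sum> p\<^sub>e T\<^sup>e\<close>, where \<open>p\<close> is the limit law of the drift. By (A1), (A2) and (A4) the drift at time
  \<open>q\<^sub>k\<close> takes two adjacent values with positive probability; hence \<open>T\<close> has no eigenfunctions.

  Write \<open>m = m' g\<close>, \<open>n = n' g\<close> with \<open>m'\<close>, \<open>n'\<close> coprime and choose \<open>r\<close> close to \<open>q\<^sub>k z / g\<close>. The conditional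
  expectations of a joining of \<open>T\<^sup>m\<close> and \<open>T\<^sup>n\<close> intertwine the weak limits of \<open>T\<^sup>m\<^sup>r\<close> and \<open>T\<^sup>n\<^sup>r\<close>.
  Eliminating one variable from this relation and \<open>X\<^sup>m = Y\<^sup>n\<close> gives a polynomial in \<open>T\<close> which
  annihilates the centred conditional expectations. Unless it is the zero polynomial, they vanish, as \<open>T\<close> has no
  eigenfunctions, and the joining is the product.

  If it is zero, then the drifts at the times \<open>m' q\<^sub>k\<close> and \<open>n' q\<^sub>k\<close> are multiples of \<open>m'\<close> and \<open>n'\<close>
  with the same law after division by \<open>m'\<close> and \<open>n'\<close>. For \<open>s\<close> a small multiple of \<open>q\<^sub>k\<close>, the increment
  \<open>\<psi>\<^sub>s(R\<^sup>N x) - \<psi>\<^sub>s(x)\<close> with \<open>N = n' q\<^sub>k\<close> is then divisible by \<open>n'\<close>, but smaller than \<open>n'\<close>, hence zero, with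
  probability tending to 1; likewise for \<open>m'\<close>, and by coprimality \<open>\<psi>\<^sub>s(R\<^sup>N x) = \<psi>\<^sub>s(x)\<close> for \<open>N = q\<^sub>k\<close>,
  contrary to (A4). (For \<open>m' = 1\<close> one compares second moments instead.)
\<close>

text \<open>Dividing by \<open>g\<close> lets one sequence of exponents serve both powers:
  \<open>m r\<close> and \<open>n r\<close> must stay within bounded distance of
  \<open>m' q_k z\<close> and \<open>n' q_k z\<close> simultaneously. Rounding up makes all drifts
  nonnegative, so only nonnegative powers of \<open>T\<close> occur in the limits; the drifts are
  bounded uniformly in \<open>k\<close>, so their laws exist along a subsequence. The limit laws are
  never computed. Information on them comes from visits during a time \<open>s\<close> of at most
  q_{k-1}: the points \<open>j \<alpha>\<close>, \<open>j < s\<close>, are then so sparse that a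
  shift by the error of q_k carries at most one of them across an end point of \<open>J\<close>,
  (A4) excluding simultaneous crossings at 0 and \<open>z\<close>. The visit cocycle is symmetric in
  the times \<open>s\<close> and q_k, which turns this into a statement on the drift at time q_k. By
  (A1) and (A2) the product of \<open>s\<close> and the error stays bounded below, so crossings do
  not become rare. The strict bound "smaller than n'" holds because two successive shifts never
  cross in the same direction. (A0) and (A6) together force k_i to tend to infinity.\<close>

section \<open>Continued fractions\<close>

fun cf_num :: "real \<Rightarrow> nat \<Rightarrow> nat" where
  "cf_num \<alpha> 0 = 0"
| "cf_num \<alpha> (Suc 0) = 1"
| "cf_num \<alpha> (Suc (Suc k)) =
     cf_quotient \<alpha> (Suc (Suc k)) * cf_num \<alpha> (Suc k) + cf_num \<alpha> k"

text \<open>For \<open>k >= 1\<close> the absolute value is the distance from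
  \<open>q_k \<alpha>\<close> to the integers; the sign is kept because consecutive errors lie on
  opposite sides of 0.\<close>

definition cf_err :: "real \<Rightarrow> nat \<Rightarrow> real" where
  "cf_err \<alpha> k = real (cf_denom \<alpha> k) * \<alpha> - real (cf_num \<alpha> k)"

locale unit_irrational =
  fixes \<alpha> :: real
  assumes alpha01: "\<alpha> \<in> {0<..<1}" and irrational: "\<alpha> \<notin> \<rat>"
begin

abbreviation "cq \<equiv> cf_complete_quotient \<alpha>"
abbreviation "pq \<equiv> cf_quotient \<alpha>"
abbreviation "qn \<equiv> cf_denom \<alpha>"
abbreviation "err \<equiv> cf_err \<alpha>"

lemma cq_irrational: "cq k \<notin> \<rat>"
proof (induction k)
  case (Suc k)
  show ?case
  proof
    assume "cq (Suc k) \<in> \<rat>"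
    then have "inverse (cq (Suc k)) \<in> \<rat>" by (rule Rats_inverse)
    then have "frac (cq k) \<in> \<rat>" by simp
    then have "frac (cq k) + of_int \<lfloor>cq k\<rfloor> \<in> \<rat>" by (intro Rats_add Rats_of_int)
    then show False using Suc by (simp add: frac_def)
  qed
qed (use irrational in simp)

lemma frac_cq: "0 < frac (cq k)" "frac (cq k) < 1"
  using cq_irrational[of k] Ints_subset_Rats by (auto simp: frac_gt_0_iff frac_lt_1)

lemma cq_gt_1: "1 < cq (Suc k)"
  using frac_cq[of k] by simp

lemma pq_real: "real (pq (Suc k)) = cq (Suc k) - frac (cq (Suc k))"
  using cq_gt_1[of k] by (simp add: cf_quotient_def frac_def del: cf_complete_quotient.simps)

lemma pq_ge_1: "1 \<le> pq (Suc k)"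
  using cq_gt_1[of k] by (simp add: cf_quotient_def le_nat_iff del: cf_complete_quotient.simps)

lemma err_0: "err 0 = \<alpha>"
  by (simp add: cf_err_def)

lemma err_Suc_Suc: "err (Suc (Suc k)) = pq (Suc (Suc k)) * err (Suc k) + err k"
  by (simp add: cf_err_def algebra_simps)

text \<open>Each complete quotient is the reciprocal of the fractional part of its predecessor, so
  the recurrence for the errors collapses to multiplication by a factor in (-1,0). Alternating signs
  and decreasing absolute values are read off from this form.\<close>

lemma err_Suc: "err (Suc k) = - err k * frac (cq (Suc k))"
proof (induction k)
  case 0
  have "frac \<alpha> = \<alpha>" using alpha01 by (simp add: frac_eq)
  then have "cq 1 * \<alpha> = 1" using alpha01 by simp
  moreover have "real (pq 1) = cq 1 - frac (cq 1)" using pq_real[of 0] by simp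
  ultimately have "\<alpha> * (frac (cq 1) + pq 1) = 1" by (simp only: algebra_simps)
  then show ?case
    by (simp add: cf_err_def algebra_simps del: cf_complete_quotient.simps)
next
  case (Suc k)
  have "cq (Suc (Suc k)) * frac (cq (Suc k)) = 1"
    using frac_cq[of "Suc k"] by simp
  then have "err k = - err (Suc k) * cq (Suc (Suc k))"
    using Suc by (simp add: algebra_simps del: cf_complete_quotient.simps)
  then show ?case
    by (simp only: err_Suc_Suc pq_real) (simp add: algebra_simps del: cf_complete_quotient.simps)
qed

lemma err_nz: "err k \<noteq> 0"
proof (induction k)
  case (Suc k)
  then show ?case using frac_cq[of "Suc k"] err_Suc[of k] by simp
qed (use alpha01 in \<open>simp add: err_0\<close>)

lemma abs_err_less: "\<bar>err (Suc k)\<bar> < \<bar>err k\<bar>"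
  using frac_cq[of "Suc k"] err_nz[of k] by (simp add: err_Suc abs_mult del: cf_complete_quotient.simps)

lemma err_opposite: "err (Suc k) * err k < 0"
  using frac_cq[of "Suc k"] err_nz[of k]
  by (simp add: err_Suc mult_less_0_iff zero_less_mult_iff del: cf_complete_quotient.simps) argo

lemma abs_err_rec:
  "\<bar>err k\<bar> = pq (Suc (Suc k)) * \<bar>err (Suc k)\<bar> + \<bar>err (Suc (Suc k))\<bar>"
proof -
  have a: "err (Suc k) * err k < 0" "err (Suc (Suc k)) * err (Suc k) < 0"
    by (rule err_opposite)+
  have e: "err k = err (Suc (Suc k)) - pq (Suc (Suc k)) * err (Suc k)"
    by (simp add: err_Suc_Suc)
  show ?thesis
  proof (cases "err (Suc k) > 0")
    case True
    then have "err k < 0" "err (Suc (Suc k)) < 0"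
      using a by (auto simp: mult_less_0_iff)
    then show ?thesis using True e by simp
  next
    case False
    then have "err (Suc k) < 0" using err_nz[of "Suc k"] by simp
    then have "err k > 0" "err (Suc (Suc k)) > 0" "err (Suc k) < 0"
      using a by (auto simp: mult_less_0_iff)
    then show ?thesis using e by simp
  qed
qed

lemma qn_pos: "0 < qn k"
proof (induction k rule: cf_denom.induct[of "\<lambda>_ k. 0 < qn k" \<alpha>, case_names 1 2 3])
  case (2 \<beta>)
  then show ?case using pq_ge_1[of 0] by simp
qed auto

lemma qn_mono: "qn k \<le> qn (Suc k)"
proof (cases k)
  case 0
  then show ?thesis using pq_ge_1[of 0] by simp
next
  case (Suc j)
  have "1 * qn (Suc j) \<le> pq (Suc (Suc j)) * qn (Suc j)"
    by (rule mult_right_mono[OF pq_ge_1]) simp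
  then have "qn (Suc j) \<le> pq (Suc (Suc j)) * qn (Suc j) + qn j" by linarith
  then show ?thesis using Suc by (simp only: cf_denom.simps)
qed

lemma qn_Suc_Suc_ge: "qn (Suc k) + qn k \<le> qn (Suc (Suc k))"
  using pq_ge_1[of "Suc k"] by simp

lemma qn_ge: "k \<le> qn k"
proof (induction k rule: cf_denom.induct[of "\<lambda>_ k. k \<le> qn k" \<alpha>, case_names 1 2 3])
  case (2 \<beta>)
  then show ?case using pq_ge_1[of 0] by simp
next
  case (3 \<beta> k)
  then show ?case using qn_Suc_Suc_ge[of k] qn_pos[of k] by linarith
qed auto

lemma qn_mono': "i \<le> j \<Longrightarrow> qn i \<le> qn j"
  using lift_Suc_mono_le[of qn] qn_mono by blast

lemma cf_det:
  "int (cf_num \<alpha> (Suc k)) * qn k - int (cf_num \<alpha> k) * qn (Suc k) = (-1) ^ k"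
proof (induction k)
  case (Suc k)
  have "int (cf_num \<alpha> (Suc (Suc k))) * qn (Suc k) - int (cf_num \<alpha> (Suc k)) * qn (Suc (Suc k))
    = - (int (cf_num \<alpha> (Suc k)) * qn k - int (cf_num \<alpha> k) * qn (Suc k))"
    by (simp add: algebra_simps)
  then show ?case using Suc by simp
qed simp

text \<open>In \<open>q_{k+1} err_k - q_k err_{k+1}\<close> the terms with \<alpha> cancel and the
  determinant +-1 remains; the opposite signs of the errors turn the absolute value into a sum. Both
  bounds for \<open>|err_k|\<close> below come from it.\<close>

lemma qn_err_sum: "qn (Suc k) * \<bar>err k\<bar> + qn k * \<bar>err (Suc k)\<bar> = 1"
proof -
  have "qn (Suc k) * err k - qn k * err (Suc k)
    = real_of_int (int (cf_num \<alpha> (Suc k)) * qn k - int (cf_num \<alpha> k) * qn (Suc k))"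
    by (simp add: cf_err_def algebra_simps)
  then have d: "qn (Suc k) * err k - qn k * err (Suc k) = (-1) ^ k"
    by (simp only: cf_det) simp
  have "\<bar>qn (Suc k) * err k - qn k * err (Suc k)\<bar> = 1"
    unfolding d by simp
  moreover have "\<bar>qn (Suc k) * err k - qn k * err (Suc k)\<bar>
      = qn (Suc k) * \<bar>err k\<bar> + qn k * \<bar>err (Suc k)\<bar>"
  proof (cases "err k > 0")
    case True
    then have "err (Suc k) < 0" using err_opposite[of k] by (auto simp: mult_less_0_iff)
    then have "qn k * err (Suc k) \<le> 0" by (simp add: mult_nonneg_nonpos)
    moreover have "qn (Suc k) * err k \<ge> 0" using True by simp
    ultimately show ?thesis using True \<open>err (Suc k) < 0\<close>
      by (simp only: abs_of_pos abs_of_neg)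
  next
    case False
    then have k: "err k < 0" using err_nz[of k] by simp
    then have s: "err (Suc k) > 0" using err_opposite[of k] by (auto simp: mult_less_0_iff)
    then have "qn k * err (Suc k) \<ge> 0" by simp
    moreover have "qn (Suc k) * err k \<le> 0" using k by (simp add: mult_nonneg_nonpos)
    ultimately have "\<bar>qn (Suc k) * err k - qn k * err (Suc k)\<bar> = - (qn (Suc k) * err k - qn k * err (Suc k))"
      by (intro abs_of_nonpos) linarith
    then show ?thesis using k s by simp
  qed
  ultimately show ?thesis by simp
qed

lemma abs_err_upper: "qn (Suc k) * \<bar>err k\<bar> < 1"
  using qn_err_sum[of k] qn_pos[of k] err_nz[of "Suc k"]
    mult_pos_pos[of "real (qn k)" "\<bar>err (Suc k)\<bar>"] by linarith

lemma abs_err_lower: "1 \<le> (qn (Suc k) + qn k) * \<bar>err k\<bar>"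
  using qn_err_sum[of k] abs_err_less[of k]
    mult_left_mono[of "\<bar>err (Suc k)\<bar>" "\<bar>err k\<bar>" "real (qn k)"]
  by (simp add: algebra_simps)

lemma cf_coprime: "coprime (qn k) (cf_num \<alpha> k)"
proof (rule coprimeI)
  fix c assume c: "c dvd qn k" "c dvd cf_num \<alpha> k"
  then have "int c dvd int (cf_num \<alpha> (Suc k)) * qn k - int (cf_num \<alpha> k) * qn (Suc k)"
    by (intro dvd_diff dvd_mult dvd_mult2) auto
  then have "int c dvd (-1) ^ k" unfolding cf_det .
  then have "int c dvd 1" by (metis dvd_minus_iff minus_one_power_iff)
  then show "c dvd 1" by simp
qed

text \<open>Two consecutive convergents form a basis of the integer lattice. As
  \<open>0 < i < q_{k+1}\<close>, the coordinate \<open>u\<close> of \<open>(i, P)\<close> is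
  nonzero and \<open>u\<close>, \<open>v\<close> do not have the same sign, whereas the two errors
  have opposite signs; so the contributions of \<open>u\<close> and \<open>v\<close> to
  \<open>i \<alpha> - P\<close> cannot cancel.\<close>

lemma best_approximation:
  fixes i :: nat and P :: int
  assumes "0 < i" "i < qn (Suc k)"
  shows "\<bar>err k\<bar> \<le> \<bar>i * \<alpha> - P\<bar>"
proof -
  define q p q' p' where "q = int (qn k)" and "p = int (cf_num \<alpha> k)"
    and "q' = int (qn (Suc k))" and "p' = int (cf_num \<alpha> (Suc k))"
  define s where "s = (-1 :: int) ^ k"
  have det: "p' * q - p * q' = s" using cf_det[of k] by (simp add: p_def q_def p'_def q'_def s_def)
  have ss: "s * s = 1" by (simp add: s_def flip: power_mult_distrib)
  \<comment> \<open>Cramer's rule; the determinant \<open>s\<close> is its own inverse.\<close>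
  define u v where "u = s * (p' * int i - q' * P)" and "v = s * (q * P - p * int i)"
  have "u * q + v * q' = s * ((p' * q - p * q') * int i)"
    by (simp add: u_def v_def algebra_simps)
  then have i: "u * q + v * q' = int i" by (simp add: det flip: mult.assoc) (simp add: ss)
  have "u * p + v * p' = s * ((p' * q - p * q') * P)"
    by (simp add: u_def v_def algebra_simps)
  then have P: "u * p + v * p' = P" by (simp add: det flip: mult.assoc) (simp add: ss)
  have val: "i * \<alpha> - P = u * err k + v * err (Suc k)"
  proof -
    have "i * \<alpha> - P = real_of_int (u * q + v * q') * \<alpha> - real_of_int (u * p + v * p')"
      by (simp add: i P)
    also have "\<dots> = u * err k + v * err (Suc k)"
      by (simp add: cf_err_def q_def p_def q'_def p'_def algebra_simps)
    finally show ?thesis .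
  qed
  have q0: "q > 0" "q' > 0"
    using qn_pos by (auto simp: q_def q'_def)
  have iq: "0 < int i" "int i < q'" using assms by (auto simp: q'_def)
  have u0: "u \<noteq> 0"
  proof
    assume "u = 0"
    then have "v * q' = int i" using i by simp
    moreover have "v \<ge> 1"
      using iq(1) q0(2) \<open>v * q' = int i\<close> by (metis zero_less_mult_pos2 zless_imp_add1_zle add_0)
    ultimately have "q' \<le> int i" using q0 mult_right_mono[of 1 v q'] by simp
    then show False using iq by simp
  qed
  have uv: "u * v \<le> 0"
  proof (rule ccontr)
    assume "\<not> ?thesis"
    then consider "u \<ge> 1" "v \<ge> 1" | "u \<le> -1" "v \<le> -1"
      by (smt (verit) mult_nonneg_nonpos mult_nonneg_nonpos2 mult_nonpos_nonneg zero_le_mult_iff)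
    then show False
    proof cases
      case 1
      then have "q' \<le> v * q'" "0 \<le> u * q" using q0 by auto
      then show False using i iq by linarith
    next
      case 2
      then have "v * q' \<le> 0" "u * q \<le> 0" using q0 by (auto simp: mult_nonpos_nonneg)
      then show False using i iq by linarith
    qed
  qed
  have same: "(u * err k) * (v * err (Suc k)) \<ge> 0"
  proof -
    have "(u * err k) * (v * err (Suc k)) = real_of_int (u * v) * (err (Suc k) * err k)"
      by simp
    moreover have "real_of_int (u * v) \<le> 0" using uv by (simp only: of_int_le_0_iff)
    ultimately show ?thesis using err_opposite[of k] by (metis less_imp_le mult_nonpos_nonpos)
  qed
  have "\<bar>u * err k\<bar> \<le> \<bar>u * err k + v * err (Suc k)\<bar>"
    using same by (smt (verit) mult_neg_pos mult_pos_neg)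
  moreover have "\<bar>err k\<bar> \<le> \<bar>u * err k\<bar>"
  proof -
    have "1 \<le> \<bar>real_of_int u\<bar>" using u0 by linarith
    then show ?thesis by (simp add: abs_mult mult_le_cancel_right1)
  qed
  ultimately show ?thesis using val by simp
qed

end

section \<open>Denjoy--Koksma estimate\<close>

lemma card_ints_in_open_interval:
  fixes u v :: real and H :: "int set"
  assumes "\<And>h. h \<in> H \<Longrightarrow> u < h \<and> h < v" and "u < v"
  shows "finite H" "card H \<le> v - u + 1"
proof -
  have sub: "H \<subseteq> {\<lfloor>u\<rfloor> + 1 .. \<lceil>v\<rceil> - 1}"
  proof
    fix h assume "h \<in> H"
    then have "u < h" "h < v" using assms by auto
    then show "h \<in> {\<lfloor>u\<rfloor> + 1 .. \<lceil>v\<rceil> - 1}"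
      by (auto simp: floor_less_iff less_ceiling_iff add1_zle_eq)
  qed
  then show "finite H" by (rule finite_subset) simp
  have "card H \<le> card {\<lfloor>u\<rfloor> + 1 .. \<lceil>v\<rceil> - 1}" by (rule card_mono[OF _ sub]) simp
  also have "\<dots> = nat (\<lceil>v\<rceil> - 1 - \<lfloor>u\<rfloor>)" by simp
  finally have c: "card H \<le> nat (\<lceil>v\<rceil> - 1 - \<lfloor>u\<rfloor>)" .
  have "real (nat (\<lceil>v\<rceil> - 1 - \<lfloor>u\<rfloor>)) \<le> v - u + 1"
  proof (cases "0 \<le> \<lceil>v\<rceil> - 1 - \<lfloor>u\<rfloor>")
    case True
    then have "real (nat (\<lceil>v\<rceil> - 1 - \<lfloor>u\<rfloor>)) = real_of_int (\<lceil>v\<rceil> - 1 - \<lfloor>u\<rfloor>)" by simp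
    also have "\<dots> \<le> v - u + 1" by linarith
    finally show ?thesis .
  qed (use assms(2) in simp)
  then show "card H \<le> v - u + 1" using c by linarith
qed

context unit_irrational
begin

text \<open>Modulo \<open>q\<close> the integer \<open>h j\<close> is \<open>j p\<close>, so
  \<open>h\<close> is injective on \<open>j < q\<close>. On the other hand \<open>h j\<close>
  differs from \<open>q (frac (x + j \<alpha>) - x)\<close> by less than 1. The orbit points in
  question thus correspond to distinct integers in an open interval of length
  \<open>q (b - a) + 2\<close>.\<close>

lemma card_orbit_interval_le:
  fixes x a b :: real
  assumes "a \<le> b"
  shows "card {j. j < qn k \<and> frac (x + j * \<alpha>) \<in> {a..<b}} \<le> qn k * (b - a) + 3"
proof -
  define q p where "q = qn k" and "p = cf_num \<alpha> k"
  define h where "h j = int j * p - q * \<lfloor>x + j * \<alpha>\<rfloor>" for j :: nat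
  define A where "A = {j. j < q \<and> frac (x + j * \<alpha>) \<in> {a..<b}}"
  have e1: "\<bar>j * err k\<bar> < 1" if "j < q" for j
  proof -
    have "\<bar>j * err k\<bar> \<le> qn (Suc k) * \<bar>err k\<bar>"
      using that qn_mono[of k] by (auto simp: abs_mult q_def intro!: mult_right_mono)
    then show ?thesis using abs_err_upper[of k] by linarith
  qed
  have hq: "h j = q * frac (x + j * \<alpha>) - q * x - j * err k" for j
    by (simp add: h_def frac_def cf_err_def q_def p_def algebra_simps)
  have inj: "inj_on h A"
  proof
    fix i j assume ij: "i \<in> A" "j \<in> A" "h i = h j"
    then have "(int i - int j) * p = q * (\<lfloor>x + i * \<alpha>\<rfloor> - \<lfloor>x + j * \<alpha>\<rfloor>)"
      by (simp add: h_def algebra_simps)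
    then have "int q dvd (int i - int j) * p" by simp
    then have "int q dvd int i - int j"
      using cf_coprime[of k] by (simp add: coprime_dvd_mult_left_iff q_def p_def)
    moreover have "\<bar>int i - int j\<bar> < int q" using ij by (auto simp: A_def)
    ultimately have "int i - int j = 0"
      by (metis dvd_imp_le_int abs_of_nat not_le)
    then show "i = j" by simp
  qed
  have "q * a - q * x - 1 < h j \<and> h j < q * b - q * x + 1" if "j \<in> A" for j
  proof -
    have "a \<le> frac (x + j * \<alpha>)" "frac (x + j * \<alpha>) \<le> b" using that by (auto simp: A_def)
    then have "q * a \<le> q * frac (x + j * \<alpha>)" "q * frac (x + j * \<alpha>) \<le> q * b"
      by (auto intro!: mult_left_mono)
    moreover have "\<bar>j * err k\<bar> < 1" using that by (intro e1) (simp add: A_def)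
    ultimately show ?thesis unfolding hq by linarith
  qed
  then have "card (h ` A) \<le> (q * b - q * x + 1) - (q * a - q * x - 1) + 1"
    using assms mult_left_mono[of a b "real q"] by (intro card_ints_in_open_interval(2)) auto
  then show ?thesis
    using card_image[OF inj] by (simp add: A_def q_def algebra_simps)
qed

text \<open>The lower bound is the upper bound for the complementary interval. The constant 3
  reappears in \<open>return_time\<close>.\<close>

lemma denjoy_koksma:
  fixes x a :: real
  assumes "0 \<le> a" "a \<le> 1"
  shows "\<bar>card {j. j < qn k \<and> frac (x + j * \<alpha>) \<in> {0..<a}} - qn k * a\<bar> \<le> 3"
proof -
  let ?A = "{j. j < qn k \<and> frac (x + j * \<alpha>) \<in> {0..<a}}"
  let ?B = "{j. j < qn k \<and> frac (x + j * \<alpha>) \<in> {a..<1}}"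
  have "?A \<union> ?B = {..<qn k}" using assms by (auto simp: frac_lt_1 not_less)
  moreover have "?A \<inter> ?B = {}" by auto
  ultimately have "card ?A + card ?B = qn k"
    by (metis (no_types, lifting) card_Un_disjoint card_lessThan finite_Un finite_lessThan)
  then have "real (card ?A) + card ?B = qn k" by linarith
  then show ?thesis
    using card_orbit_interval_le[of 0 a k x] card_orbit_interval_le[of a 1 k x] assms
    by (simp add: algebra_simps)
qed

end

section \<open>The circle\<close>

definition circle :: "real measure" where
  "circle = restrict_space lborel {0..<1}"

lemma space_circle [simp]: "space circle = {0..<1}"
  by (simp add: circle_def)

lemma sets_circle: "sets circle = {B. B \<in> sets borel \<and> B \<subseteq> {0..<1}}"
  by (auto simp: circle_def sets_restrict_space image_iff)

lemma emeasure_circle: "B \<in> sets circle \<Longrightarrow> emeasure circle B = emeasure lborel B"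
  by (auto simp: circle_def emeasure_restrict_space sets_restrict_space)

lemma measurable_circle: "f \<in> borel_measurable borel \<Longrightarrow> f \<in> borel_measurable circle"
  by (auto simp: circle_def intro!: measurable_restrict_space1)

lemma emeasure_circle_space: "emeasure circle {0..<1} = 1"
  by (simp add: emeasure_circle sets_circle)

interpretation circle: finite_measure circle
  by standard (simp add: emeasure_circle_space)

lemma frac_shift_measurable: "(\<lambda>x. frac (x + c)) \<in> measurable circle circle"
proof -
  have "(\<lambda>x::real. frac (x + c)) \<in> borel_measurable borel"
    unfolding frac_def by measurable
  then have "(\<lambda>x::real. frac (x + c)) \<in> measurable circle borel"
    by (rule measurable_circle)
  then have "(\<lambda>x. frac (x + c)) \<in> measurable circle (restrict_space borel {0..<1})"
    by (intro measurable_restrict_space2) (auto simp: frac_lt_1)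
  also have "measurable circle (restrict_space borel {0..<1}) = measurable circle circle"
    by (rule measurable_cong_sets) (auto simp: circle_def sets_restrict_space)
  finally show ?thesis .
qed

lemma emeasure_lborel_vimage_plus:
  "B \<in> sets borel \<Longrightarrow> emeasure lborel ((+) c -` B) = emeasure lborel (B :: real set)"
  using emeasure_distr[of "(+) c" lborel borel B] by (simp add: lborel_distr_plus)

lemma distr_frac_shift: "distr circle circle (\<lambda>x. frac (x + c)) = circle"
proof (rule measure_eqI)
  fix B assume "B \<in> sets (distr circle circle (\<lambda>x. frac (x + c)))"
  then have B: "B \<in> sets circle" by simp
  define d where "d = frac c"
  have d: "0 \<le> d" "d < 1" by (auto simp: d_def frac_lt_1)
  have fr: "frac (x + c) = (if x + d < 1 then x + d else x + (d - 1))" if "x \<in> {0..<1}" for x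
  proof -
    have "x + c = x + d + of_int \<lfloor>c\<rfloor>" by (simp add: d_def frac_def)
    then have "frac (x + c) = frac (x + d)" by (metis frac_add_of_int_right)
    also have "\<dots> = (if x + d < 1 then x + d else x + (d - 1))"
      using that d by (auto simp: frac_def floor_eq_iff) 
    finally show ?thesis .
  qed
  \<comment> \<open>Splits \<open>B\<close> according to whether the shift by \<open>d\<close>
    reaches it directly or after wrapping around 1.\<close>
  define B1 B2 where "B1 = B \<inter> {d..<1}" and "B2 = B \<inter> {0..<d}"
  have Bm: "B1 \<in> sets borel" "B2 \<in> sets borel" "B \<in> sets borel" "B \<subseteq> {0..<1}"
    using B by (auto simp: B1_def B2_def sets_circle)
  have vm: "(+) c -` C \<in> sets borel" if "C \<in> sets borel" for C and c :: real
    using measurable_sets[of "(+) c" borel borel C] that by simp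
  have pre: "(\<lambda>x. frac (x + c)) -` B \<inter> {0..<1} = (+) d -` B1 \<union> (+) (d - 1) -` B2"
    using fr d Bm(4) by (auto simp: B1_def B2_def add.commute split: if_splits)
  have "emeasure (distr circle circle (\<lambda>x. frac (x + c))) B
      = emeasure circle ((\<lambda>x. frac (x + c)) -` B \<inter> {0..<1})"
    using B frac_shift_measurable by (simp add: emeasure_distr)
  also have "\<dots> = emeasure lborel ((+) d -` B1 \<union> (+) (d - 1) -` B2)"
    unfolding pre[symmetric]
    using measurable_sets[OF frac_shift_measurable B, of c] by (simp add: emeasure_circle)
  also have "\<dots> = emeasure lborel ((+) d -` B1) + emeasure lborel ((+) (d - 1) -` B2)"
    by (intro plus_emeasure[symmetric]) (auto simp: Bm vm, auto simp: B1_def B2_def)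
  also have "\<dots> = emeasure lborel B1 + emeasure lborel B2"
    by (simp only: emeasure_lborel_vimage_plus[OF Bm(1)] emeasure_lborel_vimage_plus[OF Bm(2)])
  also have "\<dots> = emeasure lborel (B1 \<union> B2)"
    by (intro plus_emeasure) (auto simp: Bm, auto simp: B1_def B2_def)
  also have "B1 \<union> B2 = B" using Bm(4) by (auto simp: B1_def B2_def)
  finally show "emeasure (distr circle circle (\<lambda>x. frac (x + c))) B = emeasure circle B"
    using B by (simp add: emeasure_circle)
qed simp

lemma integral_frac_shift:
  fixes G :: "real \<Rightarrow> 'b :: {banach, second_countable_topology}"
  assumes "G \<in> borel_measurable circle"
  shows "(LINT x|circle. G (frac (x + c))) = (LINT x|circle. G x)"
proof -
  have "(LINT x|circle. G x) = (LINT x|distr circle circle (\<lambda>x. frac (x + c)). G x)"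
    by (simp add: distr_frac_shift)
  also have "\<dots> = (LINT x|circle. G (frac (x + c)))"
    by (rule integral_distr[OF frac_shift_measurable assms])
  finally show ?thesis by simp
qed

lemma integrable_frac_shift:
  fixes G :: "real \<Rightarrow> 'b :: {banach, second_countable_topology}"
  assumes "integrable circle G"
  shows "integrable circle (\<lambda>x. G (frac (x + c)))"
  using assms integrable_distr[OF frac_shift_measurable, of c G] by (simp add: distr_frac_shift)

text \<open>Dynkin's argument. The half-lines generating the Borel sets meet the circle in intervals
  \<open>[0, a)\<close>, the sets for which Denjoy--Koksma gives direct information.\<close>

lemma circle_sets_induct [consumes 1, case_names interval compl union]:
  assumes B: "B \<in> sets circle"
    and interval: "\<And>a. 0 \<le> a \<Longrightarrow> a \<le> 1 \<Longrightarrow> P {0..<a}"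
    and compl: "\<And>A. A \<in> sets circle \<Longrightarrow> P A \<Longrightarrow> P ({0..<1} - A)"
    and union: "\<And>A :: nat \<Rightarrow> real set. disjoint_family A \<Longrightarrow> range A \<subseteq> sets circle \<Longrightarrow>
      (\<And>i. P (A i)) \<Longrightarrow> P (\<Union>i. A i)"
  shows "P B"
proof -
  have Bb: "B \<in> sigma_sets UNIV (range (lessThan :: real \<Rightarrow> _))"
    using B by (auto simp: sets_circle borel_Iio)
  have Int: "Int_stable (range (lessThan :: real \<Rightarrow> _))"
    by (auto simp: Int_stable_def intro: image_eqI[of _ _ "min _ _"])
  have bor: "A \<in> sets borel" if "A \<in> sigma_sets UNIV (range (lessThan :: real \<Rightarrow> _))" for A
    using that by (auto simp: borel_Iio)
  have "P (B \<inter> {0..<1})"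
    using Int subset_UNIV[of "range lessThan", folded Pow_UNIV] Bb
  proof (induction rule: sigma_sets_induct_disjoint)
    case (basic A)
    then obtain a where A: "A = {..<a}" by auto
    have "A \<inter> {0..<1} = {0..<max 0 (min a 1)}" using A by auto
    then show ?case using interval[of "max 0 (min a 1)"] by simp
  next
    case empty
    then show ?case using interval[of 0] by simp
  next
    case (compl A)
    have "(UNIV - A) \<inter> {0..<1} = {0..<1} - A \<inter> {0..<1}" by auto
    moreover have "A \<inter> {0..<1} \<in> sets circle" using bor[OF compl(1)] by (auto simp: sets_circle)
    ultimately show ?case using assms(3) compl(2) by simp
  next
    case (union A)
    have "(\<Union>i. A i) \<inter> {0..<1} = (\<Union>i. A i \<inter> {0..<1})" by auto
    moreover have "disjoint_family (\<lambda>i. A i \<inter> {0..<1})"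
      using union(1) by (auto simp: disjoint_family_on_def)
    moreover have "range (\<lambda>i. A i \<inter> {0..<1}) \<subseteq> sets circle"
      using union(2) bor by (auto simp: sets_circle)
    ultimately show ?case using assms(4)[of "\<lambda>i. A i \<inter> {0..<1}"] union(3) by simp
  qed
  then show ?thesis using B by (simp add: sets_circle Int_absorb2)
qed

text \<open>The density argument shared by three limit statements: continuity of translations in
  \<open>L^1\<close>, equidistribution of almost invariant sets, and ergodicity of the rotation.
  Linear combinations and, by the uniform bound, \<open>L^1\<close> limits stay in the class of good
  functions.\<close>

lemma L1_seminorms_tendsto_0:
  fixes N :: "nat \<Rightarrow> (real \<Rightarrow> 'b :: {banach, second_countable_topology}) \<Rightarrow> real"
  assumes nonneg: "\<And>i G. 0 \<le> N i G"
    and add: "\<And>i G H. integrable circle G \<Longrightarrow> integrable circle H \<Longrightarrow>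
      N i (\<lambda>x. G x + H x) \<le> N i G + N i H"
    and minus: "\<And>i G. integrable circle G \<Longrightarrow> N i (\<lambda>x. - G x) = N i G"
    and bound: "\<And>i G. integrable circle G \<Longrightarrow> N i G \<le> C * (LINT x|circle. norm (G x))"
    and interval: "\<And>a v. 0 \<le> a \<Longrightarrow> a \<le> 1 \<Longrightarrow>
      (\<lambda>i. N i (\<lambda>x. indicator {0..<a} x *\<^sub>R v)) \<longlonglongrightarrow> 0"
    and G: "integrable circle G"
  shows "(\<lambda>i. N i G) \<longlonglongrightarrow> 0"
proof -
  have Npos: "(\<lambda>i. N i G) \<longlonglongrightarrow> 0" if "\<And>e. e > 0 \<Longrightarrow> eventually (\<lambda>i. N i G < e) sequentially" for G
  proof (rule order_tendstoI)
    fix l :: real assume "l < 0"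
    then have "l < N i G" for i using nonneg[of i G] by linarith
    then show "eventually (\<lambda>i. l < N i G) sequentially" by simp
  qed (rule that)
  \<comment> \<open>The uniform bound first fixes an approximant \<open>s k\<close>; only then is
    \<open>i\<close> taken large.\<close>
  have Lim: "(\<lambda>i. N i G) \<longlonglongrightarrow> 0"
    if s: "\<And>k. integrable circle (s k)" "\<And>k. (\<lambda>i. N i (s k)) \<longlonglongrightarrow> 0" and G: "integrable circle G"
      and lim: "(\<lambda>k. LINT x|circle. norm (G x - s k x)) \<longlonglongrightarrow> 0" for s G
  proof (rule Npos)
    fix e :: real assume e: "e > 0"
    define D where "D = \<bar>C\<bar> + 1"
    have D: "D > 0" by (simp add: D_def)
    then have "eventually (\<lambda>k. (LINT x|circle. norm (G x - s k x)) < e / (2 * D)) sequentially"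
      using e by (intro order_tendstoD(2)[OF lim]) simp
    then obtain k where k: "(LINT x|circle. norm (G x - s k x)) < e / (2 * D)"
      by (auto simp: eventually_sequentially)
    have "C * (LINT x|circle. norm (G x - s k x)) \<le> D * (LINT x|circle. norm (G x - s k x))"
      by (intro mult_right_mono) (auto simp: D_def)
    also have "\<dots> < D * (e / (2 * D))" using D by (intro mult_strict_left_mono k)
    also have "\<dots> = e / 2" using D by simp
    finally have small: "C * (LINT x|circle. norm (G x - s k x)) < e / 2" .
    have "eventually (\<lambda>i. N i (s k) < e / 2) sequentially"
      using e by (intro order_tendstoD(2)[OF s(2)]) simp
    then show "eventually (\<lambda>i. N i G < e) sequentially"
    proof eventually_elim
      case (elim i)
      have int: "integrable circle (\<lambda>x. G x - s k x)" using s(1) G by simp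
      have "N i G = N i (\<lambda>x. s k x + (G x - s k x))" by simp
      also have "\<dots> \<le> N i (s k) + N i (\<lambda>x. G x - s k x)" by (rule add[OF s(1) int])
      also have "\<dots> \<le> N i (s k) + C * (LINT x|circle. norm (G x - s k x))"
        using bound[OF int] by simp
      finally show ?case using elim small by simp
    qed
  qed
  have Add: "(\<lambda>i. N i (\<lambda>x. G x + H x)) \<longlonglongrightarrow> 0"
    if "(\<lambda>i. N i G) \<longlonglongrightarrow> 0" "(\<lambda>i. N i H) \<longlonglongrightarrow> 0" "integrable circle G" "integrable circle H" for G H
  proof (rule tendsto_sandwich)
    show "eventually (\<lambda>i. 0 \<le> N i (\<lambda>x. G x + H x)) sequentially" using nonneg by simp
    show "eventually (\<lambda>i. N i (\<lambda>x. G x + H x) \<le> N i G + N i H) sequentially"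
      using add[OF that(3,4)] by simp
    show "(\<lambda>i. N i G + N i H) \<longlonglongrightarrow> 0" using tendsto_add[OF that(1,2)] by simp
  qed simp
  have int_ind: "integrable circle (\<lambda>x. indicator A x *\<^sub>R v)" if "A \<in> sets circle" for A and v :: 'b
    using that
    by (intro integrable_scaleR_left integrable_real_indicator) (simp_all add: circle.emeasure_eq_measure)
  have zero: "(\<lambda>i. N i (\<lambda>x. 0)) \<longlonglongrightarrow> 0" using interval[of 0 0] by simp
  have Cong: "(\<lambda>i. N i H) \<longlonglongrightarrow> 0"
    if "(\<lambda>i. N i G) \<longlonglongrightarrow> 0" "integrable circle G" "\<And>x. x \<in> {0..<1} \<Longrightarrow> G x = H x" for G H
  proof -
    have H: "integrable circle H"
      by (rule Bochner_Integration.integrable_cong[THEN iffD1, OF refl _ that(2)]) (simp add: that(3))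
    have "(LINT x|circle. norm (H x - G x)) = (LINT x|circle. 0)"
      by (rule Bochner_Integration.integral_cong) (auto simp: that(3))
    then show ?thesis by (intro Lim[OF that(2) that(1) H]) simp
  qed
  have sets: "(\<lambda>i. N i (\<lambda>x. indicator A x *\<^sub>R v)) \<longlonglongrightarrow> 0" if "A \<in> sets circle" for A v
    using that
  proof (induction rule: circle_sets_induct)
    case (interval a)
    then show ?case by (rule assms(5))
  next
    case (compl A)
    have "(\<lambda>i. N i (\<lambda>x. indicator {0..<1} x *\<^sub>R v + - (indicator A x *\<^sub>R v))) \<longlonglongrightarrow> 0"
    proof (rule Add[OF assms(5)])
      show "(\<lambda>i. N i (\<lambda>x. - (indicator A x *\<^sub>R v))) \<longlonglongrightarrow> 0"
        using compl(2) minus[OF int_ind[OF compl(1)]] by simp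
      show "integrable circle (\<lambda>x. - (indicator A x *\<^sub>R v))"
        by (intro integrable_minus int_ind compl)
    qed (auto intro!: int_ind simp: sets_circle)
    moreover have "integrable circle (\<lambda>x. indicator {0..<1} x *\<^sub>R v + - (indicator A x *\<^sub>R v))"
      by (intro Bochner_Integration.integrable_add integrable_minus int_ind compl(1)) (simp add: sets_circle)
    ultimately show ?case
      by (rule Cong) (auto simp: indicator_def)
  next
    case (union A)
    define s where "s k = (\<lambda>x. indicator (\<Union>i<k. A i) x *\<^sub>R v)" for k :: nat
    have Am: "A i \<in> sets circle" for i using union(2) by auto
    have a: "(\<lambda>i. N i (s k)) \<longlonglongrightarrow> 0" for k
    proof (induction k)
      case 0
      then show ?case by (simp add: s_def zero)
    next
      case (Suc k)
      have "s (Suc k) x = s k x + indicator (A k) x *\<^sub>R v" for x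
      proof -
        have "A k \<inter> A i = {}" if "i < k" for i
          using union(1) that by (intro disjoint_family_onD) auto
        then have "A k \<inter> (\<Union>i<k. A i) = {}" by blast
        then show ?thesis by (auto simp: s_def lessThan_Suc indicator_def)
      qed
      then have "s (Suc k) = (\<lambda>x. s k x + indicator (A k) x *\<^sub>R v)" by blast
      moreover have "integrable circle (s k)"
        unfolding s_def by (intro int_ind sets.finite_UN) (auto simp: Am)
      ultimately show ?case
        using Add[OF Suc union(3)[of k] _ int_ind[OF Am]] by (simp only:)
    qed
    have "(\<lambda>k. LINT x|circle. norm (indicator (\<Union>i. A i) x *\<^sub>R v - s k x)) \<longlonglongrightarrow> (LINT x|circle. 0)"
    proof (rule integral_dominated_convergence[where w = "\<lambda>_. norm v"])
      show "(\<lambda>x. norm (indicator (\<Union>i. A i) x *\<^sub>R v - s k x)) \<in> borel_measurable circle" for k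
        unfolding s_def
        by (intro borel_measurable_integrable integrable_norm Bochner_Integration.integrable_diff int_ind
            sets.finite_UN sets.countable_UN) (auto simp: Am)
      show "AE x in circle. (\<lambda>k. norm (indicator (\<Union>i. A i) x *\<^sub>R v - s k x)) \<longlonglongrightarrow> 0"
      proof (rule AE_I2)
        fix x
        show "(\<lambda>k. norm (indicator (\<Union>i. A i) x *\<^sub>R v - s k x)) \<longlonglongrightarrow> 0"
        proof (cases "x \<in> (\<Union>i. A i)")
          case True
          then obtain j where j: "x \<in> A j" by auto
          have "eventually (\<lambda>k. norm (indicator (\<Union>i. A i) x *\<^sub>R v - s k x) = 0) sequentially"
            using eventually_gt_at_top[of j]
          proof eventually_elim
            case (elim k)
            then have "x \<in> (\<Union>i<k. A i)" using j by blast
            then show ?case using True by (simp add: s_def)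
          qed
          then show ?thesis by (rule tendsto_eventually)
        next
          case False
          then show ?thesis by (simp add: s_def)
        qed
      qed
      show "AE x in circle. norm (norm (indicator (\<Union>i. A i) x *\<^sub>R v - s k x)) \<le> norm v" for k
        by (auto simp: s_def indicator_def)
    qed (rule borel_measurable_const, simp)
    then have b: "(\<lambda>k. LINT x|circle. norm (indicator (\<Union>i. A i) x *\<^sub>R v - s k x)) \<longlonglongrightarrow> 0"
      by (simp only: integral_zero)
    have c: "integrable circle (s k)" for k
      unfolding s_def by (intro int_ind sets.finite_UN) (auto simp: Am)
    have d: "integrable circle (\<lambda>x. indicator (\<Union>i. A i) x *\<^sub>R v)"
      by (intro int_ind sets.countable_UN) (auto simp: Am)
    show ?case by (rule Lim[OF c a d b])
  qed
  show ?thesis using G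
  proof (induction rule: integrable_induct)
    case (base A c)
    show ?case by (rule sets[OF base(1)])
  next
    case (add f g)
    show ?case by (rule Add[OF add(3) add(4) add(1) add(2)])
  next
    case (lim f s)
    have "(\<lambda>k. LINT x|circle. norm (f x - s k x)) \<longlonglongrightarrow> (LINT x|circle. 0)"
    \<comment> \<open>The approximating simple functions are bounded by
      \<open>2 * norm (f x)\<close>, hence the differences by \<open>3 * norm (f x)\<close>.\<close>
    proof (rule integral_dominated_convergence[where w = "\<lambda>x. 3 * norm (f x)"])
      show "(\<lambda>x. norm (f x - s k x)) \<in> borel_measurable circle" for k
        by (intro borel_measurable_integrable integrable_norm Bochner_Integration.integrable_diff lim(1) lim(4))
      show "AE x in circle. (\<lambda>k. norm (f x - s k x)) \<longlonglongrightarrow> 0"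
      proof (rule AE_I2)
        fix x assume "x \<in> space circle"
        have "(\<lambda>k. f x - s k x) \<longlonglongrightarrow> f x - f x"
          by (intro tendsto_diff tendsto_const lim(2) \<open>x \<in> space circle\<close>)
        then have "(\<lambda>k. f x - s k x) \<longlonglongrightarrow> 0" by (simp only: diff_self)
        then show "(\<lambda>k. norm (f x - s k x)) \<longlonglongrightarrow> 0"
          by (rule tendsto_norm_zero)
      qed
      show "AE x in circle. norm (norm (f x - s k x)) \<le> 3 * norm (f x)" for k
      proof (rule AE_I2)
        fix x assume "x \<in> space circle"
        then have "norm (s k x) \<le> 2 * norm (f x)" by (rule lim(3))
        then show "norm (norm (f x - s k x)) \<le> 3 * norm (f x)"
          using norm_triangle_ineq4[of "f x" "s k x"] by simp
      qed
      show "integrable circle (\<lambda>x. 3 * norm (f x))" using lim(4) by simp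
    qed (rule borel_measurable_const)
    then have "(\<lambda>k. LINT x|circle. norm (f x - s k x)) \<longlonglongrightarrow> 0"
      by (simp only: integral_zero)
    then show ?case by (rule Lim[OF lim(1) lim(5) lim(4)])
  qed
qed

lemma circle_Int_space: "B \<in> sets circle \<Longrightarrow> B \<inter> {0..<1} = B"
  by (auto simp: sets_circle)

lemma integral_indicator_circle:
  fixes v :: "'b :: {banach, second_countable_topology}"
  assumes "A \<in> sets circle"
  shows "(LINT x|circle. indicator A x *\<^sub>R v) = measure circle A *\<^sub>R v"
    and "(LINT x|circle. indicator A x) = measure circle A"
  using assms by (simp_all add: circle_Int_space circle.emeasure_eq_measure)

lemma frac_frac_add: "frac (frac x + y) = frac (x + y :: real)"
proof -
  have "x + y = frac x + y + of_int \<lfloor>x\<rfloor>" by (simp add: frac_def)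
  then show ?thesis by (metis frac_add_of_int_right)
qed

lemma frac_shift_interval_change:
  fixes x c a :: real
  assumes "0 \<le> x" "x < 1" "\<bar>c\<bar> < 1" and "(frac (x + c) < a) \<noteq> (x < a)"
  shows "\<bar>x\<bar> \<le> \<bar>c\<bar> \<or> \<bar>x - a\<bar> \<le> \<bar>c\<bar> \<or> \<bar>x - 1\<bar> \<le> \<bar>c\<bar>"
proof -
  consider "0 \<le> x + c" "x + c < 1" | "x + c < 0" | "1 \<le> x + c" by linarith
  then show ?thesis
  proof cases
    case 1
    then have "frac (x + c) = x + c" by (simp add: frac_eq)
    then show ?thesis using assms(4) by auto
  qed (use assms in auto)
qed

lemma shift_L1_tendsto:
  fixes G :: "real \<Rightarrow> 'b :: {banach, second_countable_topology}"
  assumes c: "c \<longlonglongrightarrow> 0" and G: "integrable circle G"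
  shows "(\<lambda>i. LINT x|circle. norm (G (frac (x + c i)) - G x)) \<longlonglongrightarrow> 0"
proof (rule L1_seminorms_tendsto_0[where C = 2, OF _ _ _ _ _ G])
  fix i and G H :: "real \<Rightarrow> 'b"
  assume int: "integrable circle G" "integrable circle H"
  note int' = int[THEN integrable_frac_shift]
  have "(LINT x|circle. norm (G (frac (x + c i)) + H (frac (x + c i)) - (G x + H x)))
      \<le> (LINT x|circle. norm (G (frac (x + c i)) - G x) + norm (H (frac (x + c i)) - H x))"
    using int int' by (intro integral_mono) (auto intro: norm_diff_triangle_ineq)
  also have "\<dots> = (LINT x|circle. norm (G (frac (x + c i)) - G x)) + (LINT x|circle. norm (H (frac (x + c i)) - H x))"
    using int int' by (intro Bochner_Integration.integral_add) auto
  finally show "(LINT x|circle. norm (G (frac (x + c i)) + H (frac (x + c i)) - (G x + H x)))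
    \<le> (LINT x|circle. norm (G (frac (x + c i)) - G x)) + (LINT x|circle. norm (H (frac (x + c i)) - H x))" .
next
  fix i and G :: "real \<Rightarrow> 'b"
  assume int: "integrable circle G"
  note int' = integrable_frac_shift[OF int]
  have "(LINT x|circle. norm (G (frac (x + c i)) - G x))
      \<le> (LINT x|circle. norm (G (frac (x + c i))) + norm (G x))"
    using int int' by (intro integral_mono) (auto intro: norm_triangle_ineq4)
  also have "\<dots> = (LINT x|circle. norm (G (frac (x + c i)))) + (LINT x|circle. norm (G x))"
    using int int' by (intro Bochner_Integration.integral_add) auto
  also have "(LINT x|circle. norm (G (frac (x + c i)))) = (LINT x|circle. norm (G x))"
    using borel_measurable_integrable[OF int] by (intro integral_frac_shift) simp
  finally show "(LINT x|circle. norm (G (frac (x + c i)) - G x)) \<le> 2 * (LINT x|circle. norm (G x))" by simp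
next
  fix a :: real and v :: 'b
  assume a: "0 \<le> a" "a \<le> 1"
  let ?f = "\<lambda>x. indicator {0..<a} x *\<^sub>R v"
  have ev: "eventually (\<lambda>i. \<bar>c i\<bar> < 1) sequentially"
    using tendsto_rabs_zero[OF c] by (intro order_tendstoD(2)) auto
  show "(\<lambda>i. LINT x|circle. norm (?f (frac (x + c i)) - ?f x)) \<longlonglongrightarrow> 0"
  proof (rule tendsto_sandwich)
    show "eventually (\<lambda>i. 0 \<le> (LINT x|circle. norm (?f (frac (x + c i)) - ?f x))) sequentially"
      by simp
    show "eventually (\<lambda>i. (LINT x|circle. norm (?f (frac (x + c i)) - ?f x)) \<le> 6 * \<bar>c i\<bar> * norm v) sequentially"
      using ev
    proof eventually_elim
      case (elim i)
      \<comment> \<open>Membership in \<open>[0, a)\<close> can change only within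
        \<open>|c i|\<close> of 0, \<open>a\<close> or 1; three intervals of length
        \<open>2 |c i|\<close> account for the constant 6.\<close>
      define B where "B = ({-\<bar>c i\<bar>..\<bar>c i\<bar>} \<union> {a - \<bar>c i\<bar>..a + \<bar>c i\<bar>} \<union> {1 - \<bar>c i\<bar>..1 + \<bar>c i\<bar>})"
      define B' where "B' = B \<inter> {0..<1}"
      have B': "B' \<in> sets circle" by (auto simp: B'_def B_def sets_circle)
      have "emeasure circle B' \<le> emeasure lborel B"
        using B' by (simp add: emeasure_circle) (auto simp: B'_def B_def intro!: emeasure_mono)
      also have "\<dots> \<le> emeasure lborel ({-\<bar>c i\<bar>..\<bar>c i\<bar>} \<union> {a - \<bar>c i\<bar>..a + \<bar>c i\<bar>}) + emeasure lborel {1 - \<bar>c i\<bar>..1 + \<bar>c i\<bar>}"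
        unfolding B_def by (rule emeasure_subadditive) auto
      also have "\<dots> \<le> (emeasure lborel {-\<bar>c i\<bar>..\<bar>c i\<bar>} + emeasure lborel {a - \<bar>c i\<bar>..a + \<bar>c i\<bar>}) + emeasure lborel {1 - \<bar>c i\<bar>..1 + \<bar>c i\<bar>}"
        by (intro add_right_mono emeasure_subadditive) auto
      also have "\<dots> = ennreal (6 * \<bar>c i\<bar>)" by (simp flip: ennreal_plus)
      finally have mB: "measure circle B' \<le> 6 * \<bar>c i\<bar>"
        by (simp add: circle.emeasure_eq_measure)
      have int: "integrable circle ?f"
        by (intro integrable_scaleR_left integrable_real_indicator) (auto simp: circle.emeasure_eq_measure sets_circle a)
      have "(LINT x|circle. norm (?f (frac (x + c i)) - ?f x)) \<le> (LINT x|circle. indicator B' x *\<^sub>R norm v)"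
      proof (rule integral_mono)
        show "integrable circle (\<lambda>x. norm (?f (frac (x + c i)) - ?f x))"
          using int integrable_frac_shift[OF int] by auto
        show "integrable circle (\<lambda>x. indicator B' x *\<^sub>R norm v)"
          using B' by (intro integrable_scaleR_left integrable_real_indicator) (auto simp: circle.emeasure_eq_measure)
        fix x assume "x \<in> space circle"
        then have x: "0 \<le> x" "x < 1" by auto
        show "norm (?f (frac (x + c i)) - ?f x) \<le> indicator B' x *\<^sub>R norm v"
        proof (cases "(frac (x + c i) < a) = (x < a)")
          case True
          then show ?thesis using x by (simp add: indicator_def)
        next
          case False
          then have "x \<in> B'"
            using frac_shift_interval_change[OF x elim False] x by (auto simp: B'_def B_def)
          then show ?thesis by (simp add: indicator_def)
        qed
      qed
      also have "\<dots> = measure circle B' * norm v" using B' by (simp add: circle_Int_space)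
      also have "\<dots> \<le> 6 * \<bar>c i\<bar> * norm v" by (intro mult_right_mono mB) simp
      finally show ?case .
    qed
    show "(\<lambda>i. 6 * \<bar>c i\<bar> * norm v) \<longlonglongrightarrow> 0"
      using tendsto_mult_left_zero[OF tendsto_mult_right_zero[OF tendsto_rabs_zero[OF c]], of 6 "norm v"]
      by simp
  qed simp
qed (simp_all add: norm_minus_commute)

lemma shift_set_tendsto:
  assumes c: "c \<longlonglongrightarrow> 0" and A: "A \<in> sets circle"
  shows "(\<lambda>i. measure circle {x \<in> {0..<1}. (frac (x + c i) \<in> A) \<noteq> (x \<in> A)}) \<longlonglongrightarrow> 0"
proof -
  have int: "integrable circle (indicator A :: real \<Rightarrow> real)"
    using A by (intro integrable_real_indicator) (auto simp: circle.emeasure_eq_measure)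
  have m: "{x \<in> {0..<1}. (frac (x + d) \<in> A) \<noteq> (x \<in> A)} \<in> sets circle" for d
  proof -
    have "{x \<in> {0..<1}. (frac (x + d) \<in> A) \<noteq> (x \<in> A)} =
      (((\<lambda>x. frac (x + d)) -` A \<inter> space circle) - A) \<union> (A - ((\<lambda>x. frac (x + d)) -` A \<inter> space circle))"
      using sets.sets_into_space[OF A] by auto
    then show ?thesis using measurable_sets[OF frac_shift_measurable A, of d] A by simp
  qed
  have "(LINT x|circle. norm (indicator A (frac (x + d)) - indicator A x :: real))
      = measure circle {x \<in> {0..<1}. (frac (x + d) \<in> A) \<noteq> (x \<in> A)}" for d
  proof -
    have "(LINT x|circle. norm (indicator A (frac (x + d)) - indicator A x :: real))
      = (LINT x|circle. indicator {x \<in> {0..<1}. (frac (x + d) \<in> A) \<noteq> (x \<in> A)} x)"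
      by (rule Bochner_Integration.integral_cong) (auto simp: indicator_def)
    then show ?thesis using m circle_Int_space[OF m] by simp
  qed
  then show ?thesis using shift_L1_tendsto[OF c int] by simp
qed

section \<open>Equidistribution of almost invariant sets\<close>

context unit_irrational
begin

text \<open>Rotating the interval by \<open>l\<close> steps changes the measure of its intersection
  with \<open>E\<close> by at most \<open>l \<eta>\<close>, and the mean of the indicators of
  \<open>q_k\<close> rotated intervals is within \<open>3 / q_k\<close> of \<open>a\<close> at every
  point.\<close>

lemma almost_invariant_interval:
  fixes a \<eta> :: real
  assumes E: "E \<in> sets circle" and a: "0 \<le> a" "a \<le> 1"
    and \<eta>: "measure circle {x \<in> {0..<1}. (frac (x + \<alpha>) \<in> E) \<noteq> (x \<in> E)} \<le> \<eta>"
  shows "\<bar>measure circle (E \<inter> {0..<a}) - measure circle E * a\<bar> \<le> 3 / qn k + qn k * \<eta>"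
proof -
  define D where "D = {x \<in> {0..<1}. (frac (x + \<alpha>) \<in> E) \<noteq> (x \<in> E)}"
  define S where "S l = (\<lambda>x. frac (x + real l * \<alpha>)) -` {0..<a} \<inter> space circle" for l
  have I: "{0..<a} \<in> sets circle" using a by (auto simp: sets_circle)
  have S: "S l \<in> sets circle" for l
    unfolding S_def by (rule measurable_sets[OF frac_shift_measurable I])
  define P where "P A = (\<lambda>x. frac (x + \<alpha>)) -` A \<inter> space circle" for A
  have P: "P A \<in> sets circle" if "A \<in> sets circle" for A
    unfolding P_def by (rule measurable_sets[OF frac_shift_measurable that])
  have mP: "measure circle (P A) = measure circle A" if "A \<in> sets circle" for A
    using measure_distr[OF frac_shift_measurable that, of \<alpha>] by (simp add: P_def distr_frac_shift)
  have Dm: "D \<in> sets circle"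
  proof -
    have "D = (P E - E) \<union> (E - P E)" using sets.sets_into_space[OF E] by (auto simp: D_def P_def)
    then show ?thesis using P[OF E] E by simp
  qed
  define b where "b l = measure circle (E \<inter> S l)" for l
  have step: "\<bar>b l - b (Suc l)\<bar> \<le> \<eta>" for l
  proof -
    have eq: "P (E \<inter> S l) = P E \<inter> S (Suc l)"
      by (auto simp: P_def S_def frac_frac_add algebra_simps frac_lt_1)
    have m1: "measure circle (A \<inter> S (Suc l)) \<le> measure circle (B \<inter> S (Suc l)) + \<eta>"
      if "A \<in> sets circle" "B \<in> sets circle" "A \<subseteq> B \<union> D" for A B
    proof -
      have "measure circle (A \<inter> S (Suc l)) \<le> measure circle (B \<inter> S (Suc l) \<union> D)"
        using that S Dm by (intro circle.finite_measure_mono) auto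
      also have "\<dots> \<le> measure circle (B \<inter> S (Suc l)) + measure circle D"
        using that S Dm by (intro measure_Un_le) auto
      finally show ?thesis using \<eta> by (simp add: D_def)
    qed
    have "b l = measure circle (P E \<inter> S (Suc l))"
      using mP[of "E \<inter> S l"] E S eq by (simp add: b_def)
    moreover have "P E \<subseteq> E \<union> D" "E \<subseteq> P E \<union> D"
      using sets.sets_into_space[OF E] by (auto simp: P_def D_def)
    ultimately show ?thesis
      using m1[of "P E" E] m1[of E "P E"] P[OF E] E by (simp add: b_def)
  qed
  have near: "\<bar>b 0 - b l\<bar> \<le> l * \<eta>" for l
  proof (induction l)
    case (Suc l)
    then show ?case using step[of l] by (simp add: algebra_simps)
  qed simp
  have sum: "\<bar>(\<Sum>l<qn k. b l) - qn k * a * measure circle E\<bar> \<le> 3"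
  proof -
    have int: "integrable circle (indicator (E \<inter> S l) :: _ \<Rightarrow> real)" for l
      using E S by (intro integrable_real_indicator) (auto simp: circle.emeasure_eq_measure)
    have intE: "integrable circle (indicator E :: _ \<Rightarrow> real)"
      using E by (intro integrable_real_indicator) (auto simp: circle.emeasure_eq_measure)
    have "(\<Sum>l<qn k. b l) = (\<Sum>l<qn k. LINT x|circle. indicator (E \<inter> S l) x)"
      unfolding b_def by (intro sum.cong refl integral_indicator_circle(2)[symmetric] sets.Int E S)
    also have "\<dots> = (LINT x|circle. (\<Sum>l<qn k. indicator (E \<inter> S l) x))"
      by (rule Bochner_Integration.integral_sum[symmetric]) (rule int)
    finally have "(\<Sum>l<qn k. b l) - qn k * a * measure circle E
        = (LINT x|circle. (\<Sum>l<qn k. indicator (E \<inter> S l) x) - qn k * a * indicator E x)"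
      using int intE by (subst Bochner_Integration.integral_diff) (auto simp: circle_Int_space[OF E])
    also have "\<bar>\<dots>\<bar> \<le> (LINT x|circle. 3)"
    proof (rule order_trans[OF integral_abs_bound integral_mono])
      fix x assume "x \<in> space circle"
      then have x: "0 \<le> x" "x < 1" by auto
      have "(\<Sum>l<qn k. indicator (E \<inter> S l) x) = indicator E x * (\<Sum>l<qn k. indicator (S l) x :: real)"
        by (simp add: indicator_inter_arith sum_distrib_left)
      also have "(\<Sum>l<qn k. indicator (S l) x :: real) = (\<Sum>l<qn k. if frac (x + l * \<alpha>) \<in> {0..<a} then 1 else 0)"
        using x by (intro sum.cong) (auto simp: S_def indicator_def)
      also have "\<dots> = card {j. j < qn k \<and> frac (x + j * \<alpha>) \<in> {0..<a}}"
        by (simp add: sum.If_cases Int_def lessThan_def)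
      finally have "(\<Sum>l<qn k. indicator (E \<inter> S l) x) - qn k * a * indicator E x
          = indicator E x * (card {j. j < qn k \<and> frac (x + j * \<alpha>) \<in> {0..<a}} - qn k * a)"
        by (simp add: algebra_simps)
      then show "\<bar>(\<Sum>l<qn k. indicator (E \<inter> S l) x) - qn k * a * indicator E x\<bar> \<le> 3"
        using denjoy_koksma[OF a, of k x] by (simp add: abs_mult indicator_def)
    qed (use int intE in auto)
    also have "(LINT x|circle. (3::real)) = 3"
      using emeasure_circle_space by (simp add: measure_def)
    finally show ?thesis .
  qed
  have q0: "real (qn k) > 0" using qn_pos[of k] by simp
  have "\<bar>qn k * b 0 - (\<Sum>l<qn k. b l)\<bar> = \<bar>\<Sum>l<qn k. b 0 - b l\<bar>"
    by (simp add: sum_subtractf)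
  also have "\<dots> \<le> (\<Sum>l<qn k. \<bar>b 0 - b l\<bar>)" by (rule sum_abs)
  also have "\<dots> \<le> (\<Sum>l<qn k. qn k * \<eta>)"
  proof (rule sum_mono)
    fix l assume "l \<in> {..<qn k}"
    moreover have "\<eta> \<ge> 0" using \<eta> measure_nonneg order_trans by blast
    ultimately have "l * \<eta> \<le> qn k * \<eta>" by (intro mult_right_mono) auto
    then show "\<bar>b 0 - b l\<bar> \<le> qn k * \<eta>" using near[of l] by simp
  qed
  finally have "\<bar>qn k * b 0 - qn k * a * measure circle E\<bar> \<le> qn k * (qn k * \<eta>) + 3"
    using sum by simp
  moreover have "qn k * b 0 - qn k * a * measure circle E = qn k * (b 0 - measure circle E * a)"
    by (simp add: algebra_simps)
  moreover have "qn k * (qn k * \<eta>) + 3 = qn k * (3 / qn k + qn k * \<eta>)"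
    using q0 by (simp add: distrib_left)
  ultimately have "qn k * \<bar>b 0 - measure circle E * a\<bar> \<le> qn k * (3 / qn k + qn k * \<eta>)"
    by (simp add: abs_mult)
  moreover have "E \<inter> {0..<a} = E \<inter> S 0"
    using sets.sets_into_space[OF E] by (auto simp: S_def frac_eq)
  ultimately show ?thesis using q0 by (simp add: b_def)
qed

text \<open>The order of choices matters: \<open>k\<close> is fixed first so that
  \<open>3 / q_k\<close> is small, then \<open>i\<close> is taken so large that \<open>q_k\<close>
  times the invariance defect is small.\<close>

lemma almost_invariant_equidistributed:
  fixes G :: "real \<Rightarrow> 'b :: {banach, second_countable_topology}"
  assumes E: "\<And>i. E i \<in> sets circle"
    and inv: "(\<lambda>i. measure circle {x \<in> {0..<1}. (frac (x + \<alpha>) \<in> E i) \<noteq> (x \<in> E i)}) \<longlonglongrightarrow> 0"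
    and G: "integrable circle G"
  shows "(\<lambda>i. (LINT x|circle. indicator (E i) x *\<^sub>R G x)
      - measure circle (E i) *\<^sub>R (LINT x|circle. G x)) \<longlonglongrightarrow> 0"
proof -
  have intE: "integrable circle (\<lambda>x. indicator (E i) x *\<^sub>R G x)" if "integrable circle G"
    for i and G :: "real \<Rightarrow> 'b"
    using that E by (rule integrable_mult_indicator[rotated])
  have "(\<lambda>i. norm ((LINT x|circle. indicator (E i) x *\<^sub>R G x)
      - measure circle (E i) *\<^sub>R (LINT x|circle. G x))) \<longlonglongrightarrow> 0"
  proof (rule L1_seminorms_tendsto_0[where C = 2, OF _ _ _ _ _ G])
    fix i and G H :: "real \<Rightarrow> 'b"
    assume int: "integrable circle G" "integrable circle H"
    have "(LINT x|circle. indicator (E i) x *\<^sub>R (G x + H x)) - measure circle (E i) *\<^sub>R (LINT x|circle. G x + H x)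
      = ((LINT x|circle. indicator (E i) x *\<^sub>R G x) - measure circle (E i) *\<^sub>R (LINT x|circle. G x))
      + ((LINT x|circle. indicator (E i) x *\<^sub>R H x) - measure circle (E i) *\<^sub>R (LINT x|circle. H x))"
      using int intE by (simp add: scaleR_add_right)
    then show "norm ((LINT x|circle. indicator (E i) x *\<^sub>R (G x + H x)) - measure circle (E i) *\<^sub>R (LINT x|circle. G x + H x))
      \<le> norm ((LINT x|circle. indicator (E i) x *\<^sub>R G x) - measure circle (E i) *\<^sub>R (LINT x|circle. G x))
      + norm ((LINT x|circle. indicator (E i) x *\<^sub>R H x) - measure circle (E i) *\<^sub>R (LINT x|circle. H x))"
      by (simp only: norm_triangle_ineq)
  next
    fix i and G :: "real \<Rightarrow> 'b"
    assume int: "integrable circle G"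
    show "norm ((LINT x|circle. indicator (E i) x *\<^sub>R (- G x)) - measure circle (E i) *\<^sub>R (LINT x|circle. - G x))
      = norm ((LINT x|circle. indicator (E i) x *\<^sub>R G x) - measure circle (E i) *\<^sub>R (LINT x|circle. G x))"
      using norm_minus_commute by (simp add: norm_minus_commute)
  next
    fix i and G :: "real \<Rightarrow> 'b"
    assume int: "integrable circle G"
    have "norm (LINT x|circle. indicator (E i) x *\<^sub>R G x) \<le> (LINT x|circle. norm (indicator (E i) x *\<^sub>R G x))"
      by (rule integral_norm_bound)
    also have "\<dots> \<le> (LINT x|circle. norm (G x))"
      using int by (intro integral_mono integrable_norm intE) (auto simp: indicator_def)
    finally have 1: "norm (LINT x|circle. indicator (E i) x *\<^sub>R G x) \<le> (LINT x|circle. norm (G x))" .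
    have "measure circle (E i) \<le> 1"
      using circle.bounded_measure[of "E i"] emeasure_circle_space by (simp add: measure_def)
    moreover have "norm (LINT x|circle. G x) \<le> (LINT x|circle. norm (G x))" by (rule integral_norm_bound)
    ultimately have 2: "measure circle (E i) * norm (LINT x|circle. G x) \<le> 1 * (LINT x|circle. norm (G x))"
      by (intro mult_mono) auto
    show "norm ((LINT x|circle. indicator (E i) x *\<^sub>R G x) - measure circle (E i) *\<^sub>R (LINT x|circle. G x))
      \<le> 2 * (LINT x|circle. norm (G x))"
      using 1 2 norm_triangle_ineq4[of "LINT x|circle. indicator (E i) x *\<^sub>R G x"
          "measure circle (E i) *\<^sub>R (LINT x|circle. G x)"] by simp
  next
    fix a :: real and v :: 'b
    assume a: "0 \<le> a" "a \<le> 1"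
    define \<eta> where "\<eta> i = measure circle {x \<in> {0..<1}. (frac (x + \<alpha>) \<in> E i) \<noteq> (x \<in> E i)}" for i
    have I: "{0..<a} \<in> sets circle" using a by (auto simp: sets_circle)
    have ma: "measure circle {0..<a} = a"
      using a I by (simp add: measure_def emeasure_circle)
    have eq: "(LINT x|circle. indicator (E i) x *\<^sub>R (indicator {0..<a} x *\<^sub>R v)) - measure circle (E i) *\<^sub>R (LINT x|circle. indicator {0..<a} x *\<^sub>R v)
      = (measure circle (E i \<inter> {0..<a}) - measure circle (E i) * a) *\<^sub>R v" for i
    proof -
      have "(LINT x|circle. indicator (E i) x *\<^sub>R (indicator {0..<a} x *\<^sub>R v))
          = (LINT x|circle. indicator (E i \<inter> {0..<a}) x *\<^sub>R v)"
        by (rule Bochner_Integration.integral_cong) (auto simp: indicator_def)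
      also have "\<dots> = measure circle (E i \<inter> {0..<a}) *\<^sub>R v"
        by (intro integral_indicator_circle(1) sets.Int E I)
      finally show ?thesis
        by (simp only: integral_indicator_circle(1)[OF I] ma scaleR_left_diff_distrib scaleR_scaleR)
    qed
    have "(\<lambda>i. \<bar>measure circle (E i \<inter> {0..<a}) - measure circle (E i) * a\<bar>) \<longlonglongrightarrow> 0"
    proof (rule order_tendstoI)
      fix e :: real assume e: "0 < e"
      obtain k :: nat where k: "6 / e < k" using reals_Archimedean2 by blast
      then have "6 / e < qn k" using qn_ge[of k] by linarith
      moreover have q0: "0 < real (qn k)" using qn_pos[of k] by simp
      ultimately have 1: "3 / qn k < e / 2" using e by (simp add: field_simps)
      have "eventually (\<lambda>i. \<eta> i < e / (2 * qn k)) sequentially"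
        using inv e q0 unfolding \<eta>_def by (intro order_tendstoD(2)) auto
      then show "eventually (\<lambda>i. \<bar>measure circle (E i \<inter> {0..<a}) - measure circle (E i) * a\<bar> < e) sequentially"
      proof eventually_elim
        case (elim i)
        have "qn k * \<eta> i < qn k * (e / (2 * qn k))" using elim q0 by (intro mult_strict_left_mono)
        also have "\<dots> = e / 2" using q0 by simp
        finally show ?case
          using 1 almost_invariant_interval[where E = "E i" and k = k and \<eta> = "\<eta> i", OF E a] by (simp add: \<eta>_def)
      qed
    next
      fix l :: real assume "l < 0"
      then show "eventually (\<lambda>i. l < \<bar>measure circle (E i \<inter> {0..<a}) - measure circle (E i) * a\<bar>) sequentially"
        by (intro always_eventually allI) linarith
    qed
    then show "(\<lambda>i. norm ((LINT x|circle. indicator (E i) x *\<^sub>R (indicator {0..<a} x *\<^sub>R v))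
        - measure circle (E i) *\<^sub>R (LINT x|circle. indicator {0..<a} x *\<^sub>R v))) \<longlonglongrightarrow> 0"
      unfolding eq norm_scaleR real_norm_def by (rule tendsto_mult_left_zero)
  qed simp
  then show ?thesis by (simp only: tendsto_norm_zero_iff)
qed

end

section \<open>The induced map\<close>

lemma rotation_iterate: "0 \<le> x \<Longrightarrow> x < 1 \<Longrightarrow> (rotation \<alpha> ^^ j) x = frac (x + real j * \<alpha>)"
  by (induction j) (auto simp: rotation_def frac_frac_add algebra_simps frac_eq)

locale induced_rotation = unit_irrational +
  fixes z :: real and T :: "real \<Rightarrow> real"
  assumes z01: "0 < z" "z \<le> 1"
    and outside: "\<And>x. z \<le> x \<Longrightarrow> x < 1 \<Longrightarrow> frac (x + \<alpha>) < z"
    and T_return: "\<And>x. x \<in> {0..<z} \<Longrightarrow> T x = first_return (rotation \<alpha>) {0..<z} x"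
begin

abbreviation "J \<equiv> {0..<z}"
abbreviation "M \<equiv> normalized_lebesgue J"

text \<open>A point outside \<open>J\<close> enters \<open>J\<close> at the next step, so only the
  return times 1 and 2 occur.\<close>

lemma T_eq:
  assumes "x \<in> J"
  shows "T x = (if frac (x + \<alpha>) < z then frac (x + \<alpha>) else frac (x + 2 * \<alpha>))"
proof -
  have x: "0 \<le> x" "x < 1" using assms z01 by auto
  define P where "P n \<longleftrightarrow> 0 < n \<and> (rotation \<alpha> ^^ n) x \<in> J" for n
  have P1: "P 1 \<longleftrightarrow> frac (x + \<alpha>) < z" using x by (simp add: P_def rotation_def)
  show ?thesis
  proof (cases "frac (x + \<alpha>) < z")
    case True
    then have "(LEAST n. P n) = 1" using P1 by (intro Least_equality) (auto simp: P_def)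
    then have "T x = (rotation \<alpha> ^^ 1) x"
      using T_return[OF assms] by (simp only: first_return_def P_def)
    then show ?thesis using True by (simp add: rotation_def)
  next
    case False
    have "P 2"
    proof -
      have "frac (frac (x + \<alpha>) + \<alpha>) < z" using False by (intro outside) (auto simp: frac_lt_1)
      then show ?thesis by (simp add: P_def rotation_def numeral_2_eq_2)
    qed
    moreover have "2 \<le> n" if "P n" for n
      using that P1 False by (cases "n = 1") (auto simp: P_def)
    ultimately have "(LEAST n. P n) = 2" by (intro Least_equality) auto
    then have "T x = (rotation \<alpha> ^^ 2) x"
      using T_return[OF assms] by (simp only: first_return_def P_def)
    then show ?thesis using False x by (simp add: rotation_iterate)
  qed
qed

lemma T_in: "x \<in> J \<Longrightarrow> T x \<in> J"
proof -
  assume x: "x \<in> J"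
  have "frac (x + 2 * \<alpha>) = frac (frac (x + \<alpha>) + \<alpha>)" by (simp add: frac_frac_add algebra_simps)
  then show "T x \<in> J"
    using T_eq[OF x] outside[of "frac (x + \<alpha>)"] by (auto simp: frac_lt_1)
qed

lemma T_pow_in: "x \<in> J \<Longrightarrow> (T ^^ n) x \<in> J"
  by (induction n) (auto simp: T_in simp del: atLeastLessThan_iff)

text \<open>Natural-number form of \<open>visits\<close>, written with \<open>frac\<close> so that
  the cocycle identities hold for every real \<open>x\<close> without side conditions.\<close>

definition vis :: "nat \<Rightarrow> real \<Rightarrow> nat" where
  "vis r x = (\<Sum>j<r. of_bool (frac (x + real j * \<alpha>) < z))"

lemma vis_add: "vis (s + r) x = vis s x + vis r (frac (x + real s * \<alpha>))"
  by (induction r) (auto simp: vis_def frac_frac_add algebra_simps)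

lemma vis_card: "vis r x = card {j. j < r \<and> frac (x + real j * \<alpha>) \<in> J}"
  by (simp add: vis_def of_bool_def sum.If_cases Int_def lessThan_def)

text \<open>Translates induced time into rotation time: after \<open>vis r x\<close> returns the
  induced orbit sits at the first visit to \<open>J\<close> at time at least \<open>r\<close>, which
  is time \<open>r\<close> or \<open>r + 1\<close>.\<close>

lemma T_pow_vis:
  assumes "x \<in> J"
  shows "(T ^^ vis r x) x =
    (if frac (x + real r * \<alpha>) < z then frac (x + real r * \<alpha>) else frac (x + (real r + 1) * \<alpha>))"
proof (induction r)
  case 0
  then show ?case using assms z01 by (simp add: vis_def frac_eq)
next
  case (Suc r)
  show ?case
  proof (cases "frac (x + real r * \<alpha>) < z")
    case True
    then have v: "vis (Suc r) x = Suc (vis r x)" by (simp add: vis_def)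
    have "(T ^^ vis (Suc r) x) x = T (frac (x + real r * \<alpha>))"
      using Suc True by (simp add: v)
    also have "\<dots> = (if frac (frac (x + real r * \<alpha>) + \<alpha>) < z then frac (frac (x + real r * \<alpha>) + \<alpha>)
        else frac (frac (x + real r * \<alpha>) + 2 * \<alpha>))"
      using True by (intro T_eq) auto
    also have "frac (frac (x + real r * \<alpha>) + \<alpha>) = frac (x + real (Suc r) * \<alpha>)"
      by (simp only: frac_frac_add) (simp add: algebra_simps)
    also have "frac (frac (x + real r * \<alpha>) + 2 * \<alpha>) = frac (x + (real (Suc r) + 1) * \<alpha>)"
      by (simp only: frac_frac_add) (simp add: algebra_simps)
    finally show ?thesis .
  next
    case False
    then have v: "vis (Suc r) x = vis r x" by (simp add: vis_def)
    have "frac (frac (x + real r * \<alpha>) + \<alpha>) < z" using False by (intro outside) (auto simp: frac_lt_1)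
    also have "frac (frac (x + real r * \<alpha>) + \<alpha>) = frac (x + real (Suc r) * \<alpha>)"
      by (simp only: frac_frac_add) (simp add: algebra_simps)
    finally have "frac (x + real (Suc r) * \<alpha>) < z" .
    moreover have "(T ^^ vis r x) x = frac (x + (real r + 1) * \<alpha>)"
      using Suc False by simp
    moreover have "real r + 1 = real (Suc r)" by simp
    ultimately show ?thesis by (simp only: v) simp
  qed
qed

lemma J_circle: "J \<in> sets circle" "J \<in> sets borel" "J \<subseteq> {0..<1}"
  using z01 by (auto simp: sets_circle)

lemma measurable_vis: "(\<lambda>x. real (vis r x)) \<in> borel_measurable circle"
proof (rule measurable_circle)
  have f: "(\<lambda>x. frac (x + c)) \<in> borel_measurable borel" for c :: real
    unfolding frac_def by measurable
  have "(\<lambda>x. if frac (x + real j * \<alpha>) < z then 1 else 0 :: real) \<in> borel_measurable borel" for j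
  proof (rule measurable_If)
    have "(\<lambda>x. frac (x + real j * \<alpha>)) -` {..<z} \<inter> space borel \<in> sets borel"
      by (rule measurable_sets[OF f]) simp
    then show "{x \<in> space borel. frac (x + real j * \<alpha>) < z} \<in> sets borel"
      by (simp add: vimage_def)
  qed auto
  then have "(\<lambda>x. \<Sum>j<r. if frac (x + real j * \<alpha>) < z then 1 else 0 :: real) \<in> borel_measurable borel"
    by (intro borel_measurable_sum)
  then show "(\<lambda>x. real (vis r x)) \<in> borel_measurable borel"
    by (simp add: vis_def of_bool_def if_distrib[of real] cong: if_cong)
qed

lemma sets_vis: "{x \<in> {0..<1}. P (vis r x)} \<in> sets circle"
proof -
  have "(\<lambda>x. real (vis r x)) -` (real ` {v. P v}) \<inter> space circle \<in> sets circle"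
  proof (rule measurable_sets[OF measurable_vis])
    have "countable (real ` {v. P v})" by simp
    then show "real ` {v. P v} \<in> sets borel" by (rule sets.countable[rotated]) simp
  qed
  moreover have "(\<lambda>x. real (vis r x)) -` (real ` {v. P v}) \<inter> space circle = {x \<in> {0..<1}. P (vis r x)}"
    by auto
  ultimately show ?thesis by simp
qed

subsection \<open>Normalized Lebesgue measure\<close>

lemma M_density: "M = density (restrict_space lborel J) (\<lambda>_. ennreal (1 / z))"
  unfolding normalized_lebesgue_def uniform_measure_def
proof (rule density_cong)
  show "AE x in restrict_space lborel J. indicator J x / emeasure (restrict_space lborel J) J = ennreal (1 / z)"
    using z01 by (intro AE_I2) (auto simp: emeasure_restrict_space space_restrict_space
        simp flip: divide_ennreal)
  show "(\<lambda>x. indicator J x / emeasure (restrict_space lborel J) J) \<in> borel_measurable (restrict_space lborel J)"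
    by (intro borel_measurable_divide_ennreal borel_measurable_indicator borel_measurable_const)
      (auto simp: sets_restrict_space image_iff intro!: bexI[of _ J])
qed simp

lemma space_M [simp]: "space M = J"
  by (simp add: M_density space_restrict_space)

lemma sets_M: "sets M = {B. B \<in> sets borel \<and> B \<subseteq> J}"
  by (auto simp: M_density sets_restrict_space image_iff)

lemma sets_M_circle: "B \<in> sets M \<Longrightarrow> B \<in> sets circle"
  using z01 by (auto simp: sets_M sets_circle)

lemma borel_measurable_M:
  fixes f :: "real \<Rightarrow> 'b :: topological_space"
  assumes "f \<in> borel_measurable M"
  shows "f \<in> borel_measurable (restrict_space borel J)"
proof -
  have "measurable M borel = measurable (restrict_space borel J) (borel :: 'b measure)"
    by (rule measurable_cong_sets) (auto simp: sets_M sets_restrict_space)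
  then show ?thesis using assms by simp
qed

lemma measurable_extend:
  fixes f :: "real \<Rightarrow> 'b :: real_normed_vector"
  assumes "f \<in> borel_measurable M"
  shows "(\<lambda>x. indicator J x *\<^sub>R f x) \<in> borel_measurable borel"
  using borel_measurable_M[OF assms] borel_measurable_restrict_space_iff[of J borel f] by simp

lemma integral_M:
  fixes f :: "real \<Rightarrow> 'b :: {banach, second_countable_topology}"
  assumes "f \<in> borel_measurable M"
  shows "(LINT x|M. f x) = (1 / z) *\<^sub>R (LINT x|circle. indicator J x *\<^sub>R f x)"
proof -
  have f: "f \<in> borel_measurable (restrict_space lborel J)"
    using assms by (simp add: M_density)
  have "(LINT x|M. f x) = (LINT x|restrict_space lborel J. (1 / z) *\<^sub>R f x)"
    unfolding M_density using z01 f by (subst integral_density) auto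
  also have "\<dots> = (1 / z) *\<^sub>R (LINT x|restrict_space lborel J. f x)"
    by simp
  also have "(LINT x|restrict_space lborel J. f x) = (LINT x|lborel. indicator J x *\<^sub>R f x)"
    by (subst integral_restrict_space) auto
  also have "\<dots> = (LINT x|lborel. indicator {0..<1} x *\<^sub>R (indicator J x *\<^sub>R f x))"
    using z01 by (intro Bochner_Integration.integral_cong) (auto simp: indicator_def)
  also have "\<dots> = (LINT x|circle. indicator J x *\<^sub>R f x)"
    unfolding circle_def by (subst integral_restrict_space) auto
  finally show ?thesis .
qed

lemma emeasure_M: "B \<in> sets M \<Longrightarrow> emeasure M B = ennreal (measure circle B / z)"
proof -
  assume B: "B \<in> sets M"
  then have B': "B \<in> sets (restrict_space lborel J)" by (simp add: M_density)
  have "emeasure M B = ennreal (1 / z) * emeasure (restrict_space lborel J) B"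
    unfolding M_density using B' by (simp add: emeasure_density_const)
  also have "emeasure (restrict_space lborel J) B = emeasure circle B"
    using B J_circle sets_M_circle[OF B] by (simp add: emeasure_restrict_space emeasure_circle sets_M)
  also have "\<dots> = ennreal (measure circle B)" by (rule circle.emeasure_eq_measure)
  finally have "emeasure M B = ennreal (1 / z) * ennreal (measure circle B)" .
  also have "\<dots> = ennreal (1 / z * measure circle B)"
    using z01 by (subst ennreal_mult) auto
  finally show ?thesis by simp
qed

lemma measure_circle_J: "measure circle J = z"
  using z01 J_circle by (simp add: measure_def emeasure_circle)

lemma emeasure_M_J: "emeasure M J = 1"
  using z01 J_circle by (simp add: emeasure_M sets_M measure_circle_J)

sublocale M: finite_measure M
  by standard (simp add: emeasure_M_J)

lemma measurable_into_M:
  assumes "f \<in> borel_measurable borel" "\<And>x. x \<in> J \<Longrightarrow> f x \<in> J"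
  shows "f \<in> measurable M M"
proof (rule measurableI)
  fix A assume "A \<in> sets M"
  then have "A \<in> sets borel" by (simp add: sets_M)
  then have "f -` A \<inter> space borel \<in> sets borel" by (rule measurable_sets[OF assms(1)])
  then show "f -` A \<inter> space M \<in> sets M" by (auto simp: sets_M)
qed (use assms in auto)

lemma measurable_frac_shift: "(\<lambda>x. frac (x + c)) \<in> borel_measurable borel" for c :: real
  unfolding frac_def by measurable

lemma T_measurable [measurable]: "T \<in> measurable M M"
proof -
  let ?T = "\<lambda>x. if frac (x + \<alpha>) < z then frac (x + \<alpha>) else frac (x + 2 * \<alpha>)"
  have "?T \<in> measurable M M"
  proof (rule measurable_into_M)
    show "?T \<in> borel_measurable borel"
      using measurable_frac_shift by measurable
    show "?T x \<in> J" if "x \<in> J" for x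
      using T_in[OF that] T_eq[OF that] by (simp only:)
  qed
  then show ?thesis
    by (rule measurable_cong[THEN iffD2, rotated]) (simp add: T_eq)
qed

lemma T_pow_measurable [measurable]: "T ^^ n \<in> measurable M M"
proof (induction n)
  case (Suc n)
  show ?case using measurable_comp[OF Suc T_measurable] by (simp add: comp_def)
qed (simp add: id_def)

lemma measure_frac_shift:
  "A \<in> sets circle \<Longrightarrow> measure circle {x \<in> {0..<1}. frac (x + c) \<in> A} = measure circle A"
  using measure_distr[OF frac_shift_measurable, of A c]
  by (simp add: distr_frac_shift vimage_def Int_def conj_commute)

lemma sets_frac_shift: "A \<in> sets circle \<Longrightarrow> {x \<in> {0..<1}. frac (x + c) \<in> A} \<in> sets circle"
  using measurable_sets[OF frac_shift_measurable, of A c] by (simp add: vimage_def Int_def conj_commute)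

text \<open>A preimage splits by return time. The two-step piece is a rotation preimage of what
  \<open>P B\<close> has outside \<open>J\<close>, so the two measures recombine to that of
  \<open>P B\<close>.\<close>

lemma distr_T: "distr M M T = M"
proof (rule measure_eqI)
  fix B assume "B \<in> sets (distr M M T)"
  then have B: "B \<in> sets M" by simp
  then have BJ: "B \<subseteq> J" "B \<in> sets circle" using sets_M_circle by (auto simp: sets_M)
  define P where "P A = {x \<in> {0..<1}. frac (x + \<alpha>) \<in> A}" for A
  have P: "P A \<in> sets circle" "measure circle (P A) = measure circle A" if "A \<in> sets circle" for A
    using that sets_frac_shift measure_frac_shift by (auto simp: P_def)
  have pre: "T -` B \<inter> J = (P B \<inter> J) \<union> P (P B - J)"
  proof (rule set_eqI)
    fix x
    have 2: "frac (x + 2 * \<alpha>) = frac (frac (x + \<alpha>) + \<alpha>)" by (simp add: frac_frac_add algebra_simps)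
    show "x \<in> T -` B \<inter> J \<longleftrightarrow> x \<in> (P B \<inter> J) \<union> P (P B - J)"
    proof (cases "x \<in> J")
      case True
      then show ?thesis using T_eq[OF True] BJ z01 2
        by (cases "frac (x + \<alpha>) < z") (auto simp: P_def frac_lt_1)
    next
      case False
      then have "x \<notin> P (P B - J)" using outside[of x] by (auto simp: P_def)
      then show ?thesis using False by blast
    qed
  qed
  have disj: "(P B \<inter> J) \<inter> P (P B - J) = {}" using BJ by (auto simp: P_def)
  have mT: "T -` B \<inter> J \<in> sets M" using measurable_sets[OF T_measurable B] by simp
  have "measure circle (T -` B \<inter> J) = measure circle (P B \<inter> J) + measure circle (P (P B - J))"
    unfolding pre using disj BJ P J_circle
    by (intro circle.finite_measure_Union) auto
  also have "measure circle (P (P B - J)) = measure circle (P B - J)"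
    using BJ P J_circle by auto
  also have "measure circle (P B \<inter> J) + \<dots> = measure circle (P B)"
  proof -
    have "P B \<inter> J \<inter> (P B - J) = {}" by blast
    from circle.finite_measure_Union[OF _ _ this] show ?thesis
      using BJ P J_circle by (simp add: Int_Diff_Un)
  qed
  also have "\<dots> = measure circle B" using BJ P by simp
  finally have eq: "measure circle (T -` B \<inter> J) = measure circle B" .
  have "emeasure (distr M M T) B = emeasure M (T -` B \<inter> J)"
    using B by (simp add: emeasure_distr[OF T_measurable])
  then show "emeasure (distr M M T) B = emeasure M B"
    using B mT eq by (simp add: emeasure_M)
qed simp

lemma distr_T_pow: "distr M M (T ^^ n) = M"
proof (induction n)
  case 0
  then show ?case by (simp add: distr_id2 id_def)
next
  case (Suc n)
  have "distr M M (T ^^ Suc n) = distr (distr M M (T ^^ n)) M T"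
    by (subst distr_distr) (auto simp only: funpow.simps T_measurable T_pow_measurable)
  then show ?case using Suc distr_T by (simp only:)
qed

lemma AE_T_pow:
  assumes "AE x in M. P x"
  shows "AE x in M. P ((T ^^ n) x)"
proof -
  have "AE x in distr M M (T ^^ n). P x" using assms by (simp only: distr_T_pow)
  then show ?thesis by (rule AE_distrD[OF T_pow_measurable])
qed

lemma integral_T_pow:
  fixes f :: "real \<Rightarrow> 'b :: {banach, second_countable_topology}"
  assumes "f \<in> borel_measurable M"
  shows "(LINT x|M. f ((T ^^ n) x)) = (LINT x|M. f x)"
  using integral_distr[OF T_pow_measurable assms, of n] by (simp add: distr_T_pow)

text \<open>\<open>T\<close> has the measurable left inverse \<open>S\<close>, the induced map of
  the inverse rotation. For joinings this allows an identity between densities to be tested on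
  preimages under powers of \<open>T\<close>.\<close>

lemma T_vimage_surj:
  assumes "B \<in> sets M"
  obtains B' where "B' \<in> sets M" "B = T -` B' \<inter> J"
proof -
  define S where "S x = (if frac (x + - \<alpha>) < z then frac (x + - \<alpha>) else frac (x + - 2 * \<alpha>))" for x
  have SJ: "S x \<in> J" if x: "x \<in> J" for x
  proof (cases "frac (x + - \<alpha>) < z")
    case False
    define w where "w = frac (x + - 2 * \<alpha>)"
    have "frac (w + \<alpha>) = frac (x + - \<alpha>)" by (simp add: w_def frac_frac_add)
    then have "w < z" using outside[of w] False by (force simp: w_def frac_lt_1)
    then show ?thesis using False by (simp add: S_def w_def)
  qed (simp add: S_def)
  have ST: "S (T x) = x" if x: "x \<in> J" for x
  proof -
    have fx: "frac x = x" using x z01 by (simp add: frac_eq)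
    show ?thesis
    proof (cases "frac (x + \<alpha>) < z")
      case True
      have "frac (frac (x + \<alpha>) + - \<alpha>) = x"
        using fx by (simp only: frac_frac_add) simp
      then show ?thesis using T_eq[OF x] True x by (simp only: S_def) simp
    next
      case False
      have "frac (frac (x + 2 * \<alpha>) + - \<alpha>) = frac (x + \<alpha>)" "frac (frac (x + 2 * \<alpha>) + - 2 * \<alpha>) = x"
        using fx by (simp_all only: frac_frac_add) (simp_all add: algebra_simps)
      then show ?thesis using T_eq[OF x] False by (simp only: S_def) simp
    qed
  qed
  have Sm: "S \<in> measurable M M"
  proof (rule measurable_into_M)
    show "S \<in> borel_measurable borel"
      unfolding S_def using measurable_frac_shift[of "- \<alpha>"] measurable_frac_shift[of "- 2 * \<alpha>"] by measurable
  qed (rule SJ)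
  show ?thesis
  proof (rule that)
    show "S -` B \<inter> J \<in> sets M" using measurable_sets[OF Sm assms] by simp
    show "B = T -` (S -` B \<inter> J) \<inter> J" using assms ST T_in by (auto simp: sets_M simp del: atLeastLessThan_iff)
  qed
qed

lemma T_pow_vimage_surj:
  assumes "B \<in> sets M"
  obtains B' where "B' \<in> sets M" "B = (T ^^ n) -` B' \<inter> J"
proof -
  have "\<exists>B'. B' \<in> sets M \<and> B = (T ^^ n) -` B' \<inter> J"
  proof (induction n)
    case 0
    then show ?case using assms by (intro exI[of _ B]) (auto simp: sets_M)
  next
    case (Suc n)
    then obtain B' where B': "B' \<in> sets M" "B = (T ^^ n) -` B' \<inter> J" by blast
    obtain C where C: "C \<in> sets M" "B' = T -` C \<inter> J" using T_vimage_surj[OF B'(1)] by blast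
    have "B = (T ^^ Suc n) -` C \<inter> J" using B' C T_pow_in[of _ n] by auto
    then show ?case using C by blast
  qed
  then show ?thesis using that by blast
qed

end

text \<open>Strict convexity of the unit disc; it will exclude eigenvalues other than 1 when two
  adjacent drifts have positive probability.\<close>

lemma norm_convex_unit_less:
  fixes \<zeta> :: complex
  assumes "norm \<zeta> = 1" "\<zeta> \<noteq> 1" "0 < a" "0 < b"
  shows "norm (of_real a + of_real b * \<zeta>) < a + b"
proof -
  have n: "(Re \<zeta>)\<^sup>2 + (Im \<zeta>)\<^sup>2 = 1" using cmod_power2[of \<zeta>] assms(1) by simp
  have "Re \<zeta> \<noteq> 1"
  proof
    assume "Re \<zeta> = 1"
    then have "Im \<zeta> = 0" using n by simp
    then show False using assms(2) \<open>Re \<zeta> = 1\<close> by (simp add: complex_eq_iff)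
  qed
  moreover have "Re \<zeta> \<le> 1" using complex_Re_le_cmod[of \<zeta>] assms(1) by simp
  ultimately have "2 * a * b * Re \<zeta> < 2 * a * b * 1"
    using assms by (intro mult_strict_left_mono) auto
  have "(norm (of_real a + of_real b * \<zeta>))\<^sup>2 = (a + b * Re \<zeta>)\<^sup>2 + (b * Im \<zeta>)\<^sup>2"
    unfolding cmod_power2 by simp
  also have "\<dots> = a\<^sup>2 + 2 * a * b * Re \<zeta> + b\<^sup>2 * ((Re \<zeta>)\<^sup>2 + (Im \<zeta>)\<^sup>2)"
    by algebra
  also have "\<dots> < a\<^sup>2 + 2 * a * b * 1 + b\<^sup>2 * 1"
    unfolding n using \<open>2 * a * b * Re \<zeta> < 2 * a * b * 1\<close> by simp
  also have "\<dots> = (a + b)\<^sup>2" by algebra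
  finally show ?thesis by (rule power_less_imp_less_base) (use assms in simp)
qed

section \<open>Ergodicity of the irrational rotation\<close>

context unit_irrational
begin

text \<open>Invariance of \<open>H\<close> allows an interval to be replaced by the mean of its
  \<open>q_k\<close> rotated copies, which by Denjoy--Koksma is within \<open>3 / q_k\<close> of a
  constant. Letting \<open>k\<close> grow settles intervals, and density the rest.\<close>

lemma integral_invariant_times:
  fixes H G :: "real \<Rightarrow> complex"
  assumes H: "H \<in> borel_measurable circle" "\<And>x. x \<in> {0..<1} \<Longrightarrow> norm (H x) \<le> C"
    and inv: "AE x in circle. H (frac (x + \<alpha>)) = H x"
    and G: "integrable circle G"
  shows "(LINT x|circle. H x * G x) = (LINT x|circle. H x) * (LINT x|circle. G x)"
proof -
  have C0: "0 \<le> C" using order_trans[OF norm_ge_zero H(2)[of 0]] by simp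
  have intH: "integrable circle H"
  proof (rule circle.integrable_const_bound)
    show "AE x in circle. norm (H x) \<le> C" using H(2) by (intro AE_I2) simp
  qed (rule H(1))
  have bnd: "integrable circle (\<lambda>x. H x * G x)" "norm (LINT x|circle. H x * G x) \<le> C * (LINT x|circle. norm (G x))"
    if G: "integrable circle G" for G
  proof -
    have le: "norm (H x * G x) \<le> C * norm (G x)" if "x \<in> space circle" for x
      using H(2)[of x] that by (simp add: norm_mult mult_right_mono)
    show int: "integrable circle (\<lambda>x. H x * G x)"
    proof (rule Bochner_Integration.integrable_bound)
      show "integrable circle (\<lambda>x. C * norm (G x))" using G by simp
      show "(\<lambda>x. H x * G x) \<in> borel_measurable circle"
        using H(1) borel_measurable_integrable[OF G] by (rule borel_measurable_times)
      show "AE x in circle. norm (H x * G x) \<le> norm (C * norm (G x))"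
        using le C0 by (intro AE_I2) simp
    qed
    have "norm (LINT x|circle. H x * G x) \<le> (LINT x|circle. norm (H x * G x))"
      by (rule integral_norm_bound)
    also have "\<dots> \<le> (LINT x|circle. C * norm (G x))"
      using int G le by (intro integral_mono) auto
    finally show "norm (LINT x|circle. H x * G x) \<le> C * (LINT x|circle. norm (G x))" by simp
  qed
  have invl: "AE x in circle. H (frac (x + real l * \<alpha>)) = H x" for l
  proof (induction l)
    case 0
    show ?case by (rule AE_I2) (simp add: frac_eq)
  next
    case (Suc l)
    have "AE x in distr circle circle (\<lambda>x. frac (x + \<alpha>)). H (frac (x + real l * \<alpha>)) = H x"
      using Suc by (simp only: distr_frac_shift)
    then have "AE x in circle. H (frac (frac (x + \<alpha>) + real l * \<alpha>)) = H (frac (x + \<alpha>))"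
      by (rule AE_distrD[OF frac_shift_measurable])
    then show ?case using inv
    proof eventually_elim
      case (elim x)
      have "frac (frac (x + \<alpha>) + real l * \<alpha>) = frac (x + real (Suc l) * \<alpha>)"
        by (simp add: frac_frac_add) (simp add: algebra_simps)
      then show ?case using elim by simp
    qed
  qed
  define h where "h = (LINT x|circle. H x)"
  have interval: "(LINT x|circle. H x * indicator {0..<a} x) = a * h" if a: "0 \<le> a" "a \<le> 1" for a :: real
  proof -
    define I where "I x = complex_of_real (indicator {0..<a} x)" for x :: real
    have "integrable circle (indicator {0..<a} :: real \<Rightarrow> real)"
      using a by (intro integrable_real_indicator) (auto simp: sets_circle circle.emeasure_eq_measure)
    then have intI: "integrable circle I"
      unfolding I_def by (rule integrable_of_real)
    define w where "w = (LINT x|circle. H x * I x)"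
    have shift: "(LINT x|circle. H x * I (frac (x + real l * \<alpha>))) = w" for l
    proof -
      have "w = (LINT x|circle. H (frac (x + real l * \<alpha>)) * I (frac (x + real l * \<alpha>)))"
        unfolding w_def
        by (rule integral_frac_shift[symmetric]) (rule borel_measurable_integrable[OF bnd(1)[OF intI]])
      also have "\<dots> = (LINT x|circle. H x * I (frac (x + real l * \<alpha>)))"
      proof (rule integral_cong_AE)
        have "integrable circle (\<lambda>x. H (frac (x + real l * \<alpha>)) * I (frac (x + real l * \<alpha>)))"
          using integrable_frac_shift[OF bnd(1)[OF intI]] .
        then show "(\<lambda>x. H (frac (x + real l * \<alpha>)) * I (frac (x + real l * \<alpha>))) \<in> borel_measurable circle"
          by (rule borel_measurable_integrable)
        show "(\<lambda>x. H x * I (frac (x + real l * \<alpha>))) \<in> borel_measurable circle"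
          using bnd(1)[OF integrable_frac_shift[OF intI]] by (rule borel_measurable_integrable)
      qed (use invl[of l] in eventually_elim, simp)
      finally show ?thesis by simp
    qed
    have est: "norm (w - a * h) \<le> 3 * C / real k" if "k > 0" for k
    proof -
      have q0: "real (qn k) > 0" using qn_pos by simp
      define S where "S x = (\<Sum>l<qn k. I (frac (x + real l * \<alpha>))) - qn k * a" for x
      have intS: "integrable circle S"
        unfolding S_def using integrable_frac_shift[OF intI] by simp
      have "(LINT x|circle. H x * S x) = (LINT x|circle. (\<Sum>l<qn k. H x * I (frac (x + real l * \<alpha>))) - (qn k * a) * H x)"
        by (intro Bochner_Integration.integral_cong) (auto simp: S_def algebra_simps sum_distrib_left)
      also have "\<dots> = (\<Sum>l<qn k. w) - (qn k * a) * h"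
        using bnd(1)[OF integrable_frac_shift[OF intI]] intH shift
        by (subst Bochner_Integration.integral_diff) (auto simp: h_def)
      also have "\<dots> = qn k * (w - a * h)" by (simp add: algebra_simps)
      finally have eq: "(LINT x|circle. H x * S x) = qn k * (w - a * h)" .
      have S3: "norm (S x) \<le> 3" for x
      proof -
        have "(\<Sum>l<qn k. I (frac (x + real l * \<alpha>))) = (\<Sum>l<qn k. if frac (x + real l * \<alpha>) \<in> {0..<a} then 1 else 0)"
          by (intro sum.cong) (auto simp: I_def indicator_def)
        also have "\<dots> = of_nat (card {j. j < qn k \<and> frac (x + real j * \<alpha>) \<in> {0..<a}})"
          by (simp add: sum.If_cases Int_def lessThan_def)
        finally have "S x = of_real (card {j. j < qn k \<and> frac (x + real j * \<alpha>) \<in> {0..<a}} - qn k * a)"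
          by (simp add: S_def)
        then show ?thesis using denjoy_koksma[OF a, of k x] by (simp only: norm_of_real)
      qed
      have "qn k * norm (w - a * h) = norm (LINT x|circle. H x * S x)"
        unfolding eq by (simp add: norm_mult)
      also have "\<dots> \<le> C * (LINT x|circle. norm (S x))" by (rule bnd(2)[OF intS])
      also have "(LINT x|circle. norm (S x)) \<le> (LINT x|circle. 3)"
        using intS S3 by (intro integral_mono) auto
      also have "(LINT x|circle. (3::real)) = 3"
        using emeasure_circle_space by (simp add: measure_def)
      finally have "qn k * norm (w - a * h) \<le> C * 3" using C0 by (simp add: mult_left_mono)
      then have "norm (w - a * h) \<le> 3 * C / qn k" using q0 by (simp add: field_simps)
      also have "\<dots> \<le> 3 * C / real k"
        using qn_ge[of k] that C0 by (intro divide_left_mono) auto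
      finally show ?thesis .
    qed
    have lim: "(\<lambda>k. 3 * C / real k) \<longlonglongrightarrow> 0"
      using tendsto_mult[OF tendsto_const[of "3 * C"] lim_inverse_n] by (simp add: divide_inverse)
    have "norm (w - a * h) \<le> 0"
      by (rule tendsto_lowerbound[OF lim]) (auto intro!: eventually_sequentiallyI[of 1] est)
    then have "w = a * h" by simp
    moreover have "H x * indicator {0..<a} x = H x * I x" for x
      by (simp add: I_def indicator_def)
    ultimately show ?thesis by (simp only: w_def)
  qed
  \<comment> \<open>The sequence is constant in \<open>i\<close>, so the limit 0 means
    equality.\<close>
  have "(\<lambda>i::nat. norm ((LINT x|circle. H x * G x) - h * (LINT x|circle. G x))) \<longlonglongrightarrow> 0"
  proof (rule L1_seminorms_tendsto_0[where C = "C + norm h", OF _ _ _ _ _ G])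
    fix G K :: "real \<Rightarrow> complex"
    assume int: "integrable circle G" "integrable circle K"
    have "(LINT x|circle. H x * (G x + K x)) - h * (LINT x|circle. G x + K x)
      = ((LINT x|circle. H x * G x) - h * (LINT x|circle. G x)) + ((LINT x|circle. H x * K x) - h * (LINT x|circle. K x))"
      using int bnd(1) by (simp add: distrib_left)
    then show "norm ((LINT x|circle. H x * (G x + K x)) - h * (LINT x|circle. G x + K x))
      \<le> norm ((LINT x|circle. H x * G x) - h * (LINT x|circle. G x)) + norm ((LINT x|circle. H x * K x) - h * (LINT x|circle. K x))"
      by (simp only: norm_triangle_ineq)
  next
    fix G :: "real \<Rightarrow> complex"
    show "norm ((LINT x|circle. H x * (- G x)) - h * (LINT x|circle. - G x))
      = norm ((LINT x|circle. H x * G x) - h * (LINT x|circle. G x))"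
      by (simp add: norm_minus_commute)
  next
    fix G :: "real \<Rightarrow> complex"
    assume int: "integrable circle G"
    have "norm (h * (LINT x|circle. G x)) \<le> norm h * (LINT x|circle. norm (G x))"
      by (simp add: norm_mult mult_left_mono)
    then show "norm ((LINT x|circle. H x * G x) - h * (LINT x|circle. G x)) \<le> (C + norm h) * (LINT x|circle. norm (G x))"
      using bnd(2)[OF int] norm_triangle_ineq4[of "LINT x|circle. H x * G x" "h * (LINT x|circle. G x)"]
      by (simp add: algebra_simps)
  next
    fix a :: real and v :: complex
    assume a: "0 \<le> a" "a \<le> 1"
    have "(LINT x|circle. H x * indicator {0..<a} x *\<^sub>R v) = (LINT x|circle. (H x * indicator {0..<a} x) * v)"
      by (intro Bochner_Integration.integral_cong) (auto simp: indicator_def)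
    also have "\<dots> = a * h * v" using interval[OF a] by simp
    also have "\<dots> = h * (LINT x|circle. indicator {0..<a} x *\<^sub>R v)"
    proof -
      have I: "{0..<a} \<in> sets circle" using a by (auto simp: sets_circle)
      have "measure circle {0..<a} = a" using a I by (simp add: measure_def emeasure_circle)
      then show ?thesis
        by (simp only: integral_indicator_circle(1)[OF I]) (simp add: scaleR_conv_of_real)
    qed
    finally show "(\<lambda>i::nat. norm ((LINT x|circle. H x * indicator {0..<a} x *\<^sub>R v)
        - h * (LINT x|circle. indicator {0..<a} x *\<^sub>R v))) \<longlonglongrightarrow> 0"
      by simp
  qed simp
  then have "norm ((LINT x|circle. H x * G x) - h * (LINT x|circle. G x)) = 0"
    by (simp only: LIMSEQ_const_iff)
  then show ?thesis by (simp add: h_def)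
qed

end

context induced_rotation
begin

subsection \<open>Weak limits of powers\<close>

lemma AE_M_iff: "(AE x in M. P x) \<longleftrightarrow> (AE x in circle. x \<in> J \<longrightarrow> P x)"
proof -
  have "(AE x in M. P x) \<longleftrightarrow> (AE x in restrict_space lborel J. P x)"
    unfolding M_density using z01 by (subst AE_density) auto
  also have "\<dots> \<longleftrightarrow> (AE x in lborel. x \<in> J \<longrightarrow> P x)"
    by (rule AE_restrict_space_iff) simp
  also have "\<dots> \<longleftrightarrow> (AE x in lborel. x \<in> {0..<1} \<longrightarrow> x \<in> J \<longrightarrow> P x)"
    using z01 by (intro AE_cong) auto
  also have "\<dots> \<longleftrightarrow> (AE x in circle. x \<in> J \<longrightarrow> P x)"
    unfolding circle_def by (rule AE_restrict_space_iff[symmetric]) simp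
  finally show ?thesis .
qed

lemma vis_cocycle: "vis s x + vis r (frac (x + real s * \<alpha>)) = vis r x + vis s (frac (x + real r * \<alpha>))"
  using vis_add[of s r x] vis_add[of r s x] by (simp add: add.commute)

lemma vis_shift_1: "vis r (frac (x + \<alpha>)) + of_bool (frac x < z) = vis r x + of_bool (frac (x + real r * \<alpha>) < z)"
  using vis_cocycle[of 1 x r] by (simp add: vis_def)

text \<open>One rotation step changes \<open>vis (N i)\<close> only where exactly one of
  \<open>x\<close> and its image after \<open>N i\<close> steps lies in \<open>J\<close>; as
  \<open>N i\<close> steps amount to a small shift, this set is small.\<close>

lemma vis_almost_invariant:
  assumes c: "c \<longlonglongrightarrow> 0" "\<And>i x. frac (x + real (N i) * \<alpha>) = frac (x + c i)"
  shows "(\<lambda>i. measure circle {x \<in> {0..<1}.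
      (frac (x + \<alpha>) \<in> {x \<in> {0..<1}. Q i (vis (N i) x)}) \<noteq> (x \<in> {x \<in> {0..<1}. Q i (vis (N i) x)})}) \<longlonglongrightarrow> 0"
proof (rule tendsto_sandwich[OF _ _ tendsto_const])
  let ?E = "\<lambda>i. {x \<in> {0..<1}. Q i (vis (N i) x)}"
  let ?D = "\<lambda>i. {x \<in> {0..<1}. (frac (x + c i) \<in> J) \<noteq> (x \<in> J)}"
  show "(\<lambda>i. measure circle (?D i)) \<longlonglongrightarrow> 0"
    by (rule shift_set_tendsto[OF c(1) J_circle(1)])
  show "eventually (\<lambda>i. measure circle {x \<in> {0..<1}. (frac (x + \<alpha>) \<in> ?E i) \<noteq> (x \<in> ?E i)} \<le> measure circle (?D i)) sequentially"
  proof (intro always_eventually allI circle.finite_measure_mono)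
    fix i
    show "{x \<in> {0..<1}. (frac (x + \<alpha>) \<in> ?E i) \<noteq> (x \<in> ?E i)} \<subseteq> ?D i"
    proof
      fix x assume x: "x \<in> {x \<in> {0..<1}. (frac (x + \<alpha>) \<in> ?E i) \<noteq> (x \<in> ?E i)}"
      then have x01: "0 \<le> x" "x < 1" by auto
      have "frac (x + \<alpha>) \<in> {0..<1}" by (simp add: frac_lt_1)
      then have "vis (N i) (frac (x + \<alpha>)) \<noteq> vis (N i) x" using x by auto
      then have "(frac (x + real (N i) * \<alpha>) < z) \<noteq> (x < z)"
        using vis_shift_1[of "N i" x] x01 by (auto simp: frac_eq[THEN iffD2] split: if_splits)
      then show "x \<in> ?D i" using x01 by (simp add: c(2))
    qed
    have "?D i = ({x \<in> {0..<1}. frac (x + c i) \<in> J} - J) \<union> (J - {x \<in> {0..<1}. frac (x + c i) \<in> J})"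
      using z01 by auto
    then show "?D i \<in> sets circle"
      using sets_frac_shift[OF J_circle(1), of "c i"] J_circle(1) by simp
  qed
qed simp_all

lemma integrable_bounded_circle:
  fixes f :: "real \<Rightarrow> complex"
  assumes "f \<in> borel_measurable circle" "\<And>x. x \<in> {0..<1} \<Longrightarrow> norm (f x) \<le> C"
  shows "integrable circle f"
proof (rule circle.integrable_const_bound)
  show "AE x in circle. norm (f x) \<le> C" using assms(2) by (intro AE_I2) simp
qed (rule assms(1))

text \<open>If the drift of \<open>x\<close> is \<open>e\<close>, then \<open>(T ^^ K i) x\<close>
  is \<open>T ^^ e\<close> applied to \<open>x\<close> shifted by \<open>c i\<close>, unless the
  shift leaves \<open>J\<close>. Continuity of translation removes the shift, and equidistribution
  of the sets \<open>E e i\<close> decouples the drift from the integrand.\<close>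

lemma weak_limit:
  fixes f g :: "real \<Rightarrow> complex" and p :: "nat \<Rightarrow> real"
  assumes f: "f \<in> borel_measurable M" "\<And>x. x \<in> J \<Longrightarrow> norm (f x) \<le> C"
    and g: "g \<in> borel_measurable M" "\<And>x. x \<in> J \<Longrightarrow> norm (g x) \<le> C"
    and c: "c \<longlonglongrightarrow> 0" "\<And>i x. frac (x + real (N i) * \<alpha>) = frac (x + c i)"
    and K: "\<And>i x. x \<in> {0..<1} \<Longrightarrow> vis (N i) x \<le> K i \<and> K i \<le> vis (N i) x + B"
    and p: "\<And>e. e \<le> B \<Longrightarrow> (\<lambda>i. measure circle {x \<in> {0..<1}. K i = vis (N i) x + e}) \<longlonglongrightarrow> p e"
  shows "(\<lambda>i. LINT x|M. f ((T ^^ K i) x) * g x)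
    \<longlonglongrightarrow> (\<Sum>e\<le>B. p e *\<^sub>R (LINT x|M. f ((T ^^ e) x) * g x))"
proof -
  have C0: "0 \<le> C" using order_trans[OF norm_ge_zero f(2)[of 0]] z01 by simp
  define E where "E e i = {x \<in> {0..<1}. K i = vis (N i) x + e}" for e i
  have Em: "E e i \<in> sets circle" for e i
    unfolding E_def by (rule sets_vis[of "\<lambda>v. K i = v + e"])
  define F where "F e x = indicator J x *\<^sub>R f ((T ^^ e) x)" for e x
  define h where "h x = indicator J x *\<^sub>R g x" for x
  have fT: "(\<lambda>x. f ((T ^^ e) x)) \<in> borel_measurable M" for e
    using measurable_comp[OF T_pow_measurable f(1)] by (simp add: comp_def)
  have Fb: "norm (F e x) \<le> C" for e x
    using f(2)[OF T_pow_in[of x e]] C0 by (simp add: F_def indicator_def)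
  have hb: "norm (h x) \<le> C" for x
    using g(2)[of x] C0 by (simp add: h_def indicator_def)
  have Fm: "F e \<in> borel_measurable circle" for e
    unfolding F_def using measurable_extend[OF fT] by (rule measurable_circle)
  have hm: "h \<in> borel_measurable circle"
    unfolding h_def using measurable_extend[OF g(1)] by (rule measurable_circle)
  have Fi: "integrable circle (F e)" for e
    by (rule integrable_bounded_circle[OF Fm Fb])
  have Fhi: "integrable circle (\<lambda>x. F e x * h x)" for e
  proof (rule integrable_bounded_circle)
    show "norm (F e x * h x) \<le> C * C" for x
      using Fb[of e x] hb[of x] C0 by (simp add: norm_mult mult_mono)
  qed (intro borel_measurable_times Fm hm)
  define lhs where "lhs i x = indicator J x *\<^sub>R (f ((T ^^ K i) x) * g x)" for i x
  have lhsm: "lhs i \<in> borel_measurable circle" for i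
  proof -
    have "(\<lambda>x. f ((T ^^ K i) x) * g x) \<in> borel_measurable M"
      by (intro borel_measurable_times fT g(1))
    from measurable_extend[OF this] show ?thesis
      unfolding lhs_def by (rule measurable_circle)
  qed
  define rhs where "rhs i x = (\<Sum>e\<le>B. indicator (E e i) x *\<^sub>R (F e x * h x))" for i x
  have EFh: "integrable circle (\<lambda>x. indicator (E e i) x *\<^sub>R (F e x * h x))" for e i
    using Fhi Em by (rule integrable_mult_indicator[rotated])
  have rhsi: "integrable circle (rhs i)" for i
    unfolding rhs_def by (intro Bochner_Integration.integrable_sum EFh)
  have lhsi: "integrable circle (lhs i)" for i
  proof (rule integrable_bounded_circle[OF lhsm])
    fix x
    have "norm (f ((T ^^ K i) x) * g x) \<le> C * C" if "x \<in> J"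
      using f(2)[OF T_pow_in[OF that, of "K i"]] g(2)[OF that] C0 by (simp add: norm_mult mult_mono)
    then show "norm (lhs i x) \<le> C * C" using C0 by (simp add: lhs_def indicator_def)
  qed
  \<comment> \<open>Two sources of error: the shift inside \<open>F e\<close>, and points of
    \<open>J\<close> that the shift moves out of \<open>J\<close>.\<close>
  define err where "err i x = (\<Sum>e\<le>B. C * norm (F e (frac (x + c i)) - F e x))
      + C * C * norm (indicator J (frac (x + c i)) - indicator J x :: real)" for i x
  have Jint: "integrable circle (indicator J :: real \<Rightarrow> real)"
    using J_circle by (intro integrable_real_indicator) (auto simp: circle.emeasure_eq_measure)
  have erri: "integrable circle (err i)" for i
    unfolding err_def
    by (intro Bochner_Integration.integrable_add Bochner_Integration.integrable_sum
        integrable_mult_right integrable_norm Bochner_Integration.integrable_diff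
        Fi integrable_frac_shift[OF Fi] Jint integrable_frac_shift[OF Jint])
  have point: "norm (lhs i x - rhs i x) \<le> err i x" if x: "x \<in> {0..<1}" for i x
  proof (cases "x \<in> J")
    case False
    then have "lhs i x = 0" "rhs i x = 0" by (auto simp: lhs_def rhs_def h_def)
    moreover have "0 \<le> err i x"
      unfolding err_def using C0 by (intro add_nonneg_nonneg sum_nonneg mult_nonneg_nonneg) auto
    ultimately show ?thesis by simp
  next
    case True
    define e0 where "e0 = K i - vis (N i) x"
    have Ke: "K i = vis (N i) x + e0" "e0 \<le> B" using K[OF x, of i] by (auto simp: e0_def)
    have indE: "indicator (E e i) x = (if e = e0 then 1 else 0 :: real)" for e
      using x Ke by (auto simp: E_def indicator_def)
    have "rhs i x = (\<Sum>e\<le>B. if e = e0 then F e x * h x else 0)"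
      unfolding rhs_def indE by (intro sum.cong) auto
    also have "\<dots> = F e0 x * h x" using Ke(2) by simp
    finally have r: "rhs i x = F e0 x * h x" .
    have gx: "h x = g x" using True by (simp add: h_def)
    have gC: "norm (g x) \<le> C" by (rule g(2)[OF True])
    have term1: "C * norm (F e0 (frac (x + c i)) - F e0 x) \<le> (\<Sum>e\<le>B. C * norm (F e (frac (x + c i)) - F e x))"
      using Ke(2) C0 by (intro member_le_sum) auto
    show ?thesis
    proof (cases "frac (x + c i) < z")
      case y: True
      have "(T ^^ K i) x = (T ^^ e0) ((T ^^ vis (N i) x) x)"
        by (simp only: Ke(1) add.commute[of "vis (N i) x"] funpow_add comp_def)
      also have "(T ^^ vis (N i) x) x = frac (x + c i)"
        using T_pow_vis[OF True, of "N i"] y by (simp add: c(2))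
      finally have "lhs i x = F e0 (frac (x + c i)) * g x"
        using True y by (simp add: lhs_def F_def)
      then have "lhs i x - rhs i x = (F e0 (frac (x + c i)) - F e0 x) * g x"
        by (simp add: r gx algebra_simps)
      then have "norm (lhs i x - rhs i x) \<le> C * norm (F e0 (frac (x + c i)) - F e0 x)"
        using gC by (simp add: norm_mult mult.commute[of C] mult_left_mono)
      moreover have "0 \<le> C * C * norm (indicator J (frac (x + c i)) - indicator J x :: real)"
        using C0 by simp
      ultimately show ?thesis using term1 unfolding err_def by linarith
    next
      case y: False
      \<comment> \<open>The shifted point lies outside \<open>J\<close>, so the first error term
        already dominates \<open>rhs\<close> and the second one dominates
        \<open>lhs\<close>.\<close>
      then have "F e0 (frac (x + c i)) = 0" by (simp add: F_def)
      then have "norm (rhs i x) \<le> C * norm (F e0 (frac (x + c i)) - F e0 x)"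
        using gC by (simp add: r gx norm_mult mult.commute[of C] mult_left_mono)
      moreover have "norm (lhs i x) \<le> C * C * norm (indicator J (frac (x + c i)) - indicator J x :: real)"
        using True y f(2)[OF T_pow_in[OF True, of "K i"]] gC C0
        by (simp add: lhs_def norm_mult mult_mono)
      ultimately show ?thesis
        using term1 norm_triangle_ineq4[of "lhs i x" "rhs i x"] unfolding err_def by linarith
    qed
  qed
  have err0: "(\<lambda>i. LINT x|circle. err i x) \<longlonglongrightarrow> 0"
  proof -
    have "(LINT x|circle. err i x) = (\<Sum>e\<le>B. C * (LINT x|circle. norm (F e (frac (x + c i)) - F e x)))
      + C * C * (LINT x|circle. norm (indicator J (frac (x + c i)) - indicator J x :: real))" for i
    proof -
      have 1: "integrable circle (\<lambda>x. norm (F e (frac (x + c i)) - F e x))" for e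
        by (intro integrable_norm Bochner_Integration.integrable_diff Fi integrable_frac_shift[OF Fi])
      have 2: "integrable circle (\<lambda>x. norm (indicator J (frac (x + c i)) - indicator J x :: real))"
        by (intro integrable_norm Bochner_Integration.integrable_diff Jint integrable_frac_shift[OF Jint])
      show ?thesis unfolding err_def using 1 2 by simp
    qed
    moreover have "(\<lambda>i. (\<Sum>e\<le>B. C * (LINT x|circle. norm (F e (frac (x + c i)) - F e x)))
      + C * C * (LINT x|circle. norm (indicator J (frac (x + c i)) - indicator J x :: real)))
      \<longlonglongrightarrow> (\<Sum>e\<le>B. C * 0) + C * C * 0"
      by (intro tendsto_add tendsto_sum tendsto_mult tendsto_const shift_L1_tendsto[OF c(1)] Fi Jint)
    ultimately show ?thesis by simp
  qed
  have diff0: "(\<lambda>i. (LINT x|circle. lhs i x) - (LINT x|circle. rhs i x)) \<longlonglongrightarrow> 0"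
  proof (rule Lim_null_comparison[OF _ err0])
    show "eventually (\<lambda>i. norm ((LINT x|circle. lhs i x) - (LINT x|circle. rhs i x)) \<le> (LINT x|circle. err i x)) sequentially"
    proof (intro always_eventually allI)
      fix i
      have "norm ((LINT x|circle. lhs i x) - (LINT x|circle. rhs i x)) = norm (LINT x|circle. lhs i x - rhs i x)"
        by (simp only: Bochner_Integration.integral_diff[OF lhsi rhsi])
      also have "\<dots> \<le> (LINT x|circle. norm (lhs i x - rhs i x))" by (rule integral_norm_bound)
      also have "\<dots> \<le> (LINT x|circle. err i x)"
        by (intro integral_mono integrable_norm Bochner_Integration.integrable_diff lhsi rhsi erri)
          (simp add: point)
      finally show "norm ((LINT x|circle. lhs i x) - (LINT x|circle. rhs i x)) \<le> (LINT x|circle. err i x)" .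
    qed
  qed
  have rlim: "(\<lambda>i. LINT x|circle. rhs i x) \<longlonglongrightarrow> (\<Sum>e\<le>B. p e *\<^sub>R (LINT x|circle. F e x * h x))"
  proof -
    have "(\<lambda>i. LINT x|circle. indicator (E e i) x *\<^sub>R (F e x * h x)) \<longlonglongrightarrow> p e *\<^sub>R (LINT x|circle. F e x * h x)"
      if "e \<le> B" for e
    proof -
      have "(\<lambda>i. (LINT x|circle. indicator (E e i) x *\<^sub>R (F e x * h x))
          - measure circle (E e i) *\<^sub>R (LINT x|circle. F e x * h x)) \<longlonglongrightarrow> 0"
      proof (rule almost_invariant_equidistributed[OF Em _ Fhi])
        show "(\<lambda>i. measure circle {x \<in> {0..<1}. (frac (x + \<alpha>) \<in> E e i) \<noteq> (x \<in> E e i)}) \<longlonglongrightarrow> 0"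
          unfolding E_def by (rule vis_almost_invariant[OF c, of "\<lambda>i v. K i = v + e"])
      qed
      moreover have "(\<lambda>i. measure circle (E e i) *\<^sub>R (LINT x|circle. F e x * h x)) \<longlonglongrightarrow> p e *\<^sub>R (LINT x|circle. F e x * h x)"
        unfolding E_def by (intro tendsto_scaleR p[OF that] tendsto_const)
      ultimately show ?thesis by (rule Lim_transform[rotated])
    qed
    then have "(\<lambda>i. \<Sum>e\<le>B. LINT x|circle. indicator (E e i) x *\<^sub>R (F e x * h x))
        \<longlonglongrightarrow> (\<Sum>e\<le>B. p e *\<^sub>R (LINT x|circle. F e x * h x))"
      by (intro tendsto_sum) simp
    moreover have "(LINT x|circle. rhs i x) = (\<Sum>e\<le>B. LINT x|circle. indicator (E e i) x *\<^sub>R (F e x * h x))" for i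
      unfolding rhs_def by (rule Bochner_Integration.integral_sum) (rule EFh)
    ultimately show ?thesis by simp
  qed
  have "(\<lambda>i. LINT x|circle. lhs i x) \<longlonglongrightarrow> (\<Sum>e\<le>B. p e *\<^sub>R (LINT x|circle. F e x * h x))"
    by (rule Lim_transform[OF rlim diff0])
  then have lim: "(\<lambda>i. (1 / z) *\<^sub>R (LINT x|circle. lhs i x))
      \<longlonglongrightarrow> (1 / z) *\<^sub>R (\<Sum>e\<le>B. p e *\<^sub>R (LINT x|circle. F e x * h x))"
    by (intro tendsto_scaleR tendsto_const)
  have l: "(LINT x|M. f ((T ^^ K i) x) * g x) = (1 / z) *\<^sub>R (LINT x|circle. lhs i x)" for i
    unfolding lhs_def by (intro integral_M borel_measurable_times fT g(1))
  have r: "(LINT x|M. f ((T ^^ e) x) * g x) = (1 / z) *\<^sub>R (LINT x|circle. F e x * h x)" for e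
  proof -
    have "(LINT x|M. f ((T ^^ e) x) * g x) = (1 / z) *\<^sub>R (LINT x|circle. indicator J x *\<^sub>R (f ((T ^^ e) x) * g x))"
      by (intro integral_M borel_measurable_times fT g(1))
    also have "(\<lambda>x. indicator J x *\<^sub>R (f ((T ^^ e) x) * g x)) = (\<lambda>x. F e x * h x)"
      by (auto simp: F_def h_def indicator_def)
    finally show ?thesis .
  qed
  have "(\<Sum>e\<le>B. p e *\<^sub>R (LINT x|M. f ((T ^^ e) x) * g x)) = (1 / z) *\<^sub>R (\<Sum>e\<le>B. p e *\<^sub>R (LINT x|circle. F e x * h x))"
    unfolding r by (simp add: scaleR_sum_right mult.commute)
  then show ?thesis using lim unfolding l by simp
qed

end

lemma borel_measurable_cnj:
  "f \<in> borel_measurable N \<Longrightarrow> (\<lambda>x. cnj (f x)) \<in> borel_measurable N"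
  by (rule measurable_compose[OF _ borel_measurable_continuous_onI])
    (simp_all add: linear_continuous_on bounded_linear_cnj)

section \<open>Drift laws and absence of eigenfunctions\<close>

context induced_rotation
begin

text \<open>\<open>T ^^ K i\<close> sends most points \<open>x\<close> close to \<open>(T ^^ e) x\<close>, where the drift \<open>e = K i - vis (N i) x\<close> is
  at most \<open>B\<close> and has limit law \<open>p\<close>. Values of \<open>p\<close> beyond \<open>B\<close> are irrelevant.\<close>

definition drift_law :: "(nat \<Rightarrow> nat) \<Rightarrow> (nat \<Rightarrow> nat) \<Rightarrow> nat \<Rightarrow> (nat \<Rightarrow> real) \<Rightarrow> bool" where
  "drift_law N K B p \<longleftrightarrow>
     (\<exists>c. c \<longlonglongrightarrow> 0 \<and> (\<forall>i x. frac (x + real (N i) * \<alpha>) = frac (x + c i))) \<and>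
     (\<forall>i. \<forall>x\<in>{0..<1}. vis (N i) x \<le> K i \<and> K i \<le> vis (N i) x + B) \<and>
     (\<forall>e\<le>B. (\<lambda>i. measure circle {x \<in> {0..<1}. K i = vis (N i) x + e}) \<longlonglongrightarrow> p e)"

lemma drift_law_weak_limit:
  fixes f g :: "real \<Rightarrow> complex"
  assumes "drift_law N K B p"
    and "f \<in> borel_measurable M" "\<And>x. x \<in> J \<Longrightarrow> norm (f x) \<le> C"
    and "g \<in> borel_measurable M" "\<And>x. x \<in> J \<Longrightarrow> norm (g x) \<le> C"
  shows "(\<lambda>i. LINT x|M. f ((T ^^ K i) x) * g x)
    \<longlonglongrightarrow> (\<Sum>e\<le>B. p e *\<^sub>R (LINT x|M. f ((T ^^ e) x) * g x))"
proof -
  from assms(1) obtain c where c: "c \<longlonglongrightarrow> 0" "\<And>i x. frac (x + real (N i) * \<alpha>) = frac (x + c i)"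
    unfolding drift_law_def by blast
  show ?thesis
    by (rule weak_limit[OF assms(2-5) c]) (use assms(1) in \<open>simp_all add: drift_law_def\<close>)
qed

lemma drift_law_nonneg:
  assumes "drift_law N K B p" "e \<le> B"
  shows "0 \<le> p e"
proof (rule LIMSEQ_le_const)
  show "(\<lambda>i. measure circle {x \<in> {0..<1}. K i = vis (N i) x + e}) \<longlonglongrightarrow> p e"
    using assms by (simp add: drift_law_def)
qed simp

lemma drift_law_sum_1:
  assumes "drift_law N K B p"
  shows "(\<Sum>e\<le>B. p e) = 1"
proof -
  have "(\<lambda>i. \<Sum>e\<le>B. measure circle {x \<in> {0..<1}. K i = vis (N i) x + e}) \<longlonglongrightarrow> (\<Sum>e\<le>B. p e)"
    by (rule tendsto_sum) (use assms in \<open>simp add: drift_law_def\<close>)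
  moreover have "(\<Sum>e\<le>B. measure circle {x \<in> {0..<1}. K i = vis (N i) x + e}) = 1" for i
  proof -
    let ?A = "\<lambda>e. {x \<in> {0..<1}. K i = vis (N i) x + e}"
    have "measure circle (\<Union>e\<in>{..B}. ?A e) = (\<Sum>e\<le>B. measure circle (?A e))"
    proof (rule circle.finite_measure_finite_Union)
      show "?A ` {..B} \<subseteq> sets circle" using sets_vis[of "\<lambda>v. K i = v + _"] by blast
      show "disjoint_family_on ?A {..B}" by (auto simp: disjoint_family_on_def)
    qed simp
    moreover have "(\<Union>e\<in>{..B}. ?A e) = {0..<1}"
    proof
      show "{0..<1} \<subseteq> (\<Union>e\<in>{..B}. ?A e)"
      proof
        fix x :: real assume x: "x \<in> {0..<1}"
        then have "vis (N i) x \<le> K i" "K i \<le> vis (N i) x + B" using assms unfolding drift_law_def by blast+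
        then have "K i - vis (N i) x \<in> {..B}" "x \<in> ?A (K i - vis (N i) x)" using x by auto
        then show "x \<in> (\<Union>e\<in>{..B}. ?A e)" by blast
      qed
    qed auto
    moreover have "measure circle {0..<1} = 1" using emeasure_circle_space by (simp add: measure_def)
    ultimately show ?thesis by simp
  qed
  ultimately show ?thesis by (simp add: LIMSEQ_const_iff)
qed

lemma bounded_integrable_M:
  fixes f :: "real \<Rightarrow> 'b :: {banach, second_countable_topology}"
  assumes "f \<in> borel_measurable M" "\<And>x. x \<in> J \<Longrightarrow> norm (f x) \<le> C"
  shows "integrable M f"
proof (rule M.integrable_const_bound)
  show "AE x in M. norm (f x) \<le> C" using assms(2) by (intro AE_I2) simp
qed (rule assms(1))

lemma integral_norm_square_0:
  fixes h :: "real \<Rightarrow> complex"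
  assumes h: "h \<in> borel_measurable M" "\<And>x. x \<in> J \<Longrightarrow> norm (h x) \<le> C"
    and 0: "(LINT x|M. h x * cnj (h x)) = 0"
  shows "AE x in M. h x = 0"
proof -
  have int: "integrable M (\<lambda>x. (norm (h x))\<^sup>2)"
  proof (rule bounded_integrable_M)
    show "(\<lambda>x. (norm (h x))\<^sup>2) \<in> borel_measurable M"
      by (intro borel_measurable_power measurable_compose[OF h(1) borel_measurable_norm])
    show "norm ((norm (h x))\<^sup>2) \<le> C\<^sup>2" if "x \<in> J" for x
      using h(2)[OF that] by (simp add: power_mono)
  qed
  have "complex_of_real (LINT x|M. (norm (h x))\<^sup>2) = (LINT x|M. h x * cnj (h x))"
    by (simp only: integral_complex_of_real[symmetric] complex_norm_square)
  then have "(LINT x|M. (norm (h x))\<^sup>2) = 0" using 0 by simp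
  then have "AE x in M. (norm (h x))\<^sup>2 = 0"
    using integral_nonneg_eq_0_iff_AE[OF int] by simp
  then show ?thesis by simp
qed

text \<open>An invariant function of \<open>T\<close> extends to an invariant function of the
  rotation: a point outside \<open>J\<close> gets the value at its image, which lies in
  \<open>J\<close>. Testing the extension \<open>H\<close> against the conjugate of
  \<open>h\<close>, which has mean zero, shows that the square norm of \<open>h\<close>
  vanishes.\<close>

lemma ergodic:
  fixes h :: "real \<Rightarrow> complex"
  assumes h: "h \<in> borel_measurable M" "\<And>x. x \<in> J \<Longrightarrow> norm (h x) \<le> C"
    and inv: "AE x in M. h (T x) = h x" and mean: "(LINT x|M. h x) = 0"
  shows "AE x in M. h x = 0"
proof (rule integral_norm_square_0[OF h])
  have C0: "0 \<le> C" using order_trans[OF norm_ge_zero h(2)[of 0]] z01 by simp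
  define hJ where "hJ x = indicator J x *\<^sub>R h x" for x
  define H where "H x = hJ x + indicator {z..<1} x *\<^sub>R hJ (frac (x + \<alpha>))" for x
  have hJm: "hJ \<in> borel_measurable borel"
    unfolding hJ_def by (rule measurable_extend[OF h(1)])
  have Hm: "H \<in> borel_measurable circle"
  proof (rule measurable_circle)
    have "(\<lambda>x. hJ (frac (x + \<alpha>))) \<in> borel_measurable borel"
      using measurable_comp[OF measurable_frac_shift hJm] by (simp add: comp_def)
    then show "H \<in> borel_measurable borel"
      unfolding H_def by (intro borel_measurable_add hJm borel_measurable_scaleR borel_measurable_indicator) simp_all
  qed
  have HJ: "H x = h x" if "x \<in> J" for x
    using that by (simp add: H_def hJ_def)
  have Hout: "H x = h (frac (x + \<alpha>))" if "z \<le> x" "x < 1" for x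
    using that outside[OF that] by (simp add: H_def hJ_def)
  have Hb: "norm (H x) \<le> C" if "x \<in> {0..<1}" for x
    using HJ[of x] Hout[of x] h(2)[of x] h(2)[of "frac (x + \<alpha>)"] outside[of x] that
    by (cases "x < z") auto
  have "AE x in circle. H (frac (x + \<alpha>)) = H x"
  proof -
    have "AE x in circle. x \<in> J \<longrightarrow> h (T x) = h x" using inv by (simp only: AE_M_iff)
    then show ?thesis using AE_space
    proof eventually_elim
      case (elim x)
      then have x: "0 \<le> x" "x < 1" by auto
      define y where "y = frac (x + \<alpha>)"
      have y: "0 \<le> y" "y < 1" by (auto simp: y_def frac_lt_1)
      have yy: "frac (y + \<alpha>) = frac (x + 2 * \<alpha>)" by (simp add: y_def frac_frac_add algebra_simps)
      show "H (frac (x + \<alpha>)) = H x"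
      proof (cases "x < z")
        case True
        then have "x \<in> J" using x by simp
        have "H y = h (T x)"
        proof (cases "y < z")
          case yz: True
          then show ?thesis using T_eq[OF \<open>x \<in> J\<close>] HJ[of y] y by (simp add: y_def)
        next
          case False
          then show ?thesis using T_eq[OF \<open>x \<in> J\<close>] Hout[of y] y yy by (simp add: y_def)
        qed
        then show ?thesis using elim(1) \<open>x \<in> J\<close> HJ[OF \<open>x \<in> J\<close>] by (simp add: y_def)
      next
        case False
        then have "y < z" using outside[of x] x by (simp add: y_def)
        then show ?thesis using HJ[of y] Hout[of x] False x y by (simp add: y_def)
      qed
    qed
  qed
  note prod = integral_invariant_times[OF Hm Hb this]
  define G where "G x = cnj (hJ x)" for x
  have Gm: "G \<in> borel_measurable circle"
    unfolding G_def by (rule borel_measurable_cnj[OF measurable_circle[OF hJm]])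
  have Gi: "integrable circle G"
  proof (rule integrable_bounded_circle[OF Gm])
    show "norm (G x) \<le> C" for x
      using h(2)[of x] C0 by (simp add: G_def hJ_def indicator_def)
  qed
  have "(LINT x|M. h x) = (1 / z) *\<^sub>R (LINT x|circle. hJ x)"
    unfolding hJ_def by (rule integral_M[OF h(1)])
  then have "(LINT x|circle. hJ x) = 0" using mean z01 by simp
  then have "(LINT x|circle. G x) = 0" unfolding G_def by simp
  then have "(LINT x|circle. H x * G x) = 0" using prod[OF _ Gi] by simp
  moreover have "H x * G x = indicator J x *\<^sub>R (h x * cnj (h x))" for x
    by (simp add: H_def G_def hJ_def indicator_def)
  moreover have "(LINT x|M. h x * cnj (h x)) = (1 / z) *\<^sub>R (LINT x|circle. indicator J x *\<^sub>R (h x * cnj (h x)))"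
    by (intro integral_M borel_measurable_times h(1) borel_measurable_cnj)
  ultimately show "(LINT x|M. h x * cnj (h x)) = 0" by simp
qed

text \<open>Measure preservation gives \<open>norm \<zeta> = 1\<close> unless \<open>h\<close> is
  null. Pairing \<open>h\<close> with itself in the weak limit shows that the mean of
  \<open>\<zeta> ^ e\<close> under \<open>p\<close> has modulus 1; since two adjacent drifts are
  charged, strict convexity leaves only \<open>\<zeta> = 1\<close>, the case covered by
  ergodicity.\<close>

lemma eigenfunction_null:
  fixes h :: "real \<Rightarrow> complex"
  assumes drift: "drift_law N K B p" and e0: "Suc e0 \<le> B" "0 < p e0" "0 < p (Suc e0)"
    and h: "h \<in> borel_measurable M" "\<And>x. x \<in> J \<Longrightarrow> norm (h x) \<le> C"
    and eig: "AE x in M. h (T x) = \<zeta> * h x" and mean: "(LINT x|M. h x) = 0"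
  shows "AE x in M. h x = 0"
proof (rule ccontr)
  assume nz: "\<not> (AE x in M. h x = 0)"
  define I where "I = (LINT x|M. h x * cnj (h x))"
  have I0: "I \<noteq> 0" using integral_norm_square_0[OF h] nz by (auto simp: I_def)
  have hT: "(\<lambda>x. h ((T ^^ n) x)) \<in> borel_measurable M" for n
    using measurable_comp[OF T_pow_measurable h(1)] by (simp add: comp_def)
  have eign: "AE x in M. h ((T ^^ n) x) = \<zeta> ^ n * h x" for n
  proof (induction n)
    case (Suc n)
    have "AE x in M. h (T ((T ^^ n) x)) = \<zeta> * h ((T ^^ n) x)" by (rule AE_T_pow[OF eig])
    then show ?case using Suc by eventually_elim simp
  qed simp
  have int: "(LINT x|M. h ((T ^^ n) x) * cnj (h x)) = \<zeta> ^ n * I" for n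
  proof -
    have "(LINT x|M. h ((T ^^ n) x) * cnj (h x)) = (LINT x|M. \<zeta> ^ n * (h x * cnj (h x)))"
    proof (rule integral_cong_AE)
      show "AE x in M. h ((T ^^ n) x) * cnj (h x) = \<zeta> ^ n * (h x * cnj (h x))"
        using eign[of n] by eventually_elim simp
    qed (intro borel_measurable_times hT h(1) borel_measurable_cnj borel_measurable_const)+
    then show ?thesis by (simp add: I_def)
  qed
  have z1: "norm \<zeta> = 1"
  proof -
    have "I = (LINT x|M. h (T x) * cnj (h (T x)))"
      unfolding I_def
      using integral_T_pow[of "\<lambda>x. h x * cnj (h x)" 1, OF borel_measurable_times[OF h(1) borel_measurable_cnj[OF h(1)]]]
      by simp
    also have "\<dots> = (LINT x|M. (\<zeta> * cnj \<zeta>) * (h x * cnj (h x)))"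
    proof (rule integral_cong_AE)
      show "AE x in M. h (T x) * cnj (h (T x)) = (\<zeta> * cnj \<zeta>) * (h x * cnj (h x))"
        using eig by eventually_elim simp
      show "(\<lambda>x. h (T x) * cnj (h (T x))) \<in> borel_measurable M"
        using hT[of 1] by (intro borel_measurable_times borel_measurable_cnj) simp_all
    qed (intro borel_measurable_times h(1) borel_measurable_cnj borel_measurable_const)
    also have "\<dots> = (\<zeta> * cnj \<zeta>) * I" by (simp add: I_def)
    finally have "\<zeta> * cnj \<zeta> = 1" using I0 by simp
    then have "complex_of_real ((norm \<zeta>)\<^sup>2) = 1" by (simp only: complex_norm_square)
    then have "(norm \<zeta>)\<^sup>2 = 1" by (simp only: of_real_eq_1_iff)
    then show ?thesis by (simp add: power2_eq_1_iff) (smt (verit) norm_ge_zero)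
  qed
  have "(\<lambda>i. LINT x|M. h ((T ^^ K i) x) * cnj (h x))
      \<longlonglongrightarrow> (\<Sum>e\<le>B. p e *\<^sub>R (LINT x|M. h ((T ^^ e) x) * cnj (h x)))"
    by (rule drift_law_weak_limit[OF drift, where C = C]) (use h borel_measurable_cnj[OF h(1)] in simp_all)
  then have "(\<lambda>i. norm (\<zeta> ^ K i * I)) \<longlonglongrightarrow> norm (\<Sum>e\<le>B. p e *\<^sub>R (\<zeta> ^ e * I))"
    unfolding int by (rule tendsto_norm)
  then have "norm I = norm (\<Sum>e\<le>B. p e *\<^sub>R (\<zeta> ^ e * I))"
    by (simp add: norm_mult norm_power z1 LIMSEQ_const_iff)
  also have "(\<Sum>e\<le>B. p e *\<^sub>R (\<zeta> ^ e * I)) = (\<Sum>e\<le>B. of_real (p e) * \<zeta> ^ e) * I"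
    by (simp add: sum_distrib_right scaleR_conv_of_real mult.assoc)
  finally have one: "norm (\<Sum>e\<le>B. of_real (p e) * \<zeta> ^ e) = 1"
    using I0 by (simp add: norm_mult)
  have "\<zeta> = 1"
  proof (rule ccontr)
    assume "\<zeta> \<noteq> 1"
    let ?R = "{..B} - {e0, Suc e0}"
    have split: "(\<Sum>e\<le>B. f e) = f e0 + f (Suc e0) + (\<Sum>e\<in>?R. f e)" for f :: "nat \<Rightarrow> 'd :: comm_monoid_add"
    proof -
      have "(\<Sum>e\<le>B. f e) = (\<Sum>e\<in>?R. f e) + (\<Sum>e\<in>{e0, Suc e0}. f e)"
        by (rule sum.subset_diff) (use e0(1) in auto)
      then show ?thesis by (simp add: add.commute)
    qed
    have "norm (\<Sum>e\<in>?R. of_real (p e) * \<zeta> ^ e) \<le> (\<Sum>e\<in>?R. norm (of_real (p e) * \<zeta> ^ e))"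
      by (rule norm_sum)
    also have "\<dots> = (\<Sum>e\<in>?R. p e)"
      using drift_law_nonneg[OF drift] by (intro sum.cong) (auto simp: norm_mult norm_power z1)
    finally have R: "norm (\<Sum>e\<in>?R. of_real (p e) * \<zeta> ^ e) \<le> (\<Sum>e\<in>?R. p e)" .
    have "of_real (p e0) * \<zeta> ^ e0 + of_real (p (Suc e0)) * \<zeta> ^ Suc e0
        = \<zeta> ^ e0 * (of_real (p e0) + of_real (p (Suc e0)) * \<zeta>)"
      by (simp add: algebra_simps)
    then have "norm (of_real (p e0) * \<zeta> ^ e0 + of_real (p (Suc e0)) * \<zeta> ^ Suc e0) < p e0 + p (Suc e0)"
      using norm_convex_unit_less[OF z1 \<open>\<zeta> \<noteq> 1\<close> e0(2,3)] by (simp only: norm_mult norm_power z1) simp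
    then have "norm (\<Sum>e\<le>B. of_real (p e) * \<zeta> ^ e) < p e0 + p (Suc e0) + (\<Sum>e\<in>?R. p e)"
      unfolding split[of "\<lambda>e. of_real (p e) * \<zeta> ^ e"] using R norm_triangle_ineq
      by (smt (verit))
    also have "\<dots> = 1" using drift_law_sum_1[OF drift] split[of p] by simp
    finally show False using one by simp
  qed
  then have "AE x in M. h (T x) = h x" using eig by simp
  then show False using ergodic[OF h _ mean] nz by simp
qed

end

section \<open>Elimination\<close>

text \<open>The common pattern of \<open>ev\<close> and \<open>ev2\<close> below, where the
  coefficients are numbers and polynomials respectively.\<close>

definition lin :: "(nat \<Rightarrow> 'a::zero \<Rightarrow> 'b::comm_monoid_add) \<Rightarrow> 'a poly \<Rightarrow> 'b" where
  "lin \<phi> q = (\<Sum>i\<le>degree q. \<phi> i (coeff q i))"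

lemma lin_eq_sum:
  assumes "\<And>i. \<phi> i 0 = 0" "degree q \<le> N"
  shows "lin \<phi> q = (\<Sum>i\<le>N. \<phi> i (coeff q i))"
  unfolding lin_def using assms by (intro sum.mono_neutral_left) (auto simp: coeff_eq_0)

lemma lin_add:
  assumes "\<And>i. \<phi> i 0 = 0" "\<And>i a b. \<phi> i (a + b) = \<phi> i a + \<phi> i b"
  shows "lin \<phi> (q + r) = lin \<phi> q + lin \<phi> r"
proof -
  let ?N = "max (degree q) (degree r)"
  have "lin \<phi> (q + r) = (\<Sum>i\<le>?N. \<phi> i (coeff (q + r) i))"
    by (rule lin_eq_sum) (auto simp: assms degree_add_le_max)
  also have "\<dots> = (\<Sum>i\<le>?N. \<phi> i (coeff q i)) + (\<Sum>i\<le>?N. \<phi> i (coeff r i))"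
    by (simp add: assms sum.distrib)
  also have "\<dots> = lin \<phi> q + lin \<phi> r"
    by (simp add: lin_eq_sum[of \<phi> q ?N] lin_eq_sum[of \<phi> r ?N] assms)
  finally show ?thesis .
qed

lemma lin_sum:
  assumes "\<And>i. \<phi> i 0 = 0" "\<And>i a b. \<phi> i (a + b) = \<phi> i a + \<phi> i b" "finite A"
  shows "lin \<phi> (\<Sum>a\<in>A. f a) = (\<Sum>a\<in>A. lin \<phi> (f a))"
  using assms(3)
  by (induction A rule: finite_induct) (simp_all add: lin_add assms(1,2), simp add: lin_def assms(1))

lemma lin_pCons:
  assumes "\<And>i. \<phi> i 0 = 0"
  shows "lin \<phi> (pCons a q) = \<phi> 0 a + lin (\<lambda>i. \<phi> (Suc i)) q"
proof -
  have "lin \<phi> (pCons a q) = (\<Sum>i\<le>Suc (degree q). \<phi> i (coeff (pCons a q) i))"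
    by (rule lin_eq_sum) (simp_all only: assms degree_pCons_le)
  also have "\<dots> = \<phi> 0 a + (\<Sum>i\<le>degree q. \<phi> (Suc i) (coeff q i))"
    by (subst sum.atMost_Suc_shift) simp
  finally show ?thesis by (simp add: lin_def)
qed

text \<open>\<open>ev f q\<close> is the value at 0 of the sequence obtained by applying the polynomial \<open>q\<close> in the shift
  to \<open>f\<close>; \<open>ev2\<close> is the analogue for double sequences, the outer variable \<open>X\<close> acting as the shift in the first
  index and the inner variable \<open>Y\<close> as the shift in the second.\<close>

definition ev :: "(nat \<Rightarrow> complex) \<Rightarrow> complex poly \<Rightarrow> complex" where
  "ev f = lin (\<lambda>i c. c * f i)"

definition ev2 :: "(nat \<Rightarrow> nat \<Rightarrow> complex) \<Rightarrow> complex poly poly \<Rightarrow> complex" where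
  "ev2 F = lin (\<lambda>i. ev (F i))"

lemma ev_0 [simp]: "ev f 0 = 0"
  by (simp add: ev_def lin_def)

lemma ev_add: "ev f (q + r) = ev f q + ev f r"
  unfolding ev_def by (rule lin_add) (auto simp: algebra_simps)

lemma ev_pCons: "ev f (pCons a q) = a * f 0 + ev (\<lambda>i. f (Suc i)) q"
  unfolding ev_def by (subst lin_pCons) auto

lemma ev_smult: "ev f (smult c q) = c * ev f q"
  by (induction q arbitrary: f) (auto simp: ev_pCons algebra_simps)

lemma ev_shift: "ev f (monom 1 b * q) = ev (\<lambda>j. f (j + b)) q"
  by (induction b arbitrary: f) (simp_all add: monom_0 monom_Suc mult_pCons_left ev_pCons)

lemma ev_fun_lin: "ev (\<lambda>i. c * f i + d * g i) q = c * ev f q + d * ev g q"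
  by (induction q arbitrary: f g) (simp_all add: ev_pCons algebra_simps)

lemma ev2_0 [simp]: "ev2 F 0 = 0"
  by (simp add: ev2_def lin_def)

lemma ev2_add: "ev2 F (Q + R) = ev2 F Q + ev2 F R"
  unfolding ev2_def by (rule lin_add) (auto simp: ev_add)

lemma ev2_sum: "finite A \<Longrightarrow> ev2 F (\<Sum>a\<in>A. f a) = (\<Sum>a\<in>A. ev2 F (f a))"
  unfolding ev2_def by (rule lin_sum) (auto simp: ev_add)

lemma ev2_pCons: "ev2 F (pCons a Q) = ev (F 0) a + ev2 (\<lambda>i. F (Suc i)) Q"
  unfolding ev2_def by (subst lin_pCons) auto

lemma ev2_smult_monom: "ev2 F (smult (monom 1 b) Q) = ev2 (\<lambda>i j. F i (j + b)) Q"
  by (induction Q arbitrary: F) (auto simp: ev2_pCons ev_shift)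

lemma ev2_smult_const: "ev2 F (smult [:c:] Q) = c * ev2 F Q"
  by (induction Q arbitrary: F) (auto simp: ev2_pCons ev_smult algebra_simps)

lemma ev2_shift: "ev2 F (monom 1 a * Q) = ev2 (\<lambda>i. F (i + a)) Q"
  by (induction a arbitrary: F) (simp_all add: monom_0 monom_Suc mult_pCons_left ev2_pCons)

lemma ev2_fun_add: "ev2 (\<lambda>i j. F i j + G i j) Q = ev2 F Q + ev2 G Q"
proof (induction Q arbitrary: F G)
  case (pCons a Q)
  have "ev (\<lambda>j. F 0 j + G 0 j) a = ev (F 0) a + ev (G 0) a"
    using ev_fun_lin[of 1 "F 0" 1 "G 0" a] by simp
  then show ?case using pCons.IH[of "\<lambda>i. F (Suc i)" "\<lambda>i. G (Suc i)"] by (simp add: ev2_pCons)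
qed simp

lemma ev2_fun_scale: "ev2 (\<lambda>i j. c * F i j) Q = c * ev2 F Q"
proof (induction Q arbitrary: F)
  case (pCons a Q)
  have "ev (\<lambda>j. c * F 0 j) a = c * ev (F 0) a"
    using ev_fun_lin[of c "F 0" 0 "F 0" a] by simp
  then show ?case using pCons.IH[of "\<lambda>i. F (Suc i)"] by (simp add: ev2_pCons algebra_simps)
qed simp

lemma ev2_fun_zero: "ev2 (\<lambda>i j. 0) Q = 0"
  using ev2_fun_scale[of 0 "\<lambda>i j. 0" Q] by simp

lemma ev2_fun_sum:
  "finite A \<Longrightarrow> ev2 (\<lambda>i j. \<Sum>a\<in>A. F a i j) Q = (\<Sum>a\<in>A. ev2 (F a) Q)"
  by (induction A rule: finite_induct) (simp_all add: ev2_fun_zero ev2_fun_add)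

text \<open>The relations \<open>X\<^sup>m = Y\<^sup>n\<close> and \<open>\<Sum>p\<^sub>e X\<^sup>e = \<Sum>p'\<^sub>e Y\<^sup>e\<close> between the two shifts imply a relation in
  \<open>Y\<close> alone: the norm of \<open>\<Sum>p'\<^sub>e Y\<^sup>e - \<Sum>p\<^sub>e X\<^sup>e\<close>, which is the product of the conjugates of this element
  under \<open>X \<mapsto> \<epsilon> X\<close> for \<open>\<epsilon>\<close> an \<open>m\<close>-th root of unity.
  It is nonzero unless the second relation holds on a branch \<open>X = \<omega> s\<^sup>n\<close>, \<open>Y = s\<^sup>m\<close> of the curve
  \<open>X\<^sup>m = Y\<^sup>n\<close>.\<close>

lemma elimination:
  fixes p p' :: "nat \<Rightarrow> real"
  assumes m: "0 < m"
    and branch: "\<And>\<omega>::complex. \<omega> ^ m = 1 \<Longrightarrow>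
      (\<Sum>e\<le>B. monom (of_real (p' e)) (m * e)) \<noteq> (\<Sum>e\<le>B. monom (of_real (p e) * \<omega> ^ e) (n * e))"
  obtains D :: "complex poly" where "D \<noteq> 0"
    "\<forall>F :: nat \<Rightarrow> nat \<Rightarrow> complex.
      (\<forall>a b. F (a + m) b = F a (b + n)) \<longrightarrow>
      (\<forall>a b. (\<Sum>e\<le>B. of_real (p e) * F (a + e) b) = (\<Sum>e\<le>B. of_real (p' e) * F a (b + e))) \<longrightarrow>
      ev (F 0) D = 0"
proof -
  define \<epsilon> :: complex where "\<epsilon> = exp (2 * of_real pi * \<i> / of_nat m)"
  have eps_pow: "\<epsilon> ^ i = exp (2 * of_real pi * \<i> * of_nat i / of_nat m)" for i
    by (simp add: \<epsilon>_def flip: exp_of_nat_mult) (simp add: mult_ac)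
  have eps_1: "\<epsilon> ^ i = 1 \<longleftrightarrow> m dvd i" for i
    unfolding eps_pow using m by (intro complex_root_unity_eq_1) simp
  have eps_m: "\<epsilon> ^ m = 1" by (simp add: eps_1)
  define P' :: "complex poly" where "P' = (\<Sum>e\<le>B. monom (of_real (p' e)) e)"
  \<comment> \<open>\<open>\<theta> 0\<close> encodes the second relation, and
    \<open>\<theta> j\<close> is \<open>\<theta> 0\<close> with \<open>X\<close> replaced by
    \<open>\<epsilon> ^ j\<close> times \<open>X\<close>.\<close>
  define \<theta> :: "nat \<Rightarrow> complex poly poly"
    where "\<theta> j = [:P':] - (\<Sum>e\<le>B. monom [:of_real (p e) * \<epsilon> ^ (j * e):] e)" for j
  define Q where "Q = (\<Prod>j<m. \<theta> j)"
  have coeff_sum: "coeff (\<Sum>e\<le>B. monom (f e) e) i = (if i \<le> B then f i else 0)" for f :: "nat \<Rightarrow> complex poly" and i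
    by (simp add: coeff_sum)
  have conj: "pcompose (\<theta> j) [:0, [:\<epsilon>:]:] = \<theta> (Suc j)" for j
  proof (rule poly_eqI)
    fix i
    have pw: "[:\<epsilon>:] ^ i = [:\<epsilon> ^ i:]" for i by (induction i) (simp_all add: mult.commute one_pCons)
    have "coeff [:P':] i * [:\<epsilon> ^ i:] = coeff [:P':] i" by (cases i) simp_all
    then show "coeff (pcompose (\<theta> j) [:0, [:\<epsilon>:]:]) i = coeff (\<theta> (Suc j)) i"
      by (simp add: coeff_pcompose_linear \<theta>_def coeff_sum pw algebra_simps power_add)
  qed
  \<comment> \<open>The substitution permutes the factors cyclically; hence only powers of
    \<open>X\<close> with exponent divisible by \<open>m\<close> survive in
    \<open>Q\<close>.\<close>
  have Q_inv: "pcompose Q [:0, [:\<epsilon>:]:] = Q"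
  proof -
    obtain k where k: "m = Suc k" using m by (cases m) auto
    have th: "\<theta> (Suc k) = \<theta> 0"
      unfolding \<theta>_def k[symmetric] by (simp add: power_mult eps_m)
    have "pcompose Q [:0, [:\<epsilon>:]:] = (\<Prod>j<Suc k. \<theta> (Suc j))"
      unfolding Q_def k pcompose_prod conj ..
    also have "\<dots> = (\<Prod>j<k. \<theta> (Suc j)) * \<theta> 0" by (simp add: th)
    also have "\<dots> = Q" unfolding Q_def k by (subst prod.lessThan_Suc_shift) (simp add: mult.commute)
    finally show ?thesis .
  qed
  have coeffQ: "m dvd i" if "coeff Q i \<noteq> 0" for i
  proof -
    have pw: "[:\<epsilon>:] ^ i = [:\<epsilon> ^ i:]" by (induction i) (simp_all add: mult.commute one_pCons)
    have "coeff Q i = [:\<epsilon> ^ i:] * coeff Q i"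
      using arg_cong[OF Q_inv, of "\<lambda>q. coeff q i"] by (simp add: coeff_pcompose_linear pw)
    then have "coeff Q i * ([:\<epsilon> ^ i:] - 1) = 0" by (simp add: algebra_simps)
    then have "[:\<epsilon> ^ i:] = 1" using that by simp
    then have "\<epsilon> ^ i = 1" by (simp add: one_pCons)
    then show ?thesis by (simp add: eps_1)
  qed
  \<comment> \<open>\<open>Q\<close> with each \<open>X ^ m\<close> replaced by
    \<open>Y ^ n\<close>.\<close>
  define D where "D = (\<Sum>i\<le>degree Q. monom 1 (n * (i div m)) * coeff Q i)"
  have "D \<noteq> 0"
  proof -
    define \<Theta> where "\<Theta> j = (\<Sum>e\<le>B. monom (of_real (p' e)) (m * e))
        - (\<Sum>e\<le>B. monom (of_real (p e) * (\<epsilon> ^ j) ^ e) (n * e))" for j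
    have "\<Theta> j \<noteq> 0" for j
      using branch[of "\<epsilon> ^ j"] by (simp add: \<Theta>_def eps_1 flip: power_mult)
    then have "finite {s. poly (\<Theta> j) s = 0}" for j by (rule poly_roots_finite)
    then have "finite (\<Union>j<m. {s. poly (\<Theta> j) s = 0})" by simp
    then obtain s where s: "s \<notin> (\<Union>j<m. {s. poly (\<Theta> j) s = 0})"
      using infinite_UNIV_char_0[where 'a = complex] ex_new_if_finite by blast
    \<comment> \<open>The point \<open>X = s ^ n\<close>, \<open>Y = s ^ m\<close> lies on the
      curve, so \<open>D\<close> and \<open>Q\<close> agree there; the factor
      \<open>\<theta> j\<close> corresponds to the branch with
      \<open>\<omega> = \<epsilon> ^ j\<close>.\<close>
    have eval: "poly (poly (\<theta> j) [:s ^ n:]) (s ^ m) = poly (\<Theta> j) s" for j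
      by (simp add: \<theta>_def \<Theta>_def P'_def poly_sum poly_monom power_mult[symmetric] algebra_simps)
    have "poly (poly Q [:s ^ n:]) (s ^ m) = (\<Prod>j<m. poly (\<Theta> j) s)"
      unfolding Q_def by (simp only: poly_prod eval)
    also have "\<dots> \<noteq> 0" using s by auto
    finally have Q0: "poly (poly Q [:s ^ n:]) (s ^ m) \<noteq> 0" .
    have "poly D (s ^ m) = (\<Sum>i\<le>degree Q. (s ^ m) ^ (n * (i div m)) * poly (coeff Q i) (s ^ m))"
      by (simp add: D_def poly_sum poly_monom)
    also have "\<dots> = (\<Sum>i\<le>degree Q. poly (coeff Q i) (s ^ m) * (s ^ n) ^ i)"
    proof (rule sum.cong[OF refl])
      fix i
      show "(s ^ m) ^ (n * (i div m)) * poly (coeff Q i) (s ^ m) = poly (coeff Q i) (s ^ m) * (s ^ n) ^ i"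
      proof (cases "coeff Q i = 0")
        case False
        then have "m * (i div m) = i" using coeffQ by simp
        then have "(s ^ m) ^ (n * (i div m)) = (s ^ n) ^ i"
          by (metis power_mult mult.assoc mult.commute)
        then show ?thesis by simp
      qed simp
    qed
    also have "\<dots> = poly (poly Q [:s ^ n:]) (s ^ m)"
      by (subst (2) poly_altdef) (simp add: poly_sum poly_power)
    finally show ?thesis using Q0 by auto
  qed
  moreover have "ev (F 0) D = 0"
    if F1: "\<forall>a b. F (a + m) b = F a (b + n)"
      and F2: "\<forall>a b. (\<Sum>e\<le>B. of_real (p e) * F (a + e) b) = (\<Sum>e\<le>B. of_real (p' e) * F a (b + e))"
    for F :: "nat \<Rightarrow> nat \<Rightarrow> complex"
  proof -
    have F1': "F (m * k) b = F 0 (b + n * k)" for k b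
    proof (induction k arbitrary: b)
      case (Suc k)
      have "F (m * Suc k) b = F (m * k) (b + n)" using F1[rule_format, of "m * k" b] by (simp add: add.commute)
      then show ?case using Suc[of "b + n"] by (simp add: algebra_simps)
    qed simp
    have "ev2 F Q = (\<Sum>i\<le>degree Q. ev (F i) (coeff Q i))" by (simp add: ev2_def lin_def)
    also have "\<dots> = (\<Sum>i\<le>degree Q. ev (F 0) (monom 1 (n * (i div m)) * coeff Q i))"
    proof (rule sum.cong[OF refl])
      fix i
      show "ev (F i) (coeff Q i) = ev (F 0) (monom 1 (n * (i div m)) * coeff Q i)"
      proof (cases "coeff Q i = 0")
        case False
        then have "m * (i div m) = i" using coeffQ by simp
        then have "F i b = F 0 (b + n * (i div m))" for b using F1'[of "i div m" b] by simp
        then have "F i = (\<lambda>b. F 0 (b + n * (i div m)))" by blast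
        then show ?thesis by (simp only: ev_shift)
      qed simp
    qed
    also have "\<dots> = ev (F 0) D"
      unfolding D_def ev_def by (rule lin_sum[symmetric]) (auto simp: algebra_simps)
    finally have eq: "ev2 F Q = ev (F 0) D" .
    \<comment> \<open>Since \<open>\<theta> 0\<close> divides \<open>Q\<close>, the second relation
      makes the value of \<open>Q\<close> on \<open>F\<close> vanish.\<close>
    define R where "R = (\<Prod>j\<in>{..<m} - {0}. \<theta> j)"
    have "Q = \<theta> 0 * R"
      unfolding Q_def R_def using m by (subst prod.remove[of _ 0]) auto
    then have "Q = (\<Sum>e\<le>B. smult [:of_real (p' e):] (smult (monom 1 e) R))
        + (\<Sum>e\<le>B. smult [:- of_real (p e):] (monom 1 e * R))"
    proof -
      have 1: "[:P':] * R = (\<Sum>e\<le>B. smult [:of_real (p' e):] (smult (monom 1 e) R))"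
        by (simp add: P'_def smult_sum smult_monom)
      have 2: "- (\<Sum>e\<le>B. monom [:of_real (p e) * \<epsilon> ^ (0 * e):] e) * R
          = (\<Sum>e\<le>B. smult [:- of_real (p e):] (monom 1 e * R))"
      proof -
        have "monom [:of_real (p e) * \<epsilon> ^ (0 * e):] e = smult [:of_real (p e):] (monom 1 e)" for e
          by (simp add: smult_monom)
        then show ?thesis by (simp add: sum_distrib_right sum_negf[symmetric] flip: smult_minus_left)
      qed
      have "Q = [:P':] * R + - (\<Sum>e\<le>B. monom [:of_real (p e) * \<epsilon> ^ (0 * e):] e) * R"
        using \<open>Q = \<theta> 0 * R\<close> unfolding \<theta>_def by (simp only: diff_conv_add_uminus distrib_right)
      then show ?thesis unfolding 1 2 .
    qed
    then have "ev2 F Q = (\<Sum>e\<le>B. of_real (p' e) * ev2 (\<lambda>i j. F i (j + e)) R)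
        + (\<Sum>e\<le>B. - of_real (p e) * ev2 (\<lambda>i j. F (i + e) j) R)"
      by (simp only: ev2_add ev2_sum finite_atMost ev2_smult_const ev2_smult_monom ev2_shift)
    also have "\<dots> = ev2 (\<lambda>i j. (\<Sum>e\<le>B. of_real (p' e) * F i (j + e)) + (\<Sum>e\<le>B. - of_real (p e) * F (i + e) j)) R"
      by (simp only: ev2_fun_add ev2_fun_sum finite_atMost ev2_fun_scale)
    also have "(\<lambda>i j. (\<Sum>e\<le>B. of_real (p' e) * F i (j + e)) + (\<Sum>e\<le>B. - of_real (p e) * F (i + e) j)) = (\<lambda>i j. 0)"
      using F2 by (simp add: sum_negf)
    finally show ?thesis using eq by (simp add: ev2_fun_zero)
  qed
  ultimately show ?thesis using that by blast
qed

section \<open>Joinings of powers\<close>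

text \<open>The Radon--Nikodym derivative is at most 1 only almost everywhere. Cutting it off at 1
  yields a version bounded at every point, as the hypotheses of \<open>drift_law_weak_limit\<close>
  require.\<close>

lemma (in finite_measure) dominated_density:
  assumes sets: "sets N = sets M" and le: "\<And>A. A \<in> sets M \<Longrightarrow> emeasure N A \<le> emeasure M A"
  obtains D :: "'a \<Rightarrow> real" where "D \<in> borel_measurable M" "\<And>x. 0 \<le> D x" "\<And>x. D x \<le> 1"
    "\<And>A. A \<in> sets M \<Longrightarrow> measure N A = (LINT x:A|M. D x)"
proof -
  have spN: "space N = space M" using sets by (rule sets_eq_imp_space_eq)
  have finN: "finite_measure N"
  proof
    have "emeasure N (space N) \<le> emeasure M (space M)" using le[of "space M"] by (simp add: spN)
    then show "emeasure N (space N) \<noteq> \<infinity>" using emeasure_finite[of "space M"] by (auto simp: top_unique)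
  qed
  interpret N: finite_measure N by (rule finN)
  have ac: "absolutely_continuous M N"
  proof (unfold absolutely_continuous_def, rule subsetI)
    fix A assume "A \<in> null_sets M"
    then have "A \<in> sets M" "emeasure M A = 0" by auto
    then show "A \<in> null_sets N" using le[of A] sets by (auto simp: null_sets_def)
  qed
  obtain F where F: "F \<in> borel_measurable M" "AE x in M. RN_deriv M N x = ennreal (F x)" "\<And>x. 0 \<le> F x"
    using real_RN_deriv[OF finN ac sets] by metis
  have dens: "density M (\<lambda>x. ennreal (F x)) = N"
  proof -
    have "density M (\<lambda>x. ennreal (F x)) = density M (RN_deriv M N)"
      using F by (intro density_cong) auto
    then show ?thesis using density_RN_deriv[OF ac sets] by simp
  qed
  have Fint: "integrable M F"
  proof -
    have "integrable (density M (\<lambda>x. ennreal (F x))) (\<lambda>x. 1 :: real)"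
      unfolding dens by simp
    then show ?thesis using F by (simp add: integrable_real_density[where f = F] integrable_density)
  qed
  have meas: "measure N A = (LINT x:A|M. F x)" if A: "A \<in> sets M" for A
  proof -
    have "measure N A = (LINT x|N. indicator A x)" using A by (simp add: sets spN)
    also have "\<dots> = (LINT x|density M (\<lambda>x. ennreal (F x)). indicator A x)" by (simp only: dens)
    also have "\<dots> = (LINT x|M. F x *\<^sub>R indicator A x)"
      using A F by (intro integral_density) auto
    also have "\<dots> = (LINT x:A|M. F x)" by (simp add: set_lebesgue_integral_def mult.commute)
    finally show ?thesis .
  qed
  \<comment> \<open>On the set where the derivative exceeds 1, domination makes the integral of the
    nonnegative excess at most 0.\<close>
  define S where "S = {x \<in> space M. 1 < F x}"
  have S: "S \<in> sets M" unfolding S_def using F(1) by measurable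
  have int1: "integrable M (\<lambda>x. indicator S x *\<^sub>R (F x - 1))"
    using S Fint by (intro integrable_mult_indicator Bochner_Integration.integrable_diff) auto
  have "(LINT x|M. indicator S x *\<^sub>R (F x - 1)) = measure N S - measure M S"
  proof -
    have i: "integrable M (\<lambda>x. indicator S x *\<^sub>R F x)" using S Fint by (intro integrable_mult_indicator)
    have j: "integrable M (indicator S :: _ \<Rightarrow> real)" using S by (intro integrable_real_indicator) (auto simp: emeasure_eq_measure)
    have "(LINT x|M. indicator S x *\<^sub>R (F x - 1)) = (LINT x|M. indicator S x *\<^sub>R F x - indicator S x)"
      by (simp add: algebra_simps)
    also have "\<dots> = (LINT x|M. indicator S x *\<^sub>R F x) - (LINT x|M. indicator S x)"
      by (rule Bochner_Integration.integral_diff[OF i j])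
    also have "(LINT x|M. indicator S x) = measure M S"
      using S sets.sets_into_space[OF S] by (simp add: Int_absorb2)
    finally show ?thesis by (simp add: meas[OF S] set_lebesgue_integral_def)
  qed
  also have "\<dots> \<le> 0"
    using le[OF S] S by (simp add: emeasure_eq_measure N.emeasure_eq_measure)
  finally have "(LINT x|M. indicator S x *\<^sub>R (F x - 1)) \<le> 0" .
  moreover have nn: "AE x in M. 0 \<le> indicator S x *\<^sub>R (F x - 1)"
    by (intro AE_I2) (auto simp: S_def indicator_def)
  ultimately have "(LINT x|M. indicator S x *\<^sub>R (F x - 1)) = 0"
    using integral_nonneg_AE[OF nn] by linarith
  then have "AE x in M. indicator S x *\<^sub>R (F x - 1) = 0"
    using integral_nonneg_eq_0_iff_AE[OF int1 nn] by simp
  then have le1: "AE x in M. F x \<le> 1"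
    using AE_space by eventually_elim (auto simp: S_def indicator_def split: if_splits)
  show ?thesis
  proof (rule that[of "\<lambda>x. min 1 (F x)"])
    show "(\<lambda>x. min 1 (F x)) \<in> borel_measurable M" using F(1) by measurable
    show "measure N A = (LINT x:A|M. min 1 (F x))" if A: "A \<in> sets M" for A
      unfolding meas[OF A] set_lebesgue_integral_def
    proof (rule integral_cong_AE)
      show "(\<lambda>x. indicator A x *\<^sub>R F x) \<in> borel_measurable M" using A F(1) by measurable
      show "(\<lambda>x. indicator A x *\<^sub>R min 1 (F x)) \<in> borel_measurable M" using A F(1) by measurable
      show "AE x in M. indicator A x *\<^sub>R F x = indicator A x *\<^sub>R min 1 (F x)"
        using le1 by eventually_elim simp
    qed
  qed (use F(3) in auto)
qed

text \<open>\<open>D\<close> is the conditional probability of \<open>S\<close> given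
  \<open>v\<close>, obtained as the density of the image under \<open>v\<close> of
  \<open>\<nu>\<close> restricted to \<open>S\<close>.\<close>

lemma (in finite_measure) section_density:
  assumes v: "v \<in> measurable \<nu> M" and marg: "distr \<nu> M v = M" and S: "S \<in> sets \<nu>"
  obtains D :: "'a \<Rightarrow> real" where "D \<in> borel_measurable M" "\<And>x. 0 \<le> D x" "\<And>x. D x \<le> 1"
    "\<And>A. A \<in> sets M \<Longrightarrow> measure \<nu> (S \<inter> v -` A) = (LINT x:A|M. D x)"
proof -
  define N where "N = distr (density \<nu> (indicator S)) M v"
  have v': "v \<in> measurable (density \<nu> (indicator S)) M" using v by simp
  have N: "emeasure N A = emeasure \<nu> (S \<inter> v -` A)" if A: "A \<in> sets M" for A
  proof -
    have vA: "v -` A \<inter> space \<nu> \<in> sets \<nu>" using measurable_sets[OF v A] .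
    have "emeasure N A = emeasure (density \<nu> (indicator S)) (v -` A \<inter> space \<nu>)"
      unfolding N_def using A v' by (simp add: emeasure_distr)
    also have "\<dots> = (\<integral>\<^sup>+x. indicator S x * indicator (v -` A \<inter> space \<nu>) x \<partial>\<nu>)"
      using vA S by (intro emeasure_density) auto
    also have "\<dots> = (\<integral>\<^sup>+x. indicator (S \<inter> (v -` A \<inter> space \<nu>)) x \<partial>\<nu>)"
      by (simp add: indicator_inter_arith)
    also have "\<dots> = emeasure \<nu> (S \<inter> (v -` A \<inter> space \<nu>))"
      using vA S by (intro nn_integral_indicator) auto
    also have "S \<inter> (v -` A \<inter> space \<nu>) = S \<inter> v -` A" using sets.sets_into_space[OF S] by auto
    finally show ?thesis .
  qed
  have sets_N: "sets N = sets M" by (simp add: N_def)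
  have le_N: "emeasure N A \<le> emeasure M A" if A: "A \<in> sets M" for A
  proof -
    have "S \<inter> v -` A \<subseteq> v -` A \<inter> space \<nu>" using sets.sets_into_space[OF S] by auto
    then have "emeasure N A \<le> emeasure \<nu> (v -` A \<inter> space \<nu>)"
      unfolding N[OF A] by (rule emeasure_mono) (rule measurable_sets[OF v A])
    also have "\<dots> = emeasure M A" using emeasure_distr[OF v A] marg by simp
    finally show ?thesis .
  qed
  obtain D where D: "D \<in> borel_measurable M" "\<And>x. 0 \<le> D x" "\<And>x. D x \<le> 1"
    "\<And>A. A \<in> sets M \<Longrightarrow> measure N A = (LINT x:A|M. D x)"
    by (rule dominated_density[OF sets_N le_N]) (assumption, rule that, assumption+)
  show ?thesis
  proof (rule that[OF D(1-3)])
    show "measure \<nu> (S \<inter> v -` A) = (LINT x:A|M. D x)" if "A \<in> sets M" for A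
      using D(4)[OF that] N[OF that] by (simp add: measure_def)
  qed
qed

text \<open>This is the case excluded in \<open>elimination\<close>. As the weights are nonnegative,
  comparing norms of coefficients removes the root of unity: \<open>m e\<close> under
  \<open>p'\<close> and \<open>n e\<close> under \<open>p\<close> have the same law. Supports and
  second moments follow.\<close>

lemma compatible_laws:
  fixes p p' :: "nat \<Rightarrow> real" and \<omega> :: complex
  assumes mn: "0 < m" "0 < n" and w: "\<omega> ^ m = 1"
    and nn: "\<And>e. e \<le> B \<Longrightarrow> 0 \<le> p e" "\<And>e. e \<le> B \<Longrightarrow> 0 \<le> p' e"
    and eq: "(\<Sum>e\<le>B. monom (of_real (p' e)) (m * e)) = (\<Sum>e\<le>B. monom (of_real (p e) * \<omega> ^ e) (n * e))"
  shows "\<And>e. e \<le> B \<Longrightarrow> 0 < p e \<Longrightarrow> m dvd n * e"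
    and "\<And>e. e \<le> B \<Longrightarrow> 0 < p' e \<Longrightarrow> n dvd m * e"
    and "(\<Sum>e\<le>B. p' e * (real (m * e))\<^sup>2) = (\<Sum>e\<le>B. p e * (real (n * e))\<^sup>2)"
proof -
  have w1: "norm \<omega> = 1"
  proof -
    have "norm \<omega> ^ m = 1 ^ m" using w by (simp flip: norm_power)
    then show ?thesis using mn by (intro power_eq_imp_eq_base[of "norm \<omega>" m 1]) auto
  qed
  \<comment> \<open>At most one \<open>e\<close> solves \<open>r e = k\<close>, so each coefficient
    is a single weight and its norm is explicit.\<close>
  have one: "(\<Sum>e\<le>B. if r * e = k then f e else 0) = (if k div r \<le> B \<and> r dvd k then f (k div r) else 0)"
    if "0 < r" for r k :: nat and f :: "nat \<Rightarrow> 'd :: comm_monoid_add"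
  proof (cases "r dvd k")
    case True
    then have "r * e = k \<longleftrightarrow> e = k div r" for e using that by auto
    then show ?thesis using True by simp
  next
    case False
    then have "r * e \<noteq> k" for e by auto
    then show ?thesis using False by simp
  qed
  have co: "(\<Sum>e\<le>B. if m * e = k then p' e else 0) = (\<Sum>e\<le>B. if n * e = k then p e else 0)" for k
  proof -
    have "(\<Sum>e\<le>B. if m * e = k then complex_of_real (p' e) else 0)
        = (\<Sum>e\<le>B. if n * e = k then complex_of_real (p e) * \<omega> ^ e else 0)"
      using arg_cong[OF eq, of "\<lambda>q. coeff q k"] by (simp add: coeff_sum)
    note n = arg_cong[OF this[unfolded one[OF mn(1)] one[OF mn(2)]], of norm]
    define c1 c2 where c: "c1 \<longleftrightarrow> k div m \<le> B \<and> m dvd k" "c2 \<longleftrightarrow> k div n \<le> B \<and> n dvd k"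
    have "c1 \<Longrightarrow> 0 \<le> p' (k div m)" "c2 \<Longrightarrow> 0 \<le> p (k div n)" using nn c by auto
    then show ?thesis
      unfolding one[OF mn(1)] one[OF mn(2)] c[symmetric] using n[folded c]
      by (cases c1; cases c2) (simp_all add: norm_mult norm_power w1)
  qed
  show "m dvd n * e" if "e \<le> B" "0 < p e" for e
  proof (rule ccontr)
    assume "\<not> m dvd n * e"
    then show False using co[of "n * e"] that mn by (simp add: one[OF mn(1)] one[OF mn(2)])
  qed
  show "n dvd m * e" if "e \<le> B" "0 < p' e" for e
  proof (rule ccontr)
    assume "\<not> n dvd m * e"
    then show False using co[of "m * e"] that mn by (simp add: one[OF mn(1)] one[OF mn(2)])
  qed
  \<comment> \<open>Bounds every exponent \<open>m e\<close> and \<open>n e\<close>, so that both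
    moments can be summed over the same range of degrees.\<close>
  define N where "N = (m + n) * B"
  have moment: "(\<Sum>e\<le>B. f e * (real (r * e))\<^sup>2) = (\<Sum>k\<le>N. (real k)\<^sup>2 * (\<Sum>e\<le>B. if r * e = k then f e else 0))"
    if "r \<le> m + n" for r and f :: "nat \<Rightarrow> real"
  proof -
    have "(\<Sum>k\<le>N. (real k)\<^sup>2 * (\<Sum>e\<le>B. if r * e = k then f e else 0))
        = (\<Sum>k\<le>N. \<Sum>e\<le>B. if k = r * e then (real k)\<^sup>2 * f e else 0)"
      unfolding sum_distrib_left by (intro sum.cong) auto
    also have "\<dots> = (\<Sum>e\<le>B. \<Sum>k\<le>N. if k = r * e then (real k)\<^sup>2 * f e else 0)"
      by (rule sum.swap)
    also have "\<dots> = (\<Sum>e\<le>B. f e * (real (r * e))\<^sup>2)"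
    proof (rule sum.cong[OF refl])
      fix e assume "e \<in> {..B}"
      then have "r * e \<le> N" unfolding N_def using that by (intro mult_mono) auto
      then show "(\<Sum>k\<le>N. if k = r * e then (real k)\<^sup>2 * f e else 0) = f e * (real (r * e))\<^sup>2"
        by (simp add: mult.commute)
    qed
    finally show ?thesis by simp
  qed
  show "(\<Sum>e\<le>B. p' e * (real (m * e))\<^sup>2) = (\<Sum>e\<le>B. p e * (real (n * e))\<^sup>2)"
    using moment[of m p'] moment[of n p] by (simp only: co)
qed

section \<open>From weak limits to the product joining\<close>

context induced_rotation
begin

text \<open>After a linear factor with root \<open>\<zeta>\<close> is split off, the function
  \<open>h (T x) - \<zeta> * h x\<close> is annihilated by the cofactor, hence null by induction on
  the degree; so \<open>h\<close> is an eigenfunction. Boundedness and mean zero pass to the new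
  function.\<close>

lemma polynomial_annihilates:
  fixes h :: "real \<Rightarrow> complex" and D :: "complex poly"
  assumes noeig: "\<And>(h :: real \<Rightarrow> complex) C \<zeta>. h \<in> borel_measurable M \<Longrightarrow> (\<And>x. x \<in> J \<Longrightarrow> norm (h x) \<le> C) \<Longrightarrow>
      (AE x in M. h (T x) = \<zeta> * h x) \<Longrightarrow> (LINT x|M. h x) = 0 \<Longrightarrow> AE x in M. h x = 0"
    and h: "h \<in> borel_measurable M" "\<And>x. x \<in> J \<Longrightarrow> norm (h x) \<le> C"
    and mean: "(LINT x|M. h x) = 0"
    and D: "D \<noteq> 0" "AE x in M. ev (\<lambda>i. h ((T ^^ i) x)) D = 0"
  shows "AE x in M. h x = 0"
  using D h mean
proof (induction "degree D" arbitrary: D h C rule: less_induct)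
  case less
  show ?case
  proof (cases "degree D = 0")
    case True
    then obtain a where "D = [:a:]" by (rule degree_eq_zeroE)
    then have "AE x in M. a * h x = 0" "a \<noteq> 0"
      using less.prems(1,2) by (simp_all add: ev_pCons)
    then show ?thesis by simp
  next
    case False
    then obtain \<zeta> where "poly D \<zeta> = 0" using alg_closed_imp_poly_has_root[of D] by auto
    then obtain E where E: "D = [:- \<zeta>, 1:] * E" by (auto simp: poly_eq_0_iff_dvd dvd_def)
    have E0: "E \<noteq> 0" using E less.prems(1) by auto
    have deg: "degree E < degree D"
      unfolding E using E0 by (subst degree_mult_eq) auto
    define k where "k x = h (T x) - \<zeta> * h x" for x
    have hT: "(\<lambda>x. h (T x)) \<in> borel_measurable M"
      using measurable_comp[OF T_measurable less.prems(3)] by (simp add: comp_def)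
    have km: "k \<in> borel_measurable M"
      unfolding k_def by (intro borel_measurable_diff borel_measurable_times borel_measurable_const hT less.prems(3))
    have kb: "norm (k x) \<le> C + norm \<zeta> * C" if x: "x \<in> J" for x
    proof -
      have "norm (k x) \<le> norm (h (T x)) + norm (\<zeta> * h x)" unfolding k_def by (rule norm_triangle_ineq4)
      also have "\<dots> \<le> C + norm \<zeta> * C"
        using less.prems(4)[OF x] less.prems(4)[OF T_in[OF x]] by (intro add_mono) (simp_all add: norm_mult mult_left_mono)
      finally show ?thesis .
    qed
    have hi: "integrable M h" by (rule bounded_integrable_M[OF less.prems(3,4)])
    have hTi: "integrable M (\<lambda>x. h (T x))"
      by (rule bounded_integrable_M[OF hT]) (rule less.prems(4)[OF T_in])
    have "(LINT x|M. k x) = (LINT x|M. h (T x)) - \<zeta> * (LINT x|M. h x)"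
      unfolding k_def using hi hTi by simp
    also have "(LINT x|M. h (T x)) = (LINT x|M. h x)"
      using integral_T_pow[OF less.prems(3), of 1] by simp
    finally have kmean: "(LINT x|M. k x) = 0" using less.prems(5) by simp
    have "AE x in M. ev (\<lambda>i. k ((T ^^ i) x)) E = 0"
      using less.prems(2)
    proof eventually_elim
      case (elim x)
      have "[:- \<zeta>, 1:] * E = smult (- \<zeta>) E + pCons 0 E" by simp
      then have "ev (\<lambda>i. h ((T ^^ i) x)) D = - \<zeta> * ev (\<lambda>i. h ((T ^^ i) x)) E + ev (\<lambda>i. h ((T ^^ Suc i) x)) E"
        unfolding E by (simp add: ev_add ev_smult ev_pCons del: smult_minus_left)
      also have "\<dots> = ev (\<lambda>i. 1 * h ((T ^^ Suc i) x) + (- \<zeta>) * h ((T ^^ i) x)) E"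
        by (subst ev_fun_lin) simp
      also have "\<dots> = ev (\<lambda>i. k ((T ^^ i) x)) E" by (simp add: k_def)
      finally show ?case using elim by simp
    qed
    then have "AE x in M. k x = 0"
      by (rule less.hyps[OF deg E0 _ km kb kmean])
    then have eig: "AE x in M. h (T x) = \<zeta> * h x" by (simp add: k_def)
    show ?thesis
    proof (rule noeig)
      show "norm (h x) \<le> C" if "x \<in> J" for x by (rule less.prems(4)[OF that])
    qed (fact less.prems(3) eig less.prems(5))+
  qed
qed

text \<open>\<open>\<phi> a\<close> is the conditional probability, given the second coordinate,
  that the first lies in the preimage of \<open>A\<close> under \<open>T ^^ a\<close>. Raising
  \<open>a\<close> acts as the shift \<open>X\<close>, composing with \<open>T\<close> as the shift
  \<open>Y\<close>. Invariance of the joining and the weak limits supply the two relations of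
  \<open>elimination\<close>, and the resulting polynomial in \<open>T\<close> forces
  \<open>\<phi> 0\<close> to be constant.\<close>

lemma joining_rectangle:
  assumes m: "0 < m"
    and drift1: "drift_law N1 (\<lambda>i. m * r i) B p" and drift2: "drift_law N2 (\<lambda>i. n * r i) B p'"
    and branch: "\<And>\<omega>::complex. \<omega> ^ m = 1 \<Longrightarrow>
      (\<Sum>e\<le>B. monom (of_real (p' e)) (m * e)) \<noteq> (\<Sum>e\<le>B. monom (of_real (p e) * \<omega> ^ e) (n * e))"
    and noeig: "\<And>h C \<zeta>. h \<in> borel_measurable M \<Longrightarrow> (\<And>x. x \<in> J \<Longrightarrow> norm (h x) \<le> C) \<Longrightarrow>
      (AE x in M. h (T x) = \<zeta> * h x) \<Longrightarrow> (LINT x|M. h x) = 0 \<Longrightarrow> AE x in M. (h x :: complex) = 0"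
    and joint: "joining M (T ^^ m) M (T ^^ n) \<nu>"
    and A: "A \<in> sets M" and B': "B' \<in> sets M"
  shows "measure \<nu> (A \<times> B') = measure M A * measure M B'"
proof -
  have s\<nu>: "sets \<nu> = sets (M \<Otimes>\<^sub>M M)" and f\<nu>: "distr \<nu> M fst = M" and g\<nu>: "distr \<nu> M snd = M"
    and inv: "distr \<nu> (M \<Otimes>\<^sub>M M) (map_prod (T ^^ m) (T ^^ n)) = \<nu>"
    using joint by (auto simp: joining_def)
  have sp: "space \<nu> = J \<times> J" using sets_eq_imp_space_eq[OF s\<nu>] by (simp add: space_pair_measure)
  have rect: "X \<times> Y \<in> sets \<nu>" if "X \<in> sets M" "Y \<in> sets M" for X Y
    using that by (simp add: s\<nu>)
  have fstm: "fst \<in> measurable \<nu> M" and sndm: "snd \<in> measurable \<nu> M"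
    using measurable_cong_sets[OF s\<nu> refl] by auto
  have Tmm: "map_prod (T ^^ m) (T ^^ n) \<in> measurable \<nu> (M \<Otimes>\<^sub>M M)"
  proof -
    have "(\<lambda>w. ((T ^^ m) (fst w), (T ^^ n) (snd w))) \<in> measurable \<nu> (M \<Otimes>\<^sub>M M)"
      using measurable_comp[OF fstm T_pow_measurable] measurable_comp[OF sndm T_pow_measurable]
      by (intro measurable_Pair) (simp_all add: comp_def)
    moreover have "(\<lambda>w. ((T ^^ m) (fst w), (T ^^ n) (snd w))) = map_prod (T ^^ m) (T ^^ n)"
      by (auto simp: map_prod_def)
    ultimately show ?thesis by simp
  qed
  have pre: "(T ^^ k) -` X \<inter> J \<in> sets M" if "X \<in> sets M" for k X
    using measurable_sets[OF T_pow_measurable that, of k] by simp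
  have subJ: "X \<subseteq> J" if "X \<in> sets M" for X using that by (simp add: sets_M)
  have invariant: "measure \<nu> (((T ^^ m) -` X \<inter> J) \<times> ((T ^^ n) -` Y \<inter> J)) = measure \<nu> (X \<times> Y)"
    if "X \<in> sets M" "Y \<in> sets M" for X Y
  proof -
    have "measure (distr \<nu> (M \<Otimes>\<^sub>M M) (map_prod (T ^^ m) (T ^^ n))) (X \<times> Y)
        = measure \<nu> (map_prod (T ^^ m) (T ^^ n) -` (X \<times> Y) \<inter> space \<nu>)"
      using Tmm that by (intro measure_distr) auto
    also have "map_prod (T ^^ m) (T ^^ n) -` (X \<times> Y) \<inter> space \<nu> = ((T ^^ m) -` X \<inter> J) \<times> ((T ^^ n) -` Y \<inter> J)"
      by (auto simp: sp)
    finally show ?thesis by (simp add: inv)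
  qed
  define S where "S a = (T ^^ a) -` A \<inter> J" for a
  have Sm: "S a \<in> sets M" for a unfolding S_def by (rule pre[OF A])
  have S_add: "S (a + b) = (T ^^ b) -` (S a) \<inter> J" for a b
    unfolding S_def using T_pow_in[of _ b] by (auto simp: funpow_add simp del: atLeastLessThan_iff)
  have "\<exists>D. D \<in> borel_measurable M \<and> (\<forall>x. 0 \<le> D x) \<and> (\<forall>x. D x \<le> 1) \<and>
      (\<forall>Y\<in>sets M. measure \<nu> (S a \<times> Y) = (LINT y:Y|M. D y))" for a
  proof -
    obtain D :: "real \<Rightarrow> real" where D: "D \<in> borel_measurable M" "\<And>x. 0 \<le> D x" "\<And>x. D x \<le> 1"
      "\<And>Y. Y \<in> sets M \<Longrightarrow> measure \<nu> ((S a \<times> J) \<inter> snd -` Y) = (LINT x:Y|M. D x)"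
    proof (rule M.section_density[OF sndm g\<nu>])
      show "S a \<times> J \<in> sets \<nu>" using Sm sets.top[of M] by (intro rect) auto
    qed blast
    have "(S a \<times> J) \<inter> snd -` Y = S a \<times> Y" if "Y \<in> sets M" for Y
      using subJ[OF that] by auto
    then show ?thesis using D by (intro exI[of _ D]) auto
  qed
  then obtain \<phi> :: "nat \<Rightarrow> real \<Rightarrow> real" where \<phi>m: "\<And>a. \<phi> a \<in> borel_measurable M"
    and \<phi>0: "\<And>a x. 0 \<le> \<phi> a x" and \<phi>1: "\<And>a x. \<phi> a x \<le> 1"
    and \<phi>: "\<And>a Y. Y \<in> sets M \<Longrightarrow> measure \<nu> (S a \<times> Y) = (LINT y:Y|M. \<phi> a y)"
    by metis
  have \<phi>T: "(\<lambda>y. \<phi> a ((T ^^ k) y)) \<in> borel_measurable M" for a k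
    using measurable_comp[OF T_pow_measurable \<phi>m] by (simp add: comp_def)
  have \<phi>Ti: "integrable M (\<lambda>y. \<phi> a ((T ^^ k) y))" for a k
    by (rule bounded_integrable_M[OF \<phi>T, of _ _ 1]) (use \<phi>0 \<phi>1 in simp)
  have \<phi>i: "integrable M (\<phi> a)" for a using \<phi>Ti[of a 0] by simp
  have step: "AE y in M. \<phi> (a + m) y = \<phi> a ((T ^^ n) y)" for a
  proof (rule density_unique_real[OF \<phi>i \<phi>Ti])
    fix Y assume "Y \<in> sets M"
    \<comment> \<open>Every test set is a preimage under \<open>T ^^ n\<close>, which makes the
      invariance of the joining applicable to all \<open>Y\<close>.\<close>
    then obtain Z where Z: "Z \<in> sets M" "Y = (T ^^ n) -` Z \<inter> J" by (rule T_pow_vimage_surj)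
    have "(LINT y:Y|M. \<phi> (a + m) y) = measure \<nu> (S (a + m) \<times> Y)" using \<open>Y \<in> sets M\<close> by (simp add: \<phi>)
    also have "\<dots> = measure \<nu> (S a \<times> Z)"
      unfolding S_add Z(2) by (rule invariant[OF Sm Z(1)])
    also have "\<dots> = (LINT y|M. indicator Z y *\<^sub>R \<phi> a y)"
      by (simp only: \<phi>[OF Z(1)] set_lebesgue_integral_def)
    also have "\<dots> = (LINT y|M. indicator Z ((T ^^ n) y) *\<^sub>R \<phi> a ((T ^^ n) y))"
      using Z(1) \<phi>m by (intro integral_T_pow[symmetric] borel_measurable_scaleR borel_measurable_indicator)
    also have "\<dots> = (LINT y:Y|M. \<phi> a ((T ^^ n) y))"
      unfolding set_lebesgue_integral_def
      by (rule Bochner_Integration.integral_cong) (auto simp: Z(2) indicator_def)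
    finally show "(LINT y:Y|M. \<phi> (a + m) y) = (LINT y:Y|M. \<phi> a ((T ^^ n) y))" .
  qed
  have steps: "AE y in M. \<phi> (a + m * k) y = \<phi> a ((T ^^ (n * k)) y)" for a k
  proof (induction k)
    case (Suc k)
    have "AE y in M. \<phi> (a + m) ((T ^^ (n * k)) y) = \<phi> a ((T ^^ n) ((T ^^ (n * k)) y))"
      by (rule AE_T_pow[OF step])
    moreover have "AE y in M. \<phi> (a + m + m * k) y = \<phi> (a + m) ((T ^^ (n * k)) y)"
    proof (induction k)
      case (Suc k)
      have "AE y in M. \<phi> (a + m + m * k + m) y = \<phi> (a + m + m * k) ((T ^^ n) y)" by (rule step)
      moreover have "AE y in M. \<phi> (a + m + m * k) ((T ^^ n) y) = \<phi> (a + m) ((T ^^ (n * k)) ((T ^^ n) y))"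
        by (rule AE_T_pow[OF Suc])
      ultimately show ?case
        by eventually_elim (simp add: funpow_add[THEN fun_cong, symmetric, unfolded comp_def] algebra_simps)
    qed simp
    ultimately show ?case
      by eventually_elim (simp add: funpow_add algebra_simps)
  qed simp
  \<comment> \<open>Both sides are weak limits, along the exponents \<open>m * r i\<close> and
    \<open>n * r i\<close>, of sequences that coincide by \<open>steps\<close>.\<close>
  have key: "AE y in M. (\<Sum>e\<le>B. p e * \<phi> (a + e) y) = (\<Sum>e\<le>B. p' e * \<phi> a ((T ^^ e) y))" for a
  proof (rule density_unique_real)
    show "integrable M (\<lambda>y. \<Sum>e\<le>B. p e * \<phi> (a + e) y)"
      by (intro Bochner_Integration.integrable_sum integrable_mult_right \<phi>i)
    show "integrable M (\<lambda>y. \<Sum>e\<le>B. p' e * \<phi> a ((T ^^ e) y))"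
      by (intro Bochner_Integration.integrable_sum integrable_mult_right \<phi>Ti)
    fix Y assume Y: "Y \<in> sets M"
    \<comment> \<open>Conditional probability of \<open>Y\<close> given the first coordinate: it
      turns the measures of rectangles over \<open>S (a + k)\<close> into integrals over
      \<open>M\<close>, where the weak limit is available.\<close>
    obtain \<psi> :: "real \<Rightarrow> real" where \<psi>m: "\<psi> \<in> borel_measurable M" and \<psi>0: "\<And>x. 0 \<le> \<psi> x" and \<psi>1: "\<And>x. \<psi> x \<le> 1"
      and \<psi>': "\<And>X. X \<in> sets M \<Longrightarrow> measure \<nu> ((J \<times> Y) \<inter> fst -` X) = (LINT x:X|M. \<psi> x)"
    proof (rule M.section_density[OF fstm f\<nu>])
      show "J \<times> Y \<in> sets \<nu>" using Y sets.top[of M] by (intro rect) auto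
    qed blast
    have \<psi>: "measure \<nu> (X \<times> Y) = (LINT x:X|M. \<psi> x)" if "X \<in> sets M" for X
    proof -
      have "(J \<times> Y) \<inter> fst -` X = X \<times> Y" using subJ[OF that] by auto
      then show ?thesis using \<psi>'[OF that] by simp
    qed
    define f1 where "f1 x = complex_of_real (indicator (S a) x)" for x
    define g1 where "g1 x = complex_of_real (\<psi> x)" for x
    define f2 where "f2 x = complex_of_real (\<phi> a x)" for x
    define g2 where "g2 x = complex_of_real (indicator Y x)" for x
    have c_of: "(\<lambda>x. complex_of_real (f x)) \<in> borel_measurable M" if "f \<in> borel_measurable M" for f
      by (rule measurable_compose[OF that borel_measurable_of_real])
    have fg: "f1 \<in> borel_measurable M" "g1 \<in> borel_measurable M" "f2 \<in> borel_measurable M" "g2 \<in> borel_measurable M"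
      unfolding f1_def g1_def f2_def g2_def using Sm Y \<psi>m \<phi>m by (intro c_of; simp)+
    have bd: "norm (f1 x) \<le> 1" "norm (g1 x) \<le> 1" "norm (f2 x) \<le> 1" "norm (g2 x) \<le> 1" for x
      using \<psi>0 \<psi>1 \<phi>0 \<phi>1 by (auto simp: f1_def g1_def f2_def g2_def indicator_def)
    have L: "(LINT x|M. f1 ((T ^^ k) x) * g1 x) = complex_of_real (LINT y:Y|M. \<phi> (a + k) y)" for k
    proof -
      have "(LINT x|M. f1 ((T ^^ k) x) * g1 x) = (LINT x|M. complex_of_real (indicator (S (a + k)) x *\<^sub>R \<psi> x))"
        by (rule Bochner_Integration.integral_cong) (auto simp: f1_def g1_def S_add indicator_def)
      also have "\<dots> = complex_of_real (LINT x:S (a + k)|M. \<psi> x)"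
        by (simp only: integral_complex_of_real set_lebesgue_integral_def)
      also have "\<dots> = complex_of_real (LINT y:Y|M. \<phi> (a + k) y)"
        by (simp only: \<psi>[OF Sm, symmetric] \<phi>[OF Y])
      finally show ?thesis .
    qed
    have R: "(LINT y|M. f2 ((T ^^ k) y) * g2 y) = complex_of_real (LINT y:Y|M. \<phi> a ((T ^^ k) y))" for k
    proof -
      have "(LINT y|M. f2 ((T ^^ k) y) * g2 y) = (LINT y|M. complex_of_real (indicator Y y *\<^sub>R \<phi> a ((T ^^ k) y)))"
        by (rule Bochner_Integration.integral_cong) (auto simp: f2_def g2_def indicator_def)
      then show ?thesis by (simp only: integral_complex_of_real set_lebesgue_integral_def)
    qed
    have "(\<lambda>i. LINT x|M. f1 ((T ^^ (m * r i)) x) * g1 x)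
        \<longlonglongrightarrow> (\<Sum>e\<le>B. p e *\<^sub>R (LINT x|M. f1 ((T ^^ e) x) * g1 x))"
      by (rule drift_law_weak_limit[OF drift1, where C = 1]) (use fg bd in simp_all)
    then have lim1: "(\<lambda>i. complex_of_real (LINT y:Y|M. \<phi> (a + m * r i) y))
        \<longlonglongrightarrow> (\<Sum>e\<le>B. p e *\<^sub>R complex_of_real (LINT y:Y|M. \<phi> (a + e) y))"
      by (simp only: L)
    have "(\<lambda>i. LINT x|M. f2 ((T ^^ (n * r i)) x) * g2 x)
        \<longlonglongrightarrow> (\<Sum>e\<le>B. p' e *\<^sub>R (LINT x|M. f2 ((T ^^ e) x) * g2 x))"
      by (rule drift_law_weak_limit[OF drift2, where C = 1]) (use fg bd in simp_all)
    then have lim2: "(\<lambda>i. complex_of_real (LINT y:Y|M. \<phi> a ((T ^^ (n * r i)) y)))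
        \<longlonglongrightarrow> (\<Sum>e\<le>B. p' e *\<^sub>R complex_of_real (LINT y:Y|M. \<phi> a ((T ^^ e) y)))"
      by (simp only: R)
    have same: "(LINT y:Y|M. \<phi> (a + m * r i) y) = (LINT y:Y|M. \<phi> a ((T ^^ (n * r i)) y))" for i
      unfolding set_lebesgue_integral_def
    proof (rule integral_cong_AE)
      show "AE y in M. indicator Y y *\<^sub>R \<phi> (a + m * r i) y = indicator Y y *\<^sub>R \<phi> a ((T ^^ (n * r i)) y)"
        using steps[of a "r i"] by eventually_elim simp
    qed (intro borel_measurable_scaleR borel_measurable_indicator Y \<phi>m \<phi>T)+
    have "(\<Sum>e\<le>B. p e *\<^sub>R complex_of_real (LINT y:Y|M. \<phi> (a + e) y))
        = (\<Sum>e\<le>B. p' e *\<^sub>R complex_of_real (LINT y:Y|M. \<phi> a ((T ^^ e) y)))"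
      using lim1 lim2 unfolding same by (rule LIMSEQ_unique)
    then have "complex_of_real (\<Sum>e\<le>B. p e * (LINT y:Y|M. \<phi> (a + e) y))
        = complex_of_real (\<Sum>e\<le>B. p' e * (LINT y:Y|M. \<phi> a ((T ^^ e) y)))"
      by (simp add: scaleR_conv_of_real)
    then have eq: "(\<Sum>e\<le>B. p e * (LINT y:Y|M. \<phi> (a + e) y)) = (\<Sum>e\<le>B. p' e * (LINT y:Y|M. \<phi> a ((T ^^ e) y)))"
      by (simp only: of_real_eq_iff)
    have sum_int: "(LINT y:Y|M. (\<Sum>e\<le>B. w e * F e y)) = (\<Sum>e\<le>B. w e * (LINT y:Y|M. F e y))"
      if "\<And>e. integrable M (F e)" for F :: "nat \<Rightarrow> real \<Rightarrow> real" and w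
    proof -
      have i: "integrable M (\<lambda>y. indicator Y y *\<^sub>R F e y)" for e
        using Y that by (intro integrable_mult_indicator)
      have "(LINT y:Y|M. (\<Sum>e\<le>B. w e * F e y)) = (LINT y|M. (\<Sum>e\<le>B. w e * (indicator Y y *\<^sub>R F e y)))"
        unfolding set_lebesgue_integral_def
        by (rule Bochner_Integration.integral_cong) (auto simp: sum_distrib_left mult_ac)
      also have "\<dots> = (\<Sum>e\<le>B. LINT y|M. w e * (indicator Y y *\<^sub>R F e y))"
        by (intro Bochner_Integration.integral_sum integrable_mult_right i)
      also have "\<dots> = (\<Sum>e\<le>B. w e * (LINT y:Y|M. F e y))"
        by (simp only: integral_mult_right_zero set_lebesgue_integral_def)
      finally show ?thesis .
    qed
    show "(LINT y:Y|M. (\<Sum>e\<le>B. p e * \<phi> (a + e) y)) = (LINT y:Y|M. (\<Sum>e\<le>B. p' e * \<phi> a ((T ^^ e) y)))"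
      using eq by (simp only: sum_int[of "\<lambda>e. \<phi> (a + e)", OF \<phi>i] sum_int[of "\<lambda>e y. \<phi> a ((T ^^ e) y)", OF \<phi>Ti])
  qed
  obtain D :: "complex poly" where D: "D \<noteq> 0"
    "\<forall>F :: nat \<Rightarrow> nat \<Rightarrow> complex.
      (\<forall>a b. F (a + m) b = F a (b + n)) \<longrightarrow>
      (\<forall>a b. (\<Sum>e\<le>B. of_real (p e) * F (a + e) b) = (\<Sum>e\<le>B. of_real (p' e) * F a (b + e))) \<longrightarrow>
      ev (F 0) D = 0"
    using elimination[OF m branch] by blast
  define c where "c = measure M A"
  define h where "h y = complex_of_real (\<phi> 0 y - c)" for y
  \<comment> \<open>Countably many null sets are discarded at once, because the polynomial is
    applied at a single point with all indices \<open>a\<close> and \<open>b\<close>.\<close>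
  have all: "AE y in M. \<forall>a b. \<phi> (a + m) ((T ^^ b) y) = \<phi> a ((T ^^ n) ((T ^^ b) y)) \<and>
      (\<Sum>e\<le>B. p e * \<phi> (a + e) ((T ^^ b) y)) = (\<Sum>e\<le>B. p' e * \<phi> a ((T ^^ e) ((T ^^ b) y)))"
    unfolding AE_all_countable AE_conj_iff
    using AE_T_pow[OF step] AE_T_pow[OF key] by blast
  have hD: "AE y in M. ev (\<lambda>b. h ((T ^^ b) y)) D = 0"
    using all
  proof eventually_elim
    case (elim y)
    \<comment> \<open>Subtracting \<open>c\<close> preserves the second relation because both laws
      have total mass 1.\<close>
    define F where "F a b = complex_of_real (\<phi> a ((T ^^ b) y) - c)" for a b
    have pow: "(T ^^ n) ((T ^^ b) y) = (T ^^ (b + n)) y" for b n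
      by (simp add: add.commute[of b n] funpow_add)
    have "ev (F 0) D = 0"
    proof (rule D(2)[rule_format])
      show "F (a + m) b = F a (b + n)" for a b
        using elim by (simp add: F_def pow)
      show "(\<Sum>e\<le>B. of_real (p e) * F (a + e) b) = (\<Sum>e\<le>B. of_real (p' e) * F a (b + e))" for a b
      proof -
        have "(\<Sum>e\<le>B. p e * (\<phi> (a + e) ((T ^^ b) y) - c)) = (\<Sum>e\<le>B. p e * \<phi> (a + e) ((T ^^ b) y)) - (\<Sum>e\<le>B. p e) * c"
          by (simp add: right_diff_distrib sum_subtractf sum_distrib_right)
        also have "\<dots> = (\<Sum>e\<le>B. p' e * \<phi> a ((T ^^ (b + e)) y)) - (\<Sum>e\<le>B. p' e) * c"
          using elim drift_law_sum_1[OF drift1] drift_law_sum_1[OF drift2] by (simp add: pow)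
        also have "\<dots> = (\<Sum>e\<le>B. p' e * (\<phi> a ((T ^^ (b + e)) y) - c))"
          by (simp add: right_diff_distrib sum_subtractf sum_distrib_right)
        finally have "complex_of_real (\<Sum>e\<le>B. p e * (\<phi> (a + e) ((T ^^ b) y) - c))
            = complex_of_real (\<Sum>e\<le>B. p' e * (\<phi> a ((T ^^ (b + e)) y) - c))" by (simp only:)
        then show ?thesis by (simp only: F_def of_real_sum of_real_mult)
      qed
    qed
    then show ?case by (simp add: F_def[abs_def] h_def)
  qed
  have hm: "h \<in> borel_measurable M"
    unfolding h_def
    by (intro measurable_compose[OF _ borel_measurable_of_real] borel_measurable_diff \<phi>m borel_measurable_const)
  have hb: "norm (h x) \<le> 1 + \<bar>c\<bar>" for x
    using \<phi>0[of 0 x] \<phi>1[of 0 x] unfolding h_def norm_of_real by linarith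
  have hmean: "(LINT y|M. h y) = 0"
  proof -
    have J: "J \<in> sets M" using sets.top[of M] by simp
    have M1: "measure M J = 1" using emeasure_M_J by (simp add: measure_def)
    have "(LINT y|M. \<phi> 0 y) = (LINT y:J|M. \<phi> 0 y)"
      unfolding set_lebesgue_integral_def by (rule Bochner_Integration.integral_cong) auto
    also have "\<dots> = measure \<nu> (A \<times> J)"
      using \<phi>[OF J, of 0] subJ[OF A] by (simp add: S_def Int_absorb2)
    also have "\<dots> = measure (distr \<nu> M fst) A"
    proof -
      have "fst -` A \<inter> space \<nu> = A \<times> J" using subJ[OF A] by (auto simp: sp)
      then show ?thesis using fstm A by (simp add: measure_distr)
    qed
    finally have "(LINT y|M. \<phi> 0 y) = c" by (simp add: f\<nu> c_def)
    moreover have "(LINT y|M. h y) = complex_of_real (LINT y|M. \<phi> 0 y - c)"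
      unfolding h_def by (rule integral_complex_of_real)
    moreover have "(LINT y|M. \<phi> 0 y - c) = (LINT y|M. \<phi> 0 y) - c"
      using \<phi>i[of 0] M1 by (simp add: M.emeasure_eq_measure)
    ultimately show ?thesis by simp
  qed
  have "AE y in M. h y = 0"
  proof (rule polynomial_annihilates)
    show "norm (h x) \<le> 1 + \<bar>c\<bar>" for x by (rule hb)
  qed (fact noeig hm hmean D(1) hD)+
  then have const: "AE y in M. \<phi> 0 y = c" by (simp add: h_def)
  have "measure \<nu> (A \<times> B') = (LINT y:B'|M. \<phi> 0 y)"
    using \<phi>[OF B', of 0] subJ[OF A] by (simp add: S_def Int_absorb2)
  also have "\<dots> = (LINT y|M. indicator B' y *\<^sub>R c)"
    unfolding set_lebesgue_integral_def
  proof (rule integral_cong_AE)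
    show "AE y in M. indicator B' y *\<^sub>R \<phi> 0 y = indicator B' y *\<^sub>R c"
      using const by eventually_elim simp
  qed (intro borel_measurable_scaleR borel_measurable_indicator borel_measurable_const B' \<phi>m)+
  also have "\<dots> = measure M B' * c"
    using B' subJ[OF B'] by (simp add: Int_absorb2 M.emeasure_eq_measure)
  finally show ?thesis by (simp add: c_def)
qed

end

section \<open>Drift at a separated scale\<close>

lemma (in induced_rotation) sets_vis_shift:
  "{x \<in> {0..<1}. P (vis r x) (vis r' (frac (x + c)))} \<in> sets circle"
proof -
  have "{x \<in> {0..<1}. P (vis r x) (vis r' (frac (x + c)))} = (\<Union>v. \<Union>w.
      {x \<in> {0..<1}. vis r x = v \<and> P v w} \<inter> {x \<in> {0..<1}. frac (x + c) \<in> {x \<in> {0..<1}. vis r' x = w}})"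
    by (auto simp: frac_lt_1)
  also have "\<dots> \<in> sets circle"
    by (intro sets.countable_UN image_subsetI sets.Int sets_vis[of "\<lambda>v. v = _ \<and> P _ _"]
        sets_frac_shift sets_vis)
  finally show ?thesis .
qed

text \<open>The end points 0 and \<open>z\<close> of \<open>J\<close>, pulled back by fewer than
  \<open>s\<close> steps, are the jumps of \<open>vis s\<close>. Copies of the same end point are
  more than \<open>2 |err k|\<close> apart by \<open>s_le\<close>; copies of different end points
  are at least \<open>|err k|\<close> apart by \<open>separated\<close>.\<close>

locale separated_scale = induced_rotation +
  fixes k s :: nat
  assumes k2: "2 \<le> k" and s0: "0 < s" and s_le: "s \<le> qn (k - 1)"
    and separated: "\<And>j (P :: int). j < s \<Longrightarrow> \<bar>err k\<bar> \<le> \<bar>j * \<alpha> - z - P\<bar>"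
      "\<And>j (P :: int). j < s \<Longrightarrow> \<bar>err k\<bar> \<le> \<bar>j * \<alpha> + z - P\<bar>"
begin

abbreviation "\<eta> \<equiv> err k"

lemma frac_qn_shift: "frac (x + real (qn k) * \<alpha>) = frac (x + \<eta>)"
proof -
  have "x + real (qn k) * \<alpha> = (x + \<eta>) + of_int (int (cf_num \<alpha> k))" by (simp add: cf_err_def)
  then show ?thesis by (simp only: frac_add_of_int_right)
qed

text \<open>Separation at \<open>j = 0\<close>. A shift by \<open>\<eta>\<close> therefore cannot
  jump over \<open>J\<close> or over its complement.\<close>

lemma eta_le: "\<bar>\<eta>\<bar> \<le> z" "\<bar>\<eta>\<bar> \<le> 1 - z" "\<bar>\<eta>\<bar> > 0"
  using separated(1)[of 0 0] separated(1)[of 0 "- 1"] s0 z01 err_nz[of k] by auto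

text \<open>Entering and leaving \<open>J\<close> under the shift by \<open>\<eta>\<close>; the
  first raises the visit count, the second lowers it.\<close>

definition up :: "real \<Rightarrow> bool" where "up y \<longleftrightarrow> z \<le> frac y \<and> frac (y + \<eta>) < z"
definition down :: "real \<Rightarrow> bool" where "down y \<longleftrightarrow> frac y < z \<and> z \<le> frac (y + \<eta>)"

lemma crossing:
  obtains (stay) "0 \<le> frac y + \<eta>" "frac y + \<eta> < 1" "frac (y + \<eta>) = frac y + \<eta>"
  | (over) "1 \<le> frac y + \<eta>" "frac (y + \<eta>) = frac y + \<eta> - 1" "0 < \<eta>"
  | (under) "frac y + \<eta> < 0" "frac (y + \<eta>) = frac y + \<eta> + 1" "\<eta> < 0"
proof -
  have e: "\<bar>\<eta>\<bar> < 1" using eta_le z01 by linarith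
  have f: "0 \<le> frac y" "frac y < 1" by (auto simp: frac_lt_1)
  have ff: "frac (y + \<eta>) = frac (frac y + \<eta>)" by (simp add: frac_frac_add)
  consider "0 \<le> frac y + \<eta>" "frac y + \<eta> < 1" | "1 \<le> frac y + \<eta>" | "frac y + \<eta> < 0" by linarith
  then show ?thesis
  proof cases
    case 1
    then have "frac (frac y + \<eta>) = frac y + \<eta>" by (simp only: frac_eq)
    then show ?thesis using ff 1 by (intro stay) (simp_all only:)
  next
    case 2
    then have "\<lfloor>frac y + \<eta>\<rfloor> = 1" using e f by (simp add: floor_eq_iff)
    then have "frac (frac y + \<eta>) = frac y + \<eta> - 1"
      by (simp only: frac_def[of "frac y + \<eta>"] of_int_1)
    moreover have "0 < \<eta>" using 2 f by linarith
    ultimately show ?thesis using ff 2 by (intro over) (simp_all only:)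
  next
    case 3
    then have "\<lfloor>frac y + \<eta>\<rfloor> = - 1"
      unfolding floor_eq_iff of_int_minus of_int_1 using e f by linarith
    then have "frac (frac y + \<eta>) = frac y + \<eta> + 1"
      by (simp only: frac_def[of "frac y + \<eta>"] of_int_minus of_int_1 minus_minus diff_minus_eq_add)
    moreover have "\<eta> < 0" using 3 f by linarith
    ultimately show ?thesis using ff 3 by (intro under) (simp_all only:)
  qed
qed

text \<open>The witness locates the end point 0 or \<open>z\<close> of \<open>J\<close> lying between \<open>y\<close> and \<open>y + \<eta>\<close>; which of the two
  it is depends on the sign of \<open>\<eta>\<close>.\<close>

lemma up_point: "up y \<Longrightarrow> \<exists>P::int. if 0 < \<eta> then y < P \<and> P \<le> y + \<eta> else y + \<eta> < P + z \<and> P + z \<le> y"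
proof -
  assume up: "up y"
  then have u: "z \<le> frac y" "frac (y + \<eta>) < z" by (auto simp: up_def)
  have y: "y = \<lfloor>y\<rfloor> + frac y" by (simp add: frac_def)
  have f: "frac y < 1" by (rule frac_lt_1)
  show ?thesis
  proof (cases y rule: crossing)
    case stay
    then have "\<not> 0 < \<eta>" using u by linarith
    moreover have "y + \<eta> < \<lfloor>y\<rfloor> + z" "\<lfloor>y\<rfloor> + z \<le> y" using stay u y by linarith+
    ultimately show ?thesis by auto
  next
    case over
    then have "y < of_int (\<lfloor>y\<rfloor> + 1)" "of_int (\<lfloor>y\<rfloor> + 1) \<le> y + \<eta>" using y f by linarith+
    then show ?thesis using over by (intro exI[of _ "\<lfloor>y\<rfloor> + 1"]) simp
  next
    case under
    then have False using u eta_le by linarith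
    then show ?thesis ..
  qed
qed

lemma down_point: "down y \<Longrightarrow> \<exists>P::int. if 0 < \<eta> then y < P + z \<and> P + z \<le> y + \<eta> else y + \<eta> < P \<and> P \<le> y"
proof -
  assume down: "down y"
  then have u: "frac y < z" "z \<le> frac (y + \<eta>)" by (auto simp: down_def)
  have y: "y = \<lfloor>y\<rfloor> + frac y" by (simp add: frac_def)
  have f: "0 \<le> frac y" by simp
  show ?thesis
  proof (cases y rule: crossing)
    case stay
    then have "0 < \<eta>" using u by linarith
    moreover have "y < \<lfloor>y\<rfloor> + z" "\<lfloor>y\<rfloor> + z \<le> y + \<eta>" using stay u y by linarith+
    ultimately show ?thesis by auto
  next
    case over
    then have False using u eta_le by linarith
    then show ?thesis ..
  next
    case under
    then have "y + \<eta> < \<lfloor>y\<rfloor>" "\<lfloor>y\<rfloor> \<le> y" using y f by linarith+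
    then show ?thesis using under by auto
  qed
qed

text \<open>By the recurrence, \<open>|err (k - 2)|\<close> is at least
  \<open>|err (k - 1)| + |err k|\<close>, and errors decrease strictly. Best approximation makes
  \<open>|err (k - 2)|\<close> a lower bound for the spacing of orbits of length at most
  \<open>q_{k-1}\<close>.\<close>

lemma two_err_less: "2 * \<bar>\<eta>\<bar> < \<bar>err (k - 2)\<bar>"
proof -
  obtain j where j: "k = Suc (Suc j)" using k2 by (metis add_2_eq_Suc le_Suc_ex)
  have "1 * \<bar>err (Suc j)\<bar> \<le> pq (Suc (Suc j)) * \<bar>err (Suc j)\<bar>"
    using pq_ge_1[of "Suc j"] by (intro mult_right_mono) auto
  then show ?thesis using abs_err_rec[of j] abs_err_less[of "Suc j"] j by simp
qed

lemma orbit_separated: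
  fixes P :: int
  assumes "i < s" "j < s" "i \<noteq> j"
  shows "2 * \<bar>\<eta>\<bar> < \<bar>real i * \<alpha> - real j * \<alpha> - P\<bar>"
proof -
  have *: "2 * \<bar>\<eta>\<bar> < \<bar>real i * \<alpha> - real j * \<alpha> - P\<bar>" if "i < s" "j < i" for i j and P :: int
  proof -
    have "k - 1 = Suc (k - 2)" using k2 by simp
    then have "\<bar>err (k - 2)\<bar> \<le> \<bar>real (i - j) * \<alpha> - P\<bar>"
      using that s_le by (intro best_approximation) auto
    then show ?thesis using two_err_less that by (simp add: of_nat_diff algebra_simps)
  qed
  show ?thesis
  proof (cases "j < i")
    case True
    then show ?thesis using * assms by simp
  next
    case False
    then have "2 * \<bar>\<eta>\<bar> < \<bar>real j * \<alpha> - real i * \<alpha> - of_int (- P)\<bar>"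
      using False assms by (intro *) auto
    then show ?thesis unfolding of_int_minus by linarith
  qed
qed

lemma separated_both:
  fixes P :: int
  assumes "i < s" "j < s"
  shows "\<bar>\<eta>\<bar> \<le> \<bar>real i * \<alpha> - real j * \<alpha> - z - P\<bar>"
proof (cases "j \<le> i")
  case True
  then show ?thesis using separated(1)[of "i - j" P] assms by (simp add: of_nat_diff algebra_simps)
next
  case False
  have "\<bar>\<eta>\<bar> \<le> \<bar>real (j - i) * \<alpha> + z - of_int (- P)\<bar>" using assms by (intro separated(2)) simp
  also have "real (j - i) * \<alpha> = real j * \<alpha> - real i * \<alpha>" using False by (simp add: of_nat_diff algebra_simps)
  finally show ?thesis by simp
qed

text \<open>Both crossings pass copies of the same end point, so \<open>i \<alpha>\<close> and
  \<open>j \<alpha>\<close> would be within \<open>|\<eta>|\<close> of each other modulo 1.\<close>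

lemma up_unique: "i < s \<Longrightarrow> j < s \<Longrightarrow> up (x + real i * \<alpha>) \<Longrightarrow> up (x + real j * \<alpha>) \<Longrightarrow> i = j"
proof (rule ccontr)
  assume ij: "i < s" "j < s" "i \<noteq> j" and u: "up (x + real i * \<alpha>)" "up (x + real j * \<alpha>)"
  obtain P Q :: int where
    "if 0 < \<eta> then x + real i * \<alpha> < P \<and> P \<le> x + real i * \<alpha> + \<eta>
      else x + real i * \<alpha> + \<eta> < P + z \<and> P + z \<le> x + real i * \<alpha>"
    "if 0 < \<eta> then x + real j * \<alpha> < Q \<and> Q \<le> x + real j * \<alpha> + \<eta>
      else x + real j * \<alpha> + \<eta> < Q + z \<and> Q + z \<le> x + real j * \<alpha>"
    using up_point[OF u(1)] up_point[OF u(2)] by blast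
  then have "\<bar>real i * \<alpha> - real j * \<alpha> - of_int (P - Q)\<bar> \<le> \<bar>\<eta>\<bar>"
    by (auto split: if_splits)
  then show False using orbit_separated[OF ij, of "P - Q"] by linarith
qed

lemma down_unique: "i < s \<Longrightarrow> j < s \<Longrightarrow> down (x + real i * \<alpha>) \<Longrightarrow> down (x + real j * \<alpha>) \<Longrightarrow> i = j"
proof (rule ccontr)
  assume ij: "i < s" "j < s" "i \<noteq> j" and u: "down (x + real i * \<alpha>)" "down (x + real j * \<alpha>)"
  obtain P Q :: int where
    "if 0 < \<eta> then x + real i * \<alpha> < P + z \<and> P + z \<le> x + real i * \<alpha> + \<eta>
      else x + real i * \<alpha> + \<eta> < P \<and> P \<le> x + real i * \<alpha>"
    "if 0 < \<eta> then x + real j * \<alpha> < Q + z \<and> Q + z \<le> x + real j * \<alpha> + \<eta>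
      else x + real j * \<alpha> + \<eta> < Q \<and> Q \<le> x + real j * \<alpha>"
    using down_point[OF u(1)] down_point[OF u(2)] by blast
  then have "\<bar>real i * \<alpha> - real j * \<alpha> - of_int (P - Q)\<bar> \<le> \<bar>\<eta>\<bar>"
    by (auto split: if_splits)
  then show False using orbit_separated[OF ij, of "P - Q"] by linarith
qed

text \<open>The crossings pass different end points, so the difference of the orbit points is within
  \<open>|\<eta>|\<close> of +-z modulo 1. The half-open windows make this strict, contradicting the
  weak inequality in \<open>separated\<close>.\<close>

lemma not_up_down: "i < s \<Longrightarrow> j < s \<Longrightarrow> up (x + real i * \<alpha>) \<Longrightarrow> down (x + real j * \<alpha>) \<Longrightarrow> False"
proof -
  assume ij: "i < s" "j < s" and u: "up (x + real i * \<alpha>)" "down (x + real j * \<alpha>)"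
  obtain P Q :: int where PQ:
    "if 0 < \<eta> then x + real i * \<alpha> < P \<and> P \<le> x + real i * \<alpha> + \<eta>
      else x + real i * \<alpha> + \<eta> < P + z \<and> P + z \<le> x + real i * \<alpha>"
    "if 0 < \<eta> then x + real j * \<alpha> < Q + z \<and> Q + z \<le> x + real j * \<alpha> + \<eta>
      else x + real j * \<alpha> + \<eta> < Q \<and> Q \<le> x + real j * \<alpha>"
    using up_point[OF u(1)] down_point[OF u(2)] by blast
  show False
  proof (cases "0 < \<eta>")
    case True
    then have "\<bar>real j * \<alpha> - real i * \<alpha> - z - of_int (Q - P)\<bar> < \<bar>\<eta>\<bar>" using PQ by (simp, linarith)
    then show False using separated_both[OF ij(2) ij(1), of "Q - P"] by linarith
  next
    case False
    then have "\<bar>real i * \<alpha> - real j * \<alpha> - z - of_int (P - Q)\<bar> < \<bar>\<eta>\<bar>" using PQ by (simp, linarith)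
    then show False using separated_both[OF ij, of "P - Q"] by linarith
  qed
qed

text \<open>\<open>|\<eta>|\<close> is at most both \<open>z\<close> and \<open>1 - z\<close>, hence
  at most 1/2.\<close>

lemma small_int: "\<bar>real_of_int P\<bar> < 2 * \<bar>\<eta>\<bar> \<Longrightarrow> P = 0"
  using eta_le z01 by (smt (verit) of_int_1 of_int_less_iff of_int_minus)

text \<open>Two shifts move a point by \<open>2 |\<eta>|\<close>, which is why
  \<open>orbit_separated\<close> carries the factor 2: it forces \<open>i = j\<close>, and then the
  same end point would be passed twice.\<close>

lemma not_up_twice: "i < s \<Longrightarrow> j < s \<Longrightarrow> up (x + real i * \<alpha>) \<Longrightarrow> up (x + \<eta> + real j * \<alpha>) \<Longrightarrow> False"
proof -
  assume ij: "i < s" "j < s" and u: "up (x + real i * \<alpha>)" "up (x + \<eta> + real j * \<alpha>)"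
  obtain P Q :: int where PQ:
    "if 0 < \<eta> then x + real i * \<alpha> < P \<and> P \<le> x + real i * \<alpha> + \<eta>
      else x + real i * \<alpha> + \<eta> < P + z \<and> P + z \<le> x + real i * \<alpha>"
    "if 0 < \<eta> then x + \<eta> + real j * \<alpha> < Q \<and> Q \<le> x + \<eta> + real j * \<alpha> + \<eta>
      else x + \<eta> + real j * \<alpha> + \<eta> < Q + z \<and> Q + z \<le> x + \<eta> + real j * \<alpha>"
    using up_point[OF u(1)] up_point[OF u(2)] by blast
  have near: "\<bar>real i * \<alpha> - real j * \<alpha> - of_int (P - Q)\<bar> < 2 * \<bar>\<eta>\<bar>"
    using PQ eta_le(3) by (auto split: if_splits)
  have "i = j"
    using orbit_separated[OF ij, of "P - Q"] near by linarith
  moreover from this near have "P - Q = 0" by (intro small_int) simp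
  ultimately show False using PQ by (auto split: if_splits)
qed

lemma not_down_twice: "i < s \<Longrightarrow> j < s \<Longrightarrow> down (x + real i * \<alpha>) \<Longrightarrow> down (x + \<eta> + real j * \<alpha>) \<Longrightarrow> False"
proof -
  assume ij: "i < s" "j < s" and u: "down (x + real i * \<alpha>)" "down (x + \<eta> + real j * \<alpha>)"
  obtain P Q :: int where PQ:
    "if 0 < \<eta> then x + real i * \<alpha> < P + z \<and> P + z \<le> x + real i * \<alpha> + \<eta>
      else x + real i * \<alpha> + \<eta> < P \<and> P \<le> x + real i * \<alpha>"
    "if 0 < \<eta> then x + \<eta> + real j * \<alpha> < Q + z \<and> Q + z \<le> x + \<eta> + real j * \<alpha> + \<eta>
      else x + \<eta> + real j * \<alpha> + \<eta> < Q \<and> Q \<le> x + \<eta> + real j * \<alpha>"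
    using down_point[OF u(1)] down_point[OF u(2)] by blast
  have near: "\<bar>real i * \<alpha> - real j * \<alpha> - of_int (P - Q)\<bar> < 2 * \<bar>\<eta>\<bar>"
    using PQ eta_le(3) by (auto split: if_splits)
  have "i = j"
    using orbit_separated[OF ij, of "P - Q"] near by linarith
  moreover from this near have "P - Q = 0" by (intro small_int) simp
  ultimately show False using PQ by (auto split: if_splits)
qed

text \<open>By \<open>drift_commute\<close> this is also the change of \<open>vis (qn k)\<close>
  along \<open>s\<close> rotation steps. The drift in the sense of \<open>drift_law\<close> at time
  \<open>qn k\<close> thus changes by \<open>- drift x\<close> along these steps.\<close>

definition drift :: "real \<Rightarrow> int" where
  "drift x = int (vis s (frac (x + \<eta>))) - int (vis s x)"

lemma drift_sum: "drift x = (\<Sum>j<s. of_bool (up (x + real j * \<alpha>))) - (\<Sum>j<s. of_bool (down (x + real j * \<alpha>)))"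
proof -
  have "drift x = (\<Sum>j<s. of_bool (frac (x + real j * \<alpha> + \<eta>) < z) - of_bool (frac (x + real j * \<alpha>) < z))"
    by (simp add: drift_def vis_def frac_frac_add sum_subtractf algebra_simps)
  also have "\<dots> = (\<Sum>j<s. of_bool (up (x + real j * \<alpha>)) - of_bool (down (x + real j * \<alpha>)))"
    by (rule sum.cong) (auto simp: up_def down_def)
  finally show ?thesis by (simp add: sum_subtractf)
qed

lemma drift_up:
  assumes "i < s" "up (x + real i * \<alpha>)"
  shows "drift x = 1"
proof -
  have "(\<Sum>j<s. of_bool (up (x + real j * \<alpha>))) = (\<Sum>j<s. if j = i then 1 else 0 :: int)"
    using up_unique[OF _ assms(1)] assms by (intro sum.cong) auto
  moreover have "(\<Sum>j<s. of_bool (down (x + real j * \<alpha>))) = (0 :: int)"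
    using not_up_down[OF assms(1)] assms(2) by (intro sum.neutral) auto
  ultimately show ?thesis using assms(1) by (simp add: drift_sum)
qed

lemma drift_down:
  assumes "i < s" "down (x + real i * \<alpha>)"
  shows "drift x = - 1"
proof -
  have "(\<Sum>j<s. of_bool (down (x + real j * \<alpha>))) = (\<Sum>j<s. if j = i then 1 else 0 :: int)"
    using down_unique[OF _ assms(1)] assms by (intro sum.cong) auto
  moreover have "(\<Sum>j<s. of_bool (up (x + real j * \<alpha>))) = (0 :: int)"
    using not_up_down[OF _ assms(1)] assms(2) by (intro sum.neutral) auto
  ultimately show ?thesis using assms(1) by (simp add: drift_sum)
qed

lemma drift_cases:
  obtains (up) i where "i < s" "up (x + real i * \<alpha>)" "drift x = 1"
  | (down) i where "i < s" "down (x + real i * \<alpha>)" "drift x = - 1"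
  | (zero) "drift x = 0"
proof (cases "\<exists>i<s. up (x + real i * \<alpha>) \<or> down (x + real i * \<alpha>)")
  case True
  then show ?thesis using drift_up drift_down up down by blast
next
  case False
  then have "drift x = 0" by (simp add: drift_sum)
  then show ?thesis by (rule zero)
qed

lemma abs_drift_le: "\<bar>drift x\<bar> \<le> 1"
  by (cases x rule: drift_cases) auto

lemma up_frac: "up (frac x + y) = up (x + y)" "down (frac x + y) = down (x + y)"
proof -
  have "frac (frac x + y + \<eta>) = frac (x + y + \<eta>)" by (simp only: add.assoc frac_frac_add)
  then show "up (frac x + y) = up (x + y)" "down (frac x + y) = down (x + y)"
    by (simp_all add: up_def down_def frac_frac_add)
qed

text \<open>By \<open>not_up_twice\<close> and \<open>not_down_twice\<close> consecutive drifts
  cannot be equal and nonzero. The strict inequality in \<open>abs_sum_drift_less\<close> rests on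
  this.\<close>

lemma drift_twice: "\<bar>drift x + drift (frac (x + \<eta>))\<bar> \<le> 1"
proof (cases x rule: drift_cases)
  case (up i)
  show ?thesis
    by (cases "frac (x + \<eta>)" rule: drift_cases)
      (use not_up_twice[OF up(1) _ up(2)] up(3) in \<open>auto simp: up_frac\<close>)
next
  case (down i)
  show ?thesis
    by (cases "frac (x + \<eta>)" rule: drift_cases)
      (use not_down_twice[OF down(1) _ down(2)] down(3) in \<open>auto simp: up_frac\<close>)
next
  case zero
  then show ?thesis using abs_drift_le by simp
qed

lemma drift_commute: "drift x = int (vis (qn k) (frac (x + real s * \<alpha>))) - int (vis (qn k) x)"
  using vis_cocycle[of s x "qn k"] by (simp add: drift_def frac_qn_shift)

text \<open>\<open>W\<close> consists of points carried into \<open>J\<close> by the shift, just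
  below 1 or just above \<open>z\<close> according to the sign of \<open>\<eta>\<close>. Its
  pullbacks under fewer than \<open>s\<close> steps are disjoint by
  \<open>up_unique\<close>.\<close>

lemma measure_drift: "s * \<bar>\<eta>\<bar> \<le> measure circle {x \<in> {0..<1}. drift x \<noteq> 0}"
proof -
  define W where "W = (if 0 < \<eta> then {1 - \<bar>\<eta>\<bar>..<1} else {z..<z + \<bar>\<eta>\<bar>})"
  have W: "W \<in> sets circle" "measure circle W = \<bar>\<eta>\<bar>"
  proof -
    show Ws: "W \<in> sets circle" using eta_le z01 by (auto simp: W_def sets_circle)
    have "emeasure circle W = ennreal \<bar>\<eta>\<bar>"
      unfolding emeasure_circle[OF Ws] by (auto simp: W_def)
    then show "measure circle W = \<bar>\<eta>\<bar>" by (simp add: measure_def)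
  qed
  have Wup: "up y" if "frac y \<in> W" for y
  proof (cases y rule: crossing)
    case stay
    then show ?thesis using that eta_le by (auto simp: W_def up_def split: if_splits)
  next
    case over
    then show ?thesis using that eta_le frac_lt_1[of y] by (auto simp: W_def up_def split: if_splits)
  next
    case under
    then show ?thesis using that eta_le by (auto simp: W_def up_def split: if_splits)
  qed
  define U where "U j = {x \<in> {0..<1}. frac (x + real j * \<alpha>) \<in> W}" for j
  have U: "U j \<in> sets circle" "measure circle (U j) = \<bar>\<eta>\<bar>" for j
    unfolding U_def using sets_frac_shift[OF W(1)] measure_frac_shift[OF W(1)] W(2) by auto
  have "s * \<bar>\<eta>\<bar> = (\<Sum>j<s. measure circle (U j))" by (simp add: U)
  also have "\<dots> = measure circle (\<Union>j\<in>{..<s}. U j)"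
  proof (rule circle.finite_measure_finite_Union[symmetric])
    show "disjoint_family_on U {..<s}"
      unfolding disjoint_family_on_def
    proof (intro ballI impI)
      fix i j assume "i \<in> {..<s}" "j \<in> {..<s}" "i \<noteq> j"
      then show "U i \<inter> U j = {}" using up_unique[of i j] Wup by (auto simp: U_def)
    qed
  qed (use U in auto)
  also have "\<dots> \<le> measure circle {x \<in> {0..<1}. drift x \<noteq> 0}"
  proof (rule circle.finite_measure_mono)
    show "(\<Union>j\<in>{..<s}. U j) \<subseteq> {x \<in> {0..<1}. drift x \<noteq> 0}"
      using drift_up Wup by (auto simp: U_def)
    show "{x \<in> {0..<1}. drift x \<noteq> 0} \<in> sets circle"
      using sets_vis_shift[of "\<lambda>v w. int w - int v \<noteq> 0" s s \<eta>] by (simp add: drift_def)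
  qed
  finally show ?thesis .
qed

end

text \<open>Lagrange's identity: the right-hand side is half the sum of all
  \<open>(y j - y l)^2\<close>; only the pairs (0,1) and (1,0) are kept.\<close>

lemma sum_square_diff_le:
  fixes y :: "nat \<Rightarrow> real"
  assumes "2 \<le> N"
  shows "(y 1 - y 0)\<^sup>2 \<le> N * (\<Sum>l<N. (y l)\<^sup>2) - (\<Sum>l<N. y l)\<^sup>2"
proof -
  have inner: "(\<Sum>l<N. (y j - y l)\<^sup>2) = N * (y j)\<^sup>2 - 2 * y j * (\<Sum>l<N. y l) + (\<Sum>l<N. (y l)\<^sup>2)" for j
    by (simp add: power2_diff sum.distrib sum_subtractf sum_distrib_left mult.assoc)
  define Y Q where "Y = (\<Sum>l<N. y l)" and "Q = (\<Sum>l<N. (y l)\<^sup>2)"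
  have "(\<Sum>j<N. \<Sum>l<N. (y j - y l)\<^sup>2) = (\<Sum>j<N. N * (y j)\<^sup>2 - 2 * Y * y j + Q)"
    unfolding inner by (simp add: Y_def Q_def mult_ac)
  also have "\<dots> = N * Q - 2 * Y * Y + N * Q"
    by (simp add: sum.distrib sum_subtractf flip: sum_distrib_left) (simp add: Y_def Q_def)
  finally have total: "(\<Sum>j<N. \<Sum>l<N. (y j - y l)\<^sup>2) = 2 * (N * (\<Sum>l<N. (y l)\<^sup>2) - (\<Sum>l<N. y l)\<^sup>2)"
    by (simp add: Y_def Q_def power2_eq_square)
  have one: "(y j - y i)\<^sup>2 \<le> (\<Sum>l<N. (y j - y l)\<^sup>2)" if "i < N" for i j
    using that by (intro member_le_sum[of i "{..<N}" "\<lambda>l. (y j - y l)\<^sup>2"]) auto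
  have "(\<Sum>j\<in>{0, 1}. \<Sum>l<N. (y j - y l)\<^sup>2) \<le> (\<Sum>j<N. \<Sum>l<N. (y j - y l)\<^sup>2)"
    using assms by (intro sum_mono2) (auto intro: sum_nonneg)
  then have "(y 0 - y 1)\<^sup>2 + (y 1 - y 0)\<^sup>2 \<le> (\<Sum>j<N. \<Sum>l<N. (y j - y l)\<^sup>2)"
    using one[of 1 0] one[of 0 1] assms by simp
  then show ?thesis unfolding total by (simp add: power2_commute)
qed

lemma common_convergent_subsequence:
  fixes f :: "'a \<Rightarrow> nat \<Rightarrow> real"
  assumes "finite A" "\<And>a i. a \<in> A \<Longrightarrow> f a i \<in> {0..1}"
  obtains \<sigma> :: "nat \<Rightarrow> nat" where "strict_mono \<sigma>" "\<And>a. a \<in> A \<Longrightarrow> convergent (\<lambda>i. f a (\<sigma> i))"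
proof -
  have "\<exists>\<sigma> :: nat \<Rightarrow> nat. strict_mono \<sigma> \<and> (\<forall>a\<in>A. convergent (\<lambda>i. f a (\<sigma> i)))"
    using assms
  proof (induction A rule: finite_induct)
    case empty
    show ?case by (intro exI[of _ id]) (auto simp: strict_mono_def)
  next
    case (insert b A)
    then obtain \<sigma> :: "nat \<Rightarrow> nat" where s: "strict_mono \<sigma>" "\<And>a. a \<in> A \<Longrightarrow> convergent (\<lambda>i. f a (\<sigma> i))"
      by blast
    have "seq_compact {0..1 :: real}" by (simp add: compact_imp_seq_compact)
    then obtain l \<tau> where t: "strict_mono (\<tau> :: nat \<Rightarrow> nat)" "((\<lambda>i. f b (\<sigma> i)) \<circ> \<tau>) \<longlonglongrightarrow> l"
      using insert.prems[of b] by (metis (no_types, lifting) insertI1 seq_compactE)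
    show ?case
    proof (intro exI[of _ "\<sigma> \<circ> \<tau>"] conjI ballI)
      show "strict_mono (\<sigma> \<circ> \<tau>)" using s(1) t(1) by (rule strict_mono_o)
      fix a assume "a \<in> insert b A"
      then show "convergent (\<lambda>i. f a ((\<sigma> \<circ> \<tau>) i))"
      proof
        assume "a = b"
        then show ?thesis using t(2) by (auto simp: convergent_def comp_def)
      next
        assume "a \<in> A"
        then obtain L where "(\<lambda>i. f a (\<sigma> i)) \<longlonglongrightarrow> L" using s(2) by (auto simp: convergent_def)
        then have "((\<lambda>i. f a (\<sigma> i)) \<circ> \<tau>) \<longlonglongrightarrow> L" using t(1) by (rule LIMSEQ_subseq_LIMSEQ)
        then show ?thesis by (auto simp: convergent_def comp_def)
      qed
    qed
  qed
  then show ?thesis using that by blast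
qed

section \<open>Visit counts over multiples of q_k\<close>

context induced_rotation
begin

lemma vis_qn_bounds: "\<bar>real (vis (qn k) x) - qn k * z\<bar> \<le> 3"
  using denjoy_koksma[of z k x] z01 by (simp add: vis_card)

lemma frac_mult_qn_shift: "frac (x + real (N * qn k) * \<alpha>) = frac (x + real N * err k)"
proof -
  have "x + real (N * qn k) * \<alpha> = (x + real N * err k) + of_int (int (N * cf_num \<alpha> k))"
    by (simp add: cf_err_def algebra_simps)
  then show ?thesis by (simp only: frac_add_of_int_right)
qed

lemma vis_mult_qn: "vis (N * qn k) x = (\<Sum>l<N. vis (qn k) (frac (x + real l * err k)))"
proof (induction N)
  case (Suc N)
  have "vis (Suc N * qn k) x = vis (N * qn k + qn k) x" by (simp add: add.commute)
  also have "\<dots> = vis (N * qn k) x + vis (qn k) (frac (x + real N * err k))"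
    unfolding vis_add frac_mult_qn_shift ..
  finally show ?case using Suc by simp
qed (simp add: vis_def)

lemma vis_mult_qn_bounds: "\<bar>real (vis (N * qn k) x) - N * (qn k * z)\<bar> \<le> 3 * N"
proof -
  have "real (vis (N * qn k) x) - N * (qn k * z) = (\<Sum>l<N. real (vis (qn k) (frac (x + real l * err k))) - qn k * z)"
    by (simp add: vis_mult_qn sum_subtractf)
  also have "\<bar>\<dots>\<bar> \<le> (\<Sum>l<N. \<bar>real (vis (qn k) (frac (x + real l * err k))) - qn k * z\<bar>)" by (rule sum_abs)
  also have "\<dots> \<le> (\<Sum>l<N. 3)" by (intro sum_mono vis_qn_bounds)
  finally show ?thesis by simp
qed

text \<open>Adding the Denjoy--Koksma constant 3 before rounding up makes
  \<open>g * return_time g k\<close> at least every \<open>vis (qn k) x\<close>, so that drifts are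
  nonnegative.\<close>

definition return_time :: "nat \<Rightarrow> nat \<Rightarrow> nat" where
  "return_time g k = nat \<lceil>(qn k * z + 3) / g\<rceil>"

text \<open>The 7 collects 3 from the definition, 3 from Denjoy--Koksma and 1 from rounding; the
  first two come with a factor \<open>N\<close>, at most \<open>N * g\<close>.\<close>

lemma return_time_bounds:
  assumes "0 < g"
  shows "vis (N * qn k) x \<le> N * g * return_time g k"
    and "N * g * return_time g k \<le> vis (N * qn k) x + 7 * (N * g)"
proof -
  define A where "A = qn k * z + 3"
  have A0: "0 \<le> A" using z01 by (simp add: A_def)
  have r: "A / real g \<le> real (return_time g k)" "real (return_time g k) \<le> A / real g + 1"
    using A0 assms by (simp_all add: return_time_def A_def[symmetric])
  have g: "A \<le> real g * real (return_time g k)" "real g * real (return_time g k) \<le> A + real g"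
    using r assms by (simp_all add: field_simps)
  have "real N * A \<le> real N * (real g * real (return_time g k))"
    "real N * (real g * real (return_time g k)) \<le> real N * (A + real g)"
    using g by (intro mult_left_mono; simp)+
  moreover define a b c where "a = real N * (real g * real (return_time g k))"
    and "b = real N * (real (qn k) * z)" and "c = real N * real g"
  moreover have "real N * (A + real g) = b + 3 * real N + c" "real N * A = b + 3 * real N"
    by (simp_all add: A_def b_def c_def algebra_simps)
  moreover have "real N \<le> c" using assms mult_left_mono[of 1 "real g" "real N"] by (simp add: c_def)
  moreover have "\<bar>real (vis (N * qn k) x) - b\<bar> \<le> 3 * real N"
    using vis_mult_qn_bounds[of N k x] by (simp add: b_def)
  ultimately have "real (vis (N * qn k) x) \<le> a" "a \<le> real (vis (N * qn k) x) + 7 * c"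
    by linarith+
  then have "real (vis (N * qn k) x) \<le> real (N * g * return_time g k)"
      "real (N * g * return_time g k) \<le> real (vis (N * qn k) x + 7 * (N * g))"
    by (simp_all add: a_def c_def mult.assoc)
  then show "vis (N * qn k) x \<le> N * g * return_time g k"
    "N * g * return_time g k \<le> vis (N * qn k) x + 7 * (N * g)"
    by (simp_all only: of_nat_le_iff)
qed

end

section \<open>Divisible and stationary drifts\<close>

context separated_scale
begin

lemma sum_drift: "int (vis s (frac (x + real N * \<eta>))) - int (vis s (frac x)) = (\<Sum>l<N. drift (frac (x + real l * \<eta>)))"
proof (induction N)
  case (Suc N)
  have "drift (frac (x + real N * \<eta>)) = int (vis s (frac (x + real (Suc N) * \<eta>))) - int (vis s (frac (x + real N * \<eta>)))"
    by (simp add: drift_def frac_frac_add algebra_simps)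
  then show ?case using Suc by simp
qed simp

text \<open>The first two terms together contribute at most 1 in absolute value, each further term
  at most 1.\<close>

lemma abs_sum_drift_less:
  assumes "2 \<le> N"
  shows "\<bar>\<Sum>l<N. drift (frac (x + real l * \<eta>))\<bar> < N"
proof -
  obtain n where n: "N = Suc (Suc n)" using assms by (metis add_2_eq_Suc le_Suc_ex)
  have "(\<Sum>l<N. drift (frac (x + real l * \<eta>))) = drift (frac x) + drift (frac (frac x + \<eta>))
      + (\<Sum>l<n. drift (frac (x + real (Suc (Suc l)) * \<eta>)))"
    unfolding n by (simp only: sum.lessThan_Suc_shift) (simp add: frac_frac_add)
  moreover have "\<bar>\<Sum>l<n. drift (frac (x + real (Suc (Suc l)) * \<eta>))\<bar> \<le> (\<Sum>l<n. 1)"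
    by (intro order_trans[OF sum_abs] sum_mono abs_drift_le)
  ultimately show ?thesis using drift_twice[of "frac x"] n by simp
qed

text \<open>Subtracting the two multiples of \<open>N\<close> leaves, by the cocycle identity, a sum
  of \<open>N\<close> consecutive drifts, whose absolute value is below \<open>N\<close>.\<close>

lemma vis_shift_eq_of_congruent:
  assumes "2 \<le> N" "0 \<le> x" "x < 1"
    and "vis (N * qn k) x \<le> K" "vis (N * qn k) (frac (x + real s * \<alpha>)) \<le> K"
    and "N dvd K - vis (N * qn k) x" "N dvd K - vis (N * qn k) (frac (x + real s * \<alpha>))"
  shows "vis s (frac (x + real N * \<eta>)) = vis s x"
proof -
  have "int N dvd int (K - vis (N * qn k) x) - int (K - vis (N * qn k) (frac (x + real s * \<alpha>)))"
    using assms(6,7) by (intro dvd_diff) simp_all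
  then have "int N dvd int (vis (N * qn k) (frac (x + real s * \<alpha>))) - int (vis (N * qn k) x)"
    using assms(4,5) by (simp add: of_nat_diff)
  also have "\<dots> = int (vis s (frac (x + real N * \<eta>))) - int (vis s x)"
    using vis_cocycle[of s x "N * qn k"] unfolding frac_mult_qn_shift by linarith
  also have "\<dots> = (\<Sum>l<N. drift (frac (x + real l * \<eta>)))"
    using sum_drift[of x N] assms(2,3) by (simp add: frac_eq)
  finally have dvd: "int N dvd (\<Sum>l<N. drift (frac (x + real l * \<eta>)))" .
  have "(\<Sum>l<N. drift (frac (x + real l * \<eta>))) = 0"
  proof (rule ccontr)
    assume "(\<Sum>l<N. drift (frac (x + real l * \<eta>))) \<noteq> 0"
    from dvd_imp_le_int[OF this dvd] abs_sum_drift_less[OF assms(1), of x]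
    show False by linarith
  qed
  then show ?thesis
    using sum_drift[of x N] assms(2,3) by (simp add: frac_eq)
qed

text \<open>By \<open>drift_commute\<close> the hypotheses say that \<open>drift\<close> has the
  same value at \<open>x\<close> and after the shift by \<open>\<eta>\<close>;
  \<open>drift_twice\<close> leaves only 0.\<close>

lemma drift_zero_of_stationary:
  assumes "vis (qn k) (frac (x + \<eta>)) = vis (qn k) x"
    and "vis (qn k) (frac (frac (x + real s * \<alpha>) + \<eta>)) = vis (qn k) (frac (x + real s * \<alpha>))"
  shows "drift x = 0"
proof -
  have "frac (frac (x + \<eta>) + real s * \<alpha>) = frac (frac (x + real s * \<alpha>) + \<eta>)"
    by (simp add: frac_frac_add add_ac)
  then have "drift (frac (x + \<eta>)) = drift x"
    unfolding drift_commute using assms by simp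
  then show ?thesis using drift_twice[of x] by simp
qed

end

section \<open>Disjointness of powers\<close>

text \<open>Through \<open>measure_drift\<close>, \<open>\<kappa>\<close> is a lower bound, uniform
  in the scale, for the probability of a nonzero drift.\<close>

locale separated_scales = induced_rotation +
  fixes k s :: "nat \<Rightarrow> nat" and \<kappa> :: real
  assumes scale: "\<And>i. separated_scale \<alpha> z T (k i) (s i)"
    and k_lim: "filterlim k at_top sequentially"
    and kappa: "0 < \<kappa>" "\<And>i. \<kappa> \<le> real (s i) * \<bar>err (k i)\<bar>"
begin

lemma subsequence:
  assumes "strict_mono (\<sigma> :: nat \<Rightarrow> nat)"
  shows "separated_scales \<alpha> z T (k \<circ> \<sigma>) (s \<circ> \<sigma>) \<kappa>"
proof (intro separated_scales.intro separated_scales_axioms.intro)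
  show "induced_rotation \<alpha> z T" by (rule induced_rotation_axioms)
  show "separated_scale \<alpha> z T ((k \<circ> \<sigma>) i) ((s \<circ> \<sigma>) i)" for i using scale by simp
  show "filterlim (k \<circ> \<sigma>) at_top sequentially"
    unfolding comp_def by (rule filterlim_compose[OF k_lim filterlim_subseq[OF assms]])
  show "\<kappa> \<le> real ((s \<circ> \<sigma>) i) * \<bar>err ((k \<circ> \<sigma>) i)\<bar>" for i using kappa(2) by simp
qed (rule kappa(1))

lemma err_lim: "(\<lambda>i. err (k i)) \<longlonglongrightarrow> 0"
proof (rule Lim_null_comparison)
  have "filterlim (\<lambda>i. real (k i)) at_top sequentially"
    by (rule filterlim_compose[OF filterlim_real_sequentially k_lim])
  then show "(\<lambda>i. inverse (real (k i))) \<longlonglongrightarrow> 0"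
    by (rule filterlim_compose[OF tendsto_inverse_0_at_top[OF filterlim_ident]])
  have "eventually (\<lambda>i. 1 \<le> k i) sequentially" using k_lim by (simp add: filterlim_at_top)
  then show "eventually (\<lambda>i. norm (err (k i)) \<le> inverse (real (k i))) sequentially"
  proof eventually_elim
    case (elim i)
    have "real (k i) * \<bar>err (k i)\<bar> \<le> real (qn (Suc (k i))) * \<bar>err (k i)\<bar>"
      using qn_ge[of "Suc (k i)"] by (intro mult_right_mono) auto
    also have "\<dots> \<le> 1" using abs_err_upper[of "k i"] by simp
    finally show ?case using elim by (simp add: field_simps)
  qed
qed

lemma shift_lim:
  "\<exists>c. c \<longlonglongrightarrow> 0 \<and> (\<forall>i x. frac (x + real (N * qn (k i)) * \<alpha>) = frac (x + c i))"
proof (intro exI[of _ "\<lambda>i. real N * err (k i)"] conjI allI)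
  show "(\<lambda>i. real N * err (k i)) \<longlonglongrightarrow> 0" using tendsto_mult_right_zero[OF err_lim] .
qed (rule frac_mult_qn_shift)

lemma drift_lawI:
  assumes "0 < g" "7 * (N * g) \<le> B"
    and "\<And>e. e \<le> B \<Longrightarrow> (\<lambda>i. measure circle
      {x \<in> {0..<1}. N * g * return_time g (k i) = vis (N * qn (k i)) x + e}) \<longlonglongrightarrow> p e"
  shows "drift_law (\<lambda>i. N * qn (k i)) (\<lambda>i. N * g * return_time g (k i)) B p"
  unfolding drift_law_def
proof (intro conjI allI ballI impI)
  fix i x
  show "vis (N * qn (k i)) x \<le> N * g * return_time g (k i)" by (rule return_time_bounds(1)[OF assms(1)])
  show "N * g * return_time g (k i) \<le> vis (N * qn (k i)) x + B"
    using return_time_bounds(2)[OF assms(1), of N "k i" x] assms(2) by linarith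
qed (fact shift_lim assms(3))+

text \<open>Failure of invariance of \<open>vis (s i)\<close> under \<open>N q_k\<close> rotation
  steps. The \<open>N\<close> for which it tends to 0 are closed under sums and differences, and 1
  is not among them; this is how coprimality is exploited.\<close>

definition bad :: "nat \<Rightarrow> nat \<Rightarrow> real" where
  "bad N i = measure circle {x \<in> {0..<1}. vis (s i) (frac (x + real N * err (k i))) \<noteq> vis (s i) x}"

lemma sets_bad: "{x \<in> {0..<1}. vis r (frac (x + c)) \<noteq> vis r x} \<in> sets circle"
  using sets_vis_shift[of "\<lambda>v w. w \<noteq> v" r r c] .

lemma measure_shifted_bad:
  "measure circle {x \<in> {0..<1}. vis r (frac (x + (d + c))) \<noteq> vis r (frac (x + d))}
    = measure circle {x \<in> {0..<1}. vis r (frac (x + c)) \<noteq> vis r x}"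
proof -
  have "{x \<in> {0..<1}. frac (x + d) \<in> {x \<in> {0..<1}. vis r (frac (x + c)) \<noteq> vis r x}}
      = {x \<in> {0..<1}. vis r (frac (x + (d + c))) \<noteq> vis r (frac (x + d))}"
    by (auto simp: frac_lt_1 frac_frac_add add.assoc)
  then show ?thesis using measure_frac_shift[OF sets_bad, of d r c] by simp
qed

lemma sets_shifted_bad: "{x \<in> {0..<1}. vis r (frac (x + (d + c))) \<noteq> vis r (frac (x + d))} \<in> sets circle"
proof -
  have "{x \<in> {0..<1}. frac (x + d) \<in> {x \<in> {0..<1}. vis r (frac (x + c)) \<noteq> vis r x}}
      = {x \<in> {0..<1}. vis r (frac (x + (d + c))) \<noteq> vis r (frac (x + d))}"
    by (auto simp: frac_lt_1 frac_frac_add add.assoc)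
  then show ?thesis using sets_frac_shift[OF sets_bad, of d r c] by simp
qed

text \<open>The shift by \<open>N + N'\<close> is split at the intermediate point; rotation
  invariance gives the second piece the measure \<open>bad N' i\<close>.\<close>

lemma bad_add: "bad (N + N') i \<le> bad N i + bad N' i" "bad N' i \<le> bad (N + N') i + bad N i"
proof -
  let ?e = "err (k i)" and ?v = "vis (s i)"
  let ?X = "{x \<in> {0..<1}. ?v (frac (x + real N * ?e)) \<noteq> ?v x}"
  let ?Y = "{x \<in> {0..<1}. ?v (frac (x + (real N * ?e + real N' * ?e))) \<noteq> ?v (frac (x + real N * ?e))}"
  let ?Z = "{x \<in> {0..<1}. ?v (frac (x + real (N + N') * ?e)) \<noteq> ?v x}"
  have eq: "real (N + N') * ?e = real N * ?e + real N' * ?e" by (simp add: algebra_simps)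
  have Y: "measure circle ?Y = bad N' i" unfolding bad_def by (rule measure_shifted_bad)
  have "measure circle ?Z \<le> measure circle (?X \<union> ?Y)"
    using sets_bad sets_shifted_bad unfolding eq by (intro circle.finite_measure_mono sets.Un) auto
  also have "\<dots> \<le> measure circle ?X + measure circle ?Y"
    using sets_bad sets_shifted_bad by (intro measure_Un_le)
  finally show "bad (N + N') i \<le> bad N i + bad N' i" unfolding Y by (simp add: bad_def)
  have "measure circle ?Y \<le> measure circle (?Z \<union> ?X)"
    using sets_bad sets_shifted_bad unfolding eq by (intro circle.finite_measure_mono sets.Un) auto
  also have "\<dots> \<le> measure circle ?Z + measure circle ?X"
    using sets_bad by (intro measure_Un_le)
  finally show "bad N' i \<le> bad (N + N') i + bad N i" unfolding Y by (simp add: bad_def)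
qed

lemma bad_nonneg: "0 \<le> bad N i"
  by (simp add: bad_def)

lemma bad_lim_add: "bad N \<longlonglongrightarrow> 0 \<Longrightarrow> bad N' \<longlonglongrightarrow> 0 \<Longrightarrow> bad (N + N') \<longlonglongrightarrow> 0"
  by (rule tendsto_sandwich[of "\<lambda>_. 0" _ _ "\<lambda>i. bad N i + bad N' i"])
    (use tendsto_add[of "bad N" 0 _ "bad N'" 0] in \<open>auto simp: bad_nonneg bad_add(1)\<close>)

lemma bad_lim_diff: "bad (N + N') \<longlonglongrightarrow> 0 \<Longrightarrow> bad N \<longlonglongrightarrow> 0 \<Longrightarrow> bad N' \<longlonglongrightarrow> 0"
  by (rule tendsto_sandwich[of "\<lambda>_. 0" _ _ "\<lambda>i. bad (N + N') i + bad N i"])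
    (use tendsto_add[of "bad (N + N')" 0 _ "bad N" 0] in \<open>auto simp: bad_nonneg bad_add(2)\<close>)

lemma bad_lim_mult: "bad N \<longlonglongrightarrow> 0 \<Longrightarrow> bad (a * N) \<longlonglongrightarrow> 0"
proof (induction a)
  case 0
  have "bad 0 i = 0" for i
  proof -
    have "{x \<in> {0..<1}. vis (s i) (frac (x + real 0 * err (k i))) \<noteq> vis (s i) x} = {}"
      by (auto simp: frac_eq[THEN iffD2])
    then show ?thesis by (simp only: bad_def measure_empty)
  qed
  then show ?case by simp
next
  case (Suc a)
  then show ?case using bad_lim_add[of N "a * N"] by simp
qed

lemma bad_1: "\<not> bad 1 \<longlonglongrightarrow> 0"
proof
  assume lim: "bad 1 \<longlonglongrightarrow> 0"
  have "\<kappa> \<le> bad 1 i" for i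
  proof -
    interpret separated_scale \<alpha> z T "k i" "s i" by (rule scale)
    have "{x \<in> {0..<1}. drift x \<noteq> 0} = {x \<in> {0..<1}. vis (s i) (frac (x + real 1 * err (k i))) \<noteq> vis (s i) x}"
      by (auto simp: drift_def)
    then show ?thesis using measure_drift kappa(2)[of i] by (simp add: bad_def)
  qed
  then have "\<kappa> \<le> 0" by (intro LIMSEQ_le_const[OF lim]) auto
  then show False using kappa(1) by simp
qed

text \<open>Drifts not divisible by \<open>N\<close> have limiting probability 0. Where neither
  \<open>x\<close> nor its image after \<open>s i\<close> steps has such a drift,
  \<open>vis_shift_eq_of_congruent\<close> applies; the two exceptional sets have equal measure,
  hence the factor 2.\<close>

lemma bad_lim_of_law:
  assumes N: "2 \<le> N" and law: "drift_law (\<lambda>i. N * qn (k i)) K B p"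
    and dvd: "\<And>e. e \<le> B \<Longrightarrow> 0 < p e \<Longrightarrow> N dvd e"
  shows "bad N \<longlonglongrightarrow> 0"
proof (rule tendsto_sandwich[OF _ _ tendsto_const])
  let ?A = "\<lambda>i e. {x \<in> {0..<1}. K i = vis (N * qn (k i)) x + e}"
  define E where "E = {e. e \<le> B \<and> \<not> N dvd e}"
  have E: "finite E" unfolding E_def by simp
  have p0: "p e = 0" if "e \<in> E" for e
    using dvd[of e] drift_law_nonneg[OF law, of e] that by (force simp: E_def)
  have "(\<lambda>i. \<Sum>e\<in>E. measure circle (?A i e)) \<longlonglongrightarrow> (\<Sum>e\<in>E. p e)"
    using law by (intro tendsto_sum) (simp add: drift_law_def E_def)
  then have "(\<lambda>i. \<Sum>e\<in>E. measure circle (?A i e)) \<longlonglongrightarrow> 0" using p0 by simp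
  then show "(\<lambda>i. 2 * (\<Sum>e\<in>E. measure circle (?A i e))) \<longlonglongrightarrow> 0"
    by (rule tendsto_mult_right_zero)
  show "eventually (\<lambda>i. bad N i \<le> 2 * (\<Sum>e\<in>E. measure circle (?A i e))) sequentially"
  proof (intro always_eventually allI)
    fix i
    interpret separated_scale \<alpha> z T "k i" "s i" by (rule scale)
    let ?X = "\<Union>e\<in>E. ?A i e"
    have A: "?A i e \<in> sets circle" for e by (rule sets_vis[of "\<lambda>v. K i = v + e"])
    have X: "?X \<in> sets circle" using A E by (intro sets.finite_UN) auto
    let ?Y = "{x \<in> {0..<1}. frac (x + real (s i) * \<alpha>) \<in> ?X}"
    have bnd: "vis (N * qn (k i)) x \<le> K i" "K i \<le> vis (N * qn (k i)) x + B" if "x \<in> {0..<1}" for x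
      using law that unfolding drift_law_def by blast+
    have dvdX: "N dvd K i - vis (N * qn (k i)) x" if "x \<in> {0..<1}" "x \<notin> ?X" for x
    proof (rule ccontr)
      assume "\<not> ?thesis"
      then have "K i - vis (N * qn (k i)) x \<in> E" using bnd[OF that(1)] by (auto simp: E_def)
      moreover have "x \<in> ?A i (K i - vis (N * qn (k i)) x)" using bnd[OF that(1)] that(1) by auto
      ultimately show False using that(2) by blast
    qed
    have "bad N i \<le> measure circle (?X \<union> ?Y)"
      unfolding bad_def
    proof (rule circle.finite_measure_mono)
      show "{x \<in> {0..<1}. vis (s i) (frac (x + real N * err (k i))) \<noteq> vis (s i) x} \<subseteq> ?X \<union> ?Y"
      proof (rule subsetI, rule ccontr)
        fix x assume x: "x \<in> {x \<in> {0..<1}. vis (s i) (frac (x + real N * err (k i))) \<noteq> vis (s i) x}"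
          and nx: "x \<notin> ?X \<union> ?Y"
        then have x01: "x \<in> {0..<1}" "x \<notin> ?X" by auto
        have y01: "frac (x + real (s i) * \<alpha>) \<in> {0..<1}" by (simp add: frac_lt_1)
        have ny: "frac (x + real (s i) * \<alpha>) \<notin> ?X" using nx x01(1) by blast
        have "vis (s i) (frac (x + real N * err (k i))) = vis (s i) x"
          using x01(1)
          by (intro vis_shift_eq_of_congruent[OF N _ _ bnd(1)[OF x01(1)] bnd(1)[OF y01] dvdX[OF x01] dvdX[OF y01 ny]]) auto
        then show False using x by simp
      qed
      show "?X \<union> ?Y \<in> sets circle" using X sets_frac_shift[OF X] by (rule sets.Un)
    qed
    also have "\<dots> \<le> measure circle ?X + measure circle ?Y"
      using X sets_frac_shift[OF X] by (rule measure_Un_le)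
    also have "measure circle ?Y = measure circle ?X" by (rule measure_frac_shift[OF X])
    also have "measure circle ?X \<le> (\<Sum>e\<in>E. measure circle (?A i e))"
      using A E by (intro circle.finite_measure_subadditive_finite) auto
    finally show "bad N i \<le> 2 * (\<Sum>e\<in>E. measure circle (?A i e))" by simp
  qed
qed (simp_all add: bad_nonneg)

text \<open>A nonzero \<open>drift x\<close> means that \<open>x\<close> and its image after
  \<open>s i\<close> steps have drifts \<open>e\<close> and \<open>Suc e\<close> in some order. For
  each \<open>e\<close> such points have measure at most twice the smaller of the two masses, so if
  no adjacent pair were charged in the limit, \<open>bad 1\<close> would tend to 0.\<close>

lemma adjacent_drifts:
  assumes law: "drift_law (\<lambda>i. 1 * qn (k i)) K B p"
  obtains e where "Suc e \<le> B" "0 < p e" "0 < p (Suc e)"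
proof (rule ccontr)
  assume no: "\<not> thesis"
  let ?A = "\<lambda>i e. {x \<in> {0..<1}. K i = vis (1 * qn (k i)) x + e}"
  have L: "(\<lambda>i. measure circle (?A i e)) \<longlonglongrightarrow> p e" if "e \<le> B" for e
    using law that unfolding drift_law_def by blast
  have no': "\<not> (Suc e \<le> B \<and> 0 < p e \<and> 0 < p (Suc e))" for e using no that by blast
  have p0: "min (p e) (p (Suc e)) = 0" if "e < B" for e
  proof -
    have "0 \<le> p e" "0 \<le> p (Suc e)" using drift_law_nonneg[OF law] that by auto
    then show ?thesis using no'[of e] that by (auto simp: min_def)
  qed
  have "(\<lambda>i. \<Sum>e<B. min (measure circle (?A i e)) (measure circle (?A i (Suc e)))) \<longlonglongrightarrow> (\<Sum>e<B. min (p e) (p (Suc e)))"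
    by (intro tendsto_sum tendsto_min L) auto
  then have lim: "(\<lambda>i. 2 * (\<Sum>e<B. min (measure circle (?A i e)) (measure circle (?A i (Suc e))))) \<longlonglongrightarrow> 0"
    using p0 by (intro tendsto_mult_right_zero) simp
  have "bad 1 \<longlonglongrightarrow> 0"
  proof (rule tendsto_sandwich[OF _ _ tendsto_const lim])
    show "eventually (\<lambda>i. bad 1 i \<le> 2 * (\<Sum>e<B. min (measure circle (?A i e)) (measure circle (?A i (Suc e))))) sequentially"
    proof (intro always_eventually allI)
      fix i
      interpret separated_scale \<alpha> z T "k i" "s i" by (rule scale)
      have A: "?A i e \<in> sets circle" for e by (rule sets_vis[of "\<lambda>v. K i = v + e"])
      define S where "S e = {x \<in> {0..<1}. frac (x + real (s i) * \<alpha>) \<in> ?A i e}" for e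
      have S: "S e \<in> sets circle" "measure circle (S e) = measure circle (?A i e)" for e
        unfolding S_def using sets_frac_shift[OF A] measure_frac_shift[OF A] by auto
      have bnd: "vis (1 * qn (k i)) x \<le> K i" "K i \<le> vis (1 * qn (k i)) x + B" if "x \<in> {0..<1}" for x
        using law that unfolding drift_law_def by blast+
      let ?U = "\<lambda>e. (?A i e \<inter> S (Suc e)) \<union> (?A i (Suc e) \<inter> S e)"
      have "bad 1 i \<le> measure circle (\<Union>e\<in>{..<B}. ?U e)"
        unfolding bad_def
      proof (rule circle.finite_measure_mono)
        show "{x \<in> {0..<1}. vis (s i) (frac (x + real 1 * err (k i))) \<noteq> vis (s i) x} \<subseteq> (\<Union>e\<in>{..<B}. ?U e)"
        proof
          fix x assume x: "x \<in> {x \<in> {0..<1}. vis (s i) (frac (x + real 1 * err (k i))) \<noteq> vis (s i) x}"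
          then have x01: "x \<in> {0..<1}" and d0: "drift x \<noteq> 0" by (auto simp: drift_def)
          define y where "y = frac (x + real (s i) * \<alpha>)"
          have y01: "y \<in> {0..<1}" by (simp add: y_def frac_lt_1)
          define a b where "a = K i - vis (1 * qn (k i)) x" and "b = K i - vis (1 * qn (k i)) y"
          have xa: "x \<in> ?A i a" "a \<le> B" using bnd[OF x01] x01 by (auto simp: a_def)
          have "y \<in> ?A i b" and yb: "b \<le> B" using bnd[OF y01] y01 by (auto simp: b_def)
          then have xb: "x \<in> S b" using x01 by (simp add: S_def y_def)
          have "int b - int a = - drift x"
            unfolding drift_commute y_def[symmetric] using bnd(1)[OF x01] bnd(1)[OF y01]
            by (simp add: a_def b_def of_nat_diff)
          then have "b = Suc a \<or> a = Suc b" using d0 abs_drift_le[of x] by linarith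
          then show "x \<in> (\<Union>e\<in>{..<B}. ?U e)"
          proof
            assume "b = Suc a"
            then show ?thesis using xa xb yb by (intro UN_I[of a]) auto
          next
            assume "a = Suc b"
            then show ?thesis using xa xb by (intro UN_I[of b]) auto
          qed
        qed
        show "(\<Union>e\<in>{..<B}. ?U e) \<in> sets circle" by (intro sets.finite_UN sets.Un sets.Int A S(1)) simp
      qed
      also have "\<dots> \<le> (\<Sum>e<B. measure circle (?U e))"
        by (intro circle.finite_measure_subadditive_finite image_subsetI sets.Un sets.Int A S(1)) simp
      also have "\<dots> \<le> (\<Sum>e<B. 2 * min (measure circle (?A i e)) (measure circle (?A i (Suc e))))"
      proof (rule sum_mono)
        fix e
        have "measure circle (?U e) \<le> measure circle (?A i e \<inter> S (Suc e)) + measure circle (?A i (Suc e) \<inter> S e)"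
          using A S by (intro measure_Un_le sets.Int)
        moreover have le: "measure circle (X \<inter> Y) \<le> min (measure circle X) (measure circle Y)"
          if "X \<in> sets circle" "Y \<in> sets circle" for X Y
          using that by (intro min.boundedI circle.finite_measure_mono) auto
        have "measure circle (?A i e \<inter> S (Suc e)) \<le> min (measure circle (?A i e)) (measure circle (?A i (Suc e)))"
          using le[OF A S(1), of e "Suc e"] unfolding S(2) .
        moreover have "measure circle (?A i (Suc e) \<inter> S e) \<le> min (measure circle (?A i e)) (measure circle (?A i (Suc e)))"
          using le[OF A S(1), of "Suc e" e] unfolding S(2) by (simp only: min.commute)
        ultimately show "measure circle (?U e) \<le> 2 * min (measure circle (?A i e)) (measure circle (?A i (Suc e)))"
          by linarith
      qed
      finally show "bad 1 i \<le> 2 * (\<Sum>e<B. min (measure circle (?A i e)) (measure circle (?A i (Suc e))))"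
        by (simp add: sum_distrib_left)
    qed
  qed (simp add: bad_nonneg)
  then show False using bad_1 by blast
qed

lemma integral_law:
  assumes bnd: "\<And>x. x \<in> {0..<1} \<Longrightarrow> vis r x \<le> K \<and> K \<le> vis r x + B"
  shows "(LINT x|circle. (real K - real (vis r x))\<^sup>2)
    = (\<Sum>e\<le>B. (real e)\<^sup>2 * measure circle {x \<in> {0..<1}. K = vis r x + e})"
proof -
  let ?A = "\<lambda>e. {x \<in> {0..<1}. K = vis r x + e}"
  have A: "?A e \<in> sets circle" for e by (rule sets_vis[of "\<lambda>v. K = v + e"])
  have i: "integrable circle (indicator (?A e) :: real \<Rightarrow> real)" for e
    using A by (intro integrable_real_indicator) (auto simp: circle.emeasure_eq_measure)
  have "(LINT x|circle. (real K - real (vis r x))\<^sup>2) = (LINT x|circle. (\<Sum>e\<le>B. (real e)\<^sup>2 * indicator (?A e) x))"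
  proof (rule Bochner_Integration.integral_cong[OF refl])
    fix x assume "x \<in> space circle"
    then have x: "x \<in> {0..<1}" by simp
    have "(\<Sum>e\<le>B. (real e)\<^sup>2 * indicator (?A e) x) = (\<Sum>e\<le>B. if e = K - vis r x then (real e)\<^sup>2 else 0)"
      using x bnd[OF x] by (intro sum.cong) (auto simp: indicator_def)
    also have "\<dots> = (real (K - vis r x))\<^sup>2"
    proof -
      have "K - vis r x \<in> {..B}" using bnd[OF x] by auto
      then show ?thesis by (simp only: sum.delta[OF finite_atMost] if_True)
    qed
    also have "real (K - vis r x) = real K - real (vis r x)" using bnd[OF x] by (simp add: of_nat_diff)
    finally show "(real K - real (vis r x))\<^sup>2 = (\<Sum>e\<le>B. (real e)\<^sup>2 * indicator (?A e) x)" by simp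
  qed
  also have "\<dots> = (\<Sum>e\<le>B. LINT x|circle. (real e)\<^sup>2 * indicator (?A e) x)"
    by (intro Bochner_Integration.integral_sum integrable_mult_right i)
  also have "\<dots> = (\<Sum>e\<le>B. (real e)\<^sup>2 * measure circle (?A e))"
    by (intro sum.cong refl) (simp only: integral_mult_right_zero integral_indicator_circle(2)[OF A])
  finally show ?thesis .
qed

text \<open>The drift at time \<open>N q_k\<close> is the sum of \<open>N\<close> shifted copies of
  the drift at time \<open>q_k\<close>, all with the same second moment. The moment identity is the
  asymptotic equality case of Cauchy--Schwarz, so \<open>sum_square_diff_le\<close> makes
  consecutive copies agree with probability tending to 1.\<close>

lemma bad_1_of_moments:
  assumes N: "2 \<le> N"
    and law1: "drift_law (\<lambda>i. 1 * qn (k i)) K B p"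
    and law2: "drift_law (\<lambda>i. N * qn (k i)) (\<lambda>i. N * K i) B p'"
    and moments: "(\<Sum>e\<le>B. p' e * (real e)\<^sup>2) = (real N)\<^sup>2 * (\<Sum>e\<le>B. p e * (real e)\<^sup>2)"
  shows "bad 1 \<longlonglongrightarrow> 0"
proof -
  have bnd1: "vis (qn (k i)) x \<le> K i \<and> K i \<le> vis (qn (k i)) x + B" if "x \<in> {0..<1}" for i x
    using law1 that unfolding drift_law_def by auto
  have bnd2: "vis (N * qn (k i)) x \<le> N * K i \<and> N * K i \<le> vis (N * qn (k i)) x + B" if "x \<in> {0..<1}" for i x
    using law2 that unfolding drift_law_def by auto
  define I1 where "I1 i = (LINT x|circle. (real (K i) - real (vis (qn (k i)) x))\<^sup>2)" for i
  define I2 where "I2 i = (LINT x|circle. (real (N * K i) - real (vis (N * qn (k i)) x))\<^sup>2)" for i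
  have "I1 i = (\<Sum>e\<le>B. (real e)\<^sup>2 * measure circle {x \<in> {0..<1}. K i = vis (1 * qn (k i)) x + e})" for i
    unfolding I1_def mult_1 by (rule integral_law) (rule bnd1)
  note I1_eq = this
  have I2_eq: "I2 i = (\<Sum>e\<le>B. (real e)\<^sup>2 * measure circle {x \<in> {0..<1}. N * K i = vis (N * qn (k i)) x + e})" for i
    unfolding I2_def by (rule integral_law) (rule bnd2)
  have "I1 \<longlonglongrightarrow> (\<Sum>e\<le>B. (real e)\<^sup>2 * p e)"
    unfolding I1_eq[abs_def] using law1 by (intro tendsto_sum tendsto_mult tendsto_const) (simp add: drift_law_def)
  moreover have "I2 \<longlonglongrightarrow> (\<Sum>e\<le>B. (real e)\<^sup>2 * p' e)"
    unfolding I2_eq[abs_def] using law2 by (intro tendsto_sum tendsto_mult tendsto_const) (simp add: drift_law_def)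
  ultimately have "(\<lambda>i. (real N)\<^sup>2 * I1 i - I2 i) \<longlonglongrightarrow> (real N)\<^sup>2 * (\<Sum>e\<le>B. (real e)\<^sup>2 * p e) - (\<Sum>e\<le>B. (real e)\<^sup>2 * p' e)"
    by (intro tendsto_diff tendsto_mult tendsto_const)
  then have lim: "(\<lambda>i. 2 * ((real N)\<^sup>2 * I1 i - I2 i)) \<longlonglongrightarrow> 0"
    using moments by (intro tendsto_mult_right_zero) (simp add: mult.commute)
  show ?thesis
  proof (rule tendsto_sandwich[OF _ _ tendsto_const lim])
    show "eventually (\<lambda>i. bad 1 i \<le> 2 * ((real N)\<^sup>2 * I1 i - I2 i)) sequentially"
    proof (intro always_eventually allI)
      fix i
      interpret separated_scale \<alpha> z T "k i" "s i" by (rule scale)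
      define e where "e = err (k i)"
      define Y where "Y x = real (K i) - real (vis (qn (k i)) x)" for x
      have Ym: "Y \<in> borel_measurable circle"
        unfolding Y_def by (intro borel_measurable_diff borel_measurable_const measurable_vis)
      have Yb: "\<bar>Y x\<bar> \<le> B" if "x \<in> {0..<1}" for x
        using bnd1[OF that, of i] by (auto simp: Y_def)
      have Y2b: "norm ((Y x)\<^sup>2) \<le> (real B)\<^sup>2" if "x \<in> {0..<1}" for x
        using Yb[OF that] by (simp add: abs_le_square_iff[symmetric])
      have Y2: "integrable circle (\<lambda>x. (Y x)\<^sup>2)"
      proof (rule circle.integrable_const_bound)
        show "AE x in circle. norm ((Y x)\<^sup>2) \<le> (real B)\<^sup>2" using Y2b by (intro AE_I2) simp
      qed (intro borel_measurable_power Ym)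
      have Yl: "integrable circle (\<lambda>x. (Y (frac (x + c)))\<^sup>2)" "(LINT x|circle. (Y (frac (x + c)))\<^sup>2) = I1 i" for c
        using integrable_frac_shift[OF Y2, of c] integral_frac_shift[OF borel_measurable_integrable[OF Y2], of c]
        by (simp_all add: I1_def Y_def)
      have sumY: "(\<Sum>l<N. Y (frac (x + real l * e))) = real (N * K i) - real (vis (N * qn (k i)) x)" for x
        by (simp add: Y_def sum_subtractf vis_mult_qn e_def)
      have I2i: "integrable circle (\<lambda>x. (real (N * K i) - real (vis (N * qn (k i)) x))\<^sup>2)"
      proof (rule circle.integrable_const_bound)
        show "AE x in circle. norm ((real (N * K i) - real (vis (N * qn (k i)) x))\<^sup>2) \<le> (real B)\<^sup>2"
        proof (rule AE_I2)
          fix x assume "x \<in> space circle"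
          then have "\<bar>real (N * K i) - real (vis (N * qn (k i)) x)\<bar> \<le> real B"
            using bnd2[of x i] by (auto simp del: of_nat_mult)
          then show "norm ((real (N * K i) - real (vis (N * qn (k i)) x))\<^sup>2) \<le> (real B)\<^sup>2"
            by (simp add: abs_le_square_iff[symmetric] del: of_nat_mult)
        qed
      qed (intro borel_measurable_power borel_measurable_diff borel_measurable_const measurable_vis)
      let ?D = "{x \<in> {0..<1}. vis (qn (k i)) (frac (x + e)) \<noteq> vis (qn (k i)) x}"
      have D: "?D \<in> sets circle" by (rule sets_bad)
      have "measure circle ?D = (LINT x|circle. indicator ?D x)"
        by (rule integral_indicator_circle(2)[OF D, symmetric])
      also have "\<dots> \<le> (LINT x|circle. real N * (\<Sum>l<N. (Y (frac (x + real l * e)))\<^sup>2)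
          - (real (N * K i) - real (vis (N * qn (k i)) x))\<^sup>2)"
      proof (rule integral_mono)
        show "integrable circle (indicator ?D :: real \<Rightarrow> real)"
          using D by (intro integrable_real_indicator) (auto simp: circle.emeasure_eq_measure)
        show "integrable circle (\<lambda>x. real N * (\<Sum>l<N. (Y (frac (x + real l * e)))\<^sup>2)
          - (real (N * K i) - real (vis (N * qn (k i)) x))\<^sup>2)"
          by (intro Bochner_Integration.integrable_diff integrable_mult_right
              Bochner_Integration.integrable_sum Yl(1) I2i)
        fix x assume "x \<in> space circle"
        then have x: "0 \<le> x" "x < 1" by auto
        have le: "(Y (frac (x + e)) - Y x)\<^sup>2 \<le> real N * (\<Sum>l<N. (Y (frac (x + real l * e)))\<^sup>2)
            - (real (N * K i) - real (vis (N * qn (k i)) x))\<^sup>2"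
          using sum_square_diff_le[OF N, of "\<lambda>l. Y (frac (x + real l * e))"] x
          unfolding sumY by (simp add: frac_eq[THEN iffD2])
        have "indicator ?D x \<le> (Y (frac (x + e)) - Y x)\<^sup>2"
        proof (cases "x \<in> ?D")
          case True
          then have "1 \<le> \<bar>Y (frac (x + e)) - Y x\<bar>" by (auto simp: Y_def)
          then have "1 \<le> (Y (frac (x + e)) - Y x)\<^sup>2" 
            using abs_le_square_iff[of 1 "Y (frac (x + e)) - Y x"] by simp
          then show ?thesis using True by simp
        qed simp
        then show "indicator ?D x \<le> real N * (\<Sum>l<N. (Y (frac (x + real l * e)))\<^sup>2)
            - (real (N * K i) - real (vis (N * qn (k i)) x))\<^sup>2" using le by linarith
      qed
      also have "\<dots> = (LINT x|circle. real N * (\<Sum>l<N. (Y (frac (x + real l * e)))\<^sup>2)) - I2 i"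
        unfolding I2_def
        by (intro Bochner_Integration.integral_diff integrable_mult_right
            Bochner_Integration.integrable_sum Yl(1) I2i)
      also have "(LINT x|circle. real N * (\<Sum>l<N. (Y (frac (x + real l * e)))\<^sup>2)) = real N * (\<Sum>l<N. I1 i)"
        using Yl by simp
      finally have mD: "measure circle ?D \<le> (real N)\<^sup>2 * I1 i - I2 i" by (simp add: power2_eq_square)
      \<comment> \<open>\<open>drift_zero_of_stationary\<close> asks for equality at
        \<open>x\<close> and at its image after \<open>s i\<close> steps; the two exceptional sets
        have equal measure.\<close>
      let ?S = "{x \<in> {0..<1}. frac (x + real (s i) * \<alpha>) \<in> ?D}"
      have "bad 1 i \<le> measure circle (?D \<union> ?S)"
        unfolding bad_def
      proof (rule circle.finite_measure_mono)
        show "{x \<in> {0..<1}. vis (s i) (frac (x + real 1 * err (k i))) \<noteq> vis (s i) x} \<subseteq> ?D \<union> ?S"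
        proof
          fix x assume x: "x \<in> {x \<in> {0..<1}. vis (s i) (frac (x + real 1 * err (k i))) \<noteq> vis (s i) x}"
          then have "drift x \<noteq> 0" by (simp add: drift_def)
          moreover have "frac (x + real (s i) * \<alpha>) \<in> {0..<1}" by (simp add: frac_lt_1)
          ultimately show "x \<in> ?D \<union> ?S"
            using drift_zero_of_stationary[of x] x unfolding e_def by blast
        qed
        show "?D \<union> ?S \<in> sets circle" using D sets_frac_shift[OF D] by (rule sets.Un)
      qed
      also have "\<dots> \<le> measure circle ?D + measure circle ?S"
        using D sets_frac_shift[OF D] by (rule measure_Un_le)
      also have "measure circle ?S = measure circle ?D" by (rule measure_frac_shift[OF D])
      finally show "bad 1 i \<le> 2 * ((real N)\<^sup>2 * I1 i - I2 i)" using mD by simp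
    qed
  qed (simp add: bad_nonneg)
qed

end

context induced_rotation
begin

lemma disjoint_maps_of_rectangles:
  assumes "\<And>\<nu> A B. joining M (T ^^ m) M (T ^^ n) \<nu> \<Longrightarrow> A \<in> sets M \<Longrightarrow> B \<in> sets M \<Longrightarrow>
    measure \<nu> (A \<times> B) = measure M A * measure M B"
  shows "disjoint_maps M (T ^^ m) M (T ^^ n)"
  unfolding disjoint_maps_def
proof (intro allI impI)
  fix \<nu> assume joint: "joining M (T ^^ m) M (T ^^ n) \<nu>"
  then have s: "sets \<nu> = sets (M \<Otimes>\<^sub>M M)" and f: "distr \<nu> M fst = M" by (auto simp: joining_def)
  have sp: "space \<nu> = J \<times> J" using sets_eq_imp_space_eq[OF s] by (simp add: space_pair_measure)
  have fm: "fst \<in> measurable \<nu> M" using measurable_cong_sets[OF s refl] by auto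
  have "emeasure (distr \<nu> M fst) (space M) = emeasure \<nu> (fst -` space M \<inter> space \<nu>)"
    by (rule emeasure_distr[OF fm sets.top])
  also have "fst -` space M \<inter> space \<nu> = space \<nu>" by (auto simp: sp)
  finally have "emeasure \<nu> (space \<nu>) = 1" by (simp add: f emeasure_M_J)
  then interpret \<nu>: finite_measure \<nu> by (intro finite_measureI) simp
  have "M \<Otimes>\<^sub>M M = \<nu>"
  proof (rule pair_measure_eqI)
    fix A B assume AB: "A \<in> sets M" "B \<in> sets M"
    have "emeasure M A * emeasure M B = ennreal (measure M A * measure M B)"
      by (simp add: M.emeasure_eq_measure ennreal_mult)
    then show "emeasure M A * emeasure M B = emeasure \<nu> (A \<times> B)"
      using assms[OF joint AB] by (simp add: \<nu>.emeasure_eq_measure)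
  qed (simp_all add: s M.sigma_finite_measure_axioms)
  then show "\<nu> = M \<Otimes>\<^sub>M M" by simp
qed

end

context separated_scales
begin

lemma disjoint_of_laws:
  fixes p1 p2 p3 :: "nat \<Rightarrow> real"
  assumes mn: "0 < m" "m < n" and g: "m = m' * g" "n = n' * g" "coprime m' n'"
    and law1: "drift_law (\<lambda>i. m' * qn (k i)) (\<lambda>i. m' * g * return_time g (k i)) B p1"
    and law2: "drift_law (\<lambda>i. n' * qn (k i)) (\<lambda>i. n' * g * return_time g (k i)) B p2"
    and law3: "drift_law (\<lambda>i. 1 * qn (k i)) K B p3"
  shows "disjoint_maps M (T ^^ m) M (T ^^ n)"
proof (rule disjoint_maps_of_rectangles)
  fix \<nu> A B' assume joint: "joining M (T ^^ m) M (T ^^ n) \<nu>" and AB: "A \<in> sets M" "B' \<in> sets M"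
  have pos: "0 < g" "0 < m'" using mn g by auto
  have n2: "2 \<le> n'"
  proof -
    have "m' < n'" using mn(2) unfolding g(1,2) by simp
    then show ?thesis using pos by simp
  qed
  obtain e0 where e0: "Suc e0 \<le> B" "0 < p3 e0" "0 < p3 (Suc e0)" by (rule adjacent_drifts[OF law3])
  show "measure \<nu> (A \<times> B') = measure M A * measure M B'"
  proof (rule joining_rectangle[OF mn(1) _ _ _ _ joint AB])
    show "drift_law (\<lambda>i. m' * qn (k i)) (\<lambda>i. m * return_time g (k i)) B p1" using law1 by (simp only: g(1))
    show "drift_law (\<lambda>i. n' * qn (k i)) (\<lambda>i. n * return_time g (k i)) B p2" using law2 by (simp only: g(2))
    show "AE x in M. h x = 0"
      if "h \<in> borel_measurable M" "\<And>x. x \<in> J \<Longrightarrow> norm (h x) \<le> C" "AE x in M. h (T x) = \<zeta> * h x"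
        "(LINT x|M. h x) = 0" for h C and \<zeta> :: complex
      using eigenfunction_null[OF law3 e0 that(1) that(2) that(3) that(4)] by simp
    fix \<omega> :: complex
    assume w: "\<omega> ^ m = 1"
    show "(\<Sum>e\<le>B. monom (of_real (p2 e)) (m * e)) \<noteq> (\<Sum>e\<le>B. monom (of_real (p1 e) * \<omega> ^ e) (n * e))"
    proof
      assume eq: "(\<Sum>e\<le>B. monom (of_real (p2 e)) (m * e)) = (\<Sum>e\<le>B. monom (of_real (p1 e) * \<omega> ^ e) (n * e))"
      have n0: "0 < n" using mn by simp
      \<comment> \<open>Equality of the polynomials says that \<open>m e\<close> under
        \<open>p2\<close> and \<open>n e\<close> under \<open>p1\<close> have the same law.\<close>
      note comp = compatible_laws[OF mn(1) n0 w drift_law_nonneg[OF law1] drift_law_nonneg[OF law2] eq]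
      have d1: "m' dvd e" if "e \<le> B" "0 < p1 e" for e
      proof -
        have "m' * g dvd n' * e * g" using comp(1)[of e] that unfolding g(1,2) by (simp add: mult_ac)
        then have "m' dvd n' * e" using pos(1) by simp
        then show ?thesis using g(3) by (simp add: coprime_dvd_mult_right_iff)
      qed
      have d2: "n' dvd e" if "e \<le> B" "0 < p2 e" for e
      proof -
        have "n' * g dvd m' * e * g" using comp(2)[of e] that unfolding g(1,2) by (simp add: mult_ac)
        then have "n' dvd m' * e" using pos(1) by simp
        then show ?thesis using g(3) by (simp add: coprime_dvd_mult_right_iff coprime_commute)
      qed
      show False
      \<comment> \<open>Divisibility by 1 carries no information, so for \<open>m' = 1\<close> the
        second moments are compared instead.\<close>
      proof (cases "m' = 1")
        case True
        have "(\<Sum>e\<le>B. p2 e * (real (m * e))\<^sup>2) = (\<Sum>e\<le>B. p1 e * (real (n * e))\<^sup>2)"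
          by (rule comp(3))
        then have "(real g)\<^sup>2 * (\<Sum>e\<le>B. p2 e * (real e)\<^sup>2) = (real g)\<^sup>2 * ((real n')\<^sup>2 * (\<Sum>e\<le>B. p1 e * (real e)\<^sup>2))"
          by (simp add: g(1,2) True sum_distrib_left power_mult_distrib mult_ac)
        then have moments: "(\<Sum>e\<le>B. p2 e * (real e)\<^sup>2) = (real n')\<^sup>2 * (\<Sum>e\<le>B. p1 e * (real e)\<^sup>2)"
          using pos(1) by simp
        have "bad 1 \<longlonglongrightarrow> 0"
        proof (rule bad_1_of_moments[OF n2 _ _ moments])
          show "drift_law (\<lambda>i. 1 * qn (k i)) (\<lambda>i. g * return_time g (k i)) B p1"
            using law1 unfolding True by simp
          show "drift_law (\<lambda>i. n' * qn (k i)) (\<lambda>i. n' * (g * return_time g (k i))) B p2"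
            using law2 by (simp add: mult.assoc)
        qed
        then show False using bad_1 by blast
      next
        case False
        then have m2: "2 \<le> m'" using pos by simp
        have bm: "bad m' \<longlonglongrightarrow> 0" by (rule bad_lim_of_law[OF m2 law1 d1])
        have bn: "bad n' \<longlonglongrightarrow> 0" by (rule bad_lim_of_law[OF n2 law2 d2])
        \<comment> \<open>Bezout in natural numbers: closure of the limits under multiples and
          differences then reaches 1.\<close>
        obtain a b where ab: "m' * a = n' * b + 1"
          using bezout_nat[of m' n'] pos(2) g(3) by auto
        have "bad (b * n' + 1) \<longlonglongrightarrow> 0"
          using bad_lim_mult[OF bm, of a] ab by (simp add: mult.commute)
        then have "bad 1 \<longlonglongrightarrow> 0" by (rule bad_lim_diff) (rule bad_lim_mult[OF bn])
        then show False using bad_1 by blast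
      qed
    qed
  qed
qed

text \<open>Compactness: the finitely many level-set measures converge along a common subsequence.
  Laws are extracted at the multiples \<open>m'\<close>, \<open>n'\<close> and 1 of
  \<open>q_k\<close>, the last one to exclude eigenfunctions. The bound \<open>7 * n\<close> covers
  all drifts, as \<open>N * h\<close> is at most \<open>n\<close> in each case.\<close>

theorem disjoint_powers:
  assumes mn: "0 < m" "m < n"
  shows "disjoint_maps M (T ^^ m) M (T ^^ n)"
proof -
  define g where "g = gcd m n"
  have g0: "0 < g" using mn by (simp add: g_def)
  obtain m' n' where g: "m = m' * g" "n = n' * g" "coprime m' n'"
    using gcd_coprime_exists[of m n] mn unfolding g_def by auto
  define L where "L N h e i = measure circle
      {x \<in> {0..<1}. N * h * return_time h (k i) = vis (N * qn (k i)) x + e}" for N h e i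
  define A where "A = {(m', g), (n', g), (1, 1)} \<times> {..7 * n}"
  define f where "f = (\<lambda>((N, h), e). L N h e)"
  have fin: "finite A" by (simp add: A_def)
  have rng: "f a i \<in> {0..1}" for a i
  proof -
    obtain N h e where a: "a = ((N, h), e)" by (metis prod.exhaust)
    have "measure circle X \<le> 1" for X
      using circle.bounded_measure[of X] emeasure_circle_space by (simp add: measure_def)
    then show ?thesis by (simp add: a f_def L_def)
  qed
  obtain \<sigma> :: "nat \<Rightarrow> nat" where \<sigma>: "strict_mono \<sigma>" and conv: "\<forall>a\<in>A. convergent (\<lambda>i. f a (\<sigma> i))"
  proof (rule common_convergent_subsequence[OF fin rng])
    fix \<sigma> :: "nat \<Rightarrow> nat"
    assume *: "strict_mono \<sigma>" "\<And>a. a \<in> A \<Longrightarrow> convergent (\<lambda>i. f a (\<sigma> i))"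
    show thesis
    proof (rule that)
      show "strict_mono \<sigma>" by (rule *(1))
      show "\<forall>a\<in>A. convergent (\<lambda>i. f a (\<sigma> i))" using *(2) by blast
    qed
  qed
  interpret sub: separated_scales \<alpha> z T "k \<circ> \<sigma>" "s \<circ> \<sigma>" \<kappa> by (rule subsequence[OF \<sigma>])
  define p where "p N h e = lim (\<lambda>i. L N h e (\<sigma> i))" for N h e
  have lim: "(\<lambda>i. L N h e (\<sigma> i)) \<longlonglongrightarrow> p N h e"
    if "(N, h) \<in> {(m', g), (n', g), (1, 1)}" "e \<le> 7 * n" for N h e
  proof -
    have "((N, h), e) \<in> A" using that by (simp add: A_def)
    then have "convergent (\<lambda>i. f ((N, h), e) (\<sigma> i))" using conv by blast
    then show ?thesis by (simp add: p_def f_def convergent_LIMSEQ_iff)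
  qed
  have law: "drift_law (\<lambda>i. N * qn ((k \<circ> \<sigma>) i)) (\<lambda>i. N * h * return_time h ((k \<circ> \<sigma>) i)) (7 * n) (p N h)"
    if "(N, h) \<in> {(m', g), (n', g), (1, 1)}" "0 < h" "N * h \<le> n" for N h
  proof (rule sub.drift_lawI)
    show "(\<lambda>i. measure circle {x \<in> {0..<1}. N * h * return_time h ((k \<circ> \<sigma>) i) = vis (N * qn ((k \<circ> \<sigma>) i)) x + e})
        \<longlonglongrightarrow> p N h e" if "e \<le> 7 * n" for e
      using lim[OF _ that] \<open>(N, h) \<in> _\<close> by (simp add: L_def)
  qed (use that in auto)
  show ?thesis
  proof (rule sub.disjoint_of_laws[OF mn g])
    show "drift_law (\<lambda>i. m' * qn ((k \<circ> \<sigma>) i)) (\<lambda>i. m' * g * return_time g ((k \<circ> \<sigma>) i)) (7 * n) (p m' g)"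
      using mn g g0 by (intro law) auto
    show "drift_law (\<lambda>i. n' * qn ((k \<circ> \<sigma>) i)) (\<lambda>i. n' * g * return_time g ((k \<circ> \<sigma>) i)) (7 * n) (p n' g)"
      using mn g g0 by (intro law) auto
    show "drift_law (\<lambda>i. 1 * qn ((k \<circ> \<sigma>) i)) (\<lambda>i. 1 * 1 * return_time 1 ((k \<circ> \<sigma>) i)) (7 * n) (p 1 1)"
      using mn by (intro law) auto
  qed
qed

end

section \<open>Consequences of the assumptions (A0)--(A9)\<close>

context induced_rotation
begin

lemma irrational_multiple_separated:
  fixes l :: nat
  assumes "0 < l" "l < qn (Suc j)"
  shows "\<bar>err j\<bar> \<le> min (frac (l * \<alpha>)) (1 - frac (l * \<alpha>))"
proof -
  have f: "frac (l * \<alpha>) = real l * \<alpha> - of_int \<lfloor>l * \<alpha>\<rfloor>" by (simp add: frac_def)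
  have "0 \<le> frac (l * \<alpha>)" "frac (l * \<alpha>) < 1" by (simp_all add: frac_lt_1)
  moreover have "\<bar>err j\<bar> \<le> \<bar>frac (l * \<alpha>)\<bar>"
    unfolding f by (rule best_approximation[OF assms])
  moreover have "\<bar>err j\<bar> \<le> \<bar>frac (l * \<alpha>) - 1\<bar>"
    using best_approximation[OF assms, of "\<lfloor>l * \<alpha>\<rfloor> + 1"] unfolding f by (simp add: diff_diff_eq)
  ultimately show ?thesis by linarith
qed

text \<open>The integrand is constant, so (A6) says that the distance from
  \<open>L i * \<alpha>\<close> to the integers tends to 0.\<close>

lemma integral_circle_dist:
  "(LINT x:{0..<1}|lborel. circle_dist ((rotation \<alpha> ^^ l) x) x) = min (frac (l * \<alpha>)) (1 - frac (l * \<alpha>))"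
proof -
  define u where "u = frac (l * \<alpha>)"
  have u: "0 \<le> u" "u < 1" by (auto simp: u_def frac_lt_1)
  have "circle_dist ((rotation \<alpha> ^^ l) x) x = min u (1 - u)" if x: "x \<in> {0..<1}" for x
  proof -
    have "(rotation \<alpha> ^^ l) x = frac (u + x)"
      using x by (simp add: rotation_iterate u_def frac_frac_add add.commute)
    moreover have "frac (u + x) = (if u + x < 1 then u + x else u + x - 1)"
      using u x by (auto simp: frac_def floor_eq_iff)
    ultimately show ?thesis using u x by (auto simp: circle_dist_def)
  qed
  then have "(LINT x:{0..<1}|lborel. circle_dist ((rotation \<alpha> ^^ l) x) x) = (LINT x:{0..<1::real}|lborel. min u (1 - u))"
    by (intro set_lebesgue_integral_cong) auto
  also have "\<dots> = min u (1 - u)" by (simp add: set_lebesgue_integral_def)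
  finally show ?thesis by (simp add: u_def)
qed

text \<open>By best approximation a positive \<open>l\<close> below \<open>q_{j+1}\<close> keeps
  \<open>l \<alpha>\<close> at least \<open>|err j|\<close> away from the integers.\<close>

lemma rotation_times_unbounded:
  assumes L: "\<And>i. 0 < L i" and lim: "(\<lambda>i. LINT x:{0..<1}|lborel. circle_dist ((rotation \<alpha> ^^ L i) x) x) \<longlonglongrightarrow> 0"
  shows "eventually (\<lambda>i. qn (Suc j) \<le> L i) sequentially"
proof -
  have "eventually (\<lambda>i. (LINT x:{0..<1}|lborel. circle_dist ((rotation \<alpha> ^^ L i) x) x) < \<bar>err j\<bar>) sequentially"
    using err_nz by (intro order_tendstoD(2)[OF lim]) simp
  then show ?thesis
  proof eventually_elim
    case (elim i)
    then show ?case
      using irrational_multiple_separated[OF L[of i], of j] unfolding integral_circle_dist by (meson not_le)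
  qed
qed

text \<open>Best approximation is applied to \<open>q_k < q_{k+1}\<close>, which can fail for
  \<open>k = 0\<close>, where both may equal 1.\<close>

lemma err_le_dist_to_int:
  assumes "1 \<le> k"
  shows "\<bar>err k\<bar> \<le> dist_to_int (real (qn k) * \<alpha>)"
proof -
  obtain j where j: "k = Suc j" using assms by (cases k) auto
  have "qn k < qn (Suc k)" using qn_Suc_Suc_ge[of j] qn_pos[of j] by (simp add: j del: cf_denom.simps)
  then have "\<bar>err k\<bar> \<le> dist (real (qn k) * \<alpha>) y" if "y \<in> \<int>" for y
    using best_approximation[OF qn_pos] that by (auto simp: dist_real_def elim!: Ints_cases)
  then show ?thesis
    unfolding dist_to_int_def by (subst infdist_notempty) (auto intro!: cINF_greatest)
qed

text \<open>At height \<open>j\<close> the lattice vector \<open>P (1,0) + j (-\<alpha>,1)\<close>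
  brings a copy of the target to the same height, so the distance there is purely
  horizontal.\<close>

lemma torus_dist_le:
  fixes P :: int
  shows "torus_dist \<alpha> ((0, 0) + (0, real j)) (z, 0) \<le> \<bar>real j * \<alpha> - z - P\<bar>"
    and "torus_dist \<alpha> ((z, 0) + (0, real j)) (0, 0) \<le> \<bar>real j * \<alpha> + z - P\<bar>"
proof -
  have lat: "(of_int P - real j * \<alpha>, real j) \<in> torus_lattice \<alpha>"
    unfolding torus_lattice_def by (intro image_eqI[of _ _ "(P, int j)"]) auto
  have "torus_dist \<alpha> ((0, 0) + (0, real j)) (z, 0)
      \<le> dist ((0, 0) + (0, real j)) ((z, 0) + (of_int P - real j * \<alpha>, real j))"
    unfolding torus_dist_def by (intro infdist_le imageI lat)
  also have "\<dots> = \<bar>real j * \<alpha> - z - P\<bar>"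
    by (simp add: dist_prod_def dist_real_def)
  finally show "torus_dist \<alpha> ((0, 0) + (0, real j)) (z, 0) \<le> \<bar>real j * \<alpha> - z - P\<bar>" .
  have "torus_dist \<alpha> ((z, 0) + (0, real j)) (0, 0)
      \<le> dist ((z, 0) + (0, real j)) ((0, 0) + (of_int P - real j * \<alpha>, real j))"
    unfolding torus_dist_def by (intro infdist_le imageI lat)
  also have "\<dots> = \<bar>real j * \<alpha> + z - P\<bar>"
    by (simp add: dist_prod_def dist_real_def)
  finally show "torus_dist \<alpha> ((z, 0) + (0, real j)) (0, 0) \<le> \<bar>real j * \<alpha> + z - P\<bar>" .
qed

lemma vertical_length_separated:
  fixes P :: int
  assumes k: "1 \<le> k" and j: "real j < h"
    and "vertical_length_ge \<alpha> (0, 0) (z, 0) (dist_to_int (real (qn k) * \<alpha>)) h"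
    and "vertical_length_ge \<alpha> (z, 0) (0, 0) (dist_to_int (real (qn k) * \<alpha>)) h"
  shows "\<bar>err k\<bar> \<le> \<bar>real j * \<alpha> - z - P\<bar>" "\<bar>err k\<bar> \<le> \<bar>real j * \<alpha> + z - P\<bar>"
proof -
  have "\<not> torus_dist \<alpha> ((0, 0) + (0, real j)) (z, 0) < dist_to_int (real (qn k) * \<alpha>)"
    "\<not> torus_dist \<alpha> ((z, 0) + (0, real j)) (0, 0) < dist_to_int (real (qn k) * \<alpha>)"
    using assms(2-4) unfolding vertical_length_ge_def by (meson not_le of_nat_0_le_iff)+
  then show "\<bar>err k\<bar> \<le> \<bar>real j * \<alpha> - z - P\<bar>" "\<bar>err k\<bar> \<le> \<bar>real j * \<alpha> + z - P\<bar>"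
    using err_le_dist_to_int[OF k] torus_dist_le(1)[of j P] torus_dist_le(2)[of j P] by linarith+
qed

text \<open>(A1) gives \<open>q_k <= (C1 + 1) q_{k-1}\<close>, so the minimum is at least
  \<open>q_k / ((C1 + 1) C4)\<close>; (A2) gives \<open>q_{k+1} <= (C2 + 1) q_k\<close>, so
  \<open>|err k|\<close> is at least \<open>1 / ((C2 + 2) q_k)\<close>.\<close>

lemma scale_lower_bound:
  assumes k: "2 \<le> k" and C: "1 < C1" "1 < C2" "1 < C4"
    and a: "real (pq k) < C1" "real (pq (k + 1)) < C2"
  shows "1 / ((C1 + 1) * (C2 + 2) * C4) \<le> real (min (qn (k - 1)) (nat \<lceil>qn k / C4\<rceil>)) * \<bar>err k\<bar>"
proof -
  obtain j where j: "k = Suc (Suc j)" using k by (metis add_2_eq_Suc le_Suc_ex)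
  define q0 q1 q2 where "q0 = real (qn (Suc j))" and "q1 = real (qn k)" and "q2 = real (qn (Suc k))"
  have pos: "0 < q0" "0 < q1" using qn_pos by (auto simp: q0_def q1_def)
  have "real (qn j) \<le> q0" "q0 \<le> q1"
    using qn_mono[of j] qn_mono[of "Suc j"] unfolding q0_def q1_def j by (simp_all del: cf_denom.simps)
  then have q1: "q1 \<le> (C1 + 1) * q0"
  proof -
    have "q1 = real (pq k) * q0 + real (qn j)" by (simp add: q1_def q0_def j)
    also have "\<dots> \<le> C1 * q0 + q0" using a(1) pos \<open>real (qn j) \<le> q0\<close> by (intro add_mono mult_right_mono) auto
    finally show ?thesis by (simp add: algebra_simps)
  qed
  have q2: "q2 \<le> (C2 + 1) * q1"
  proof -
    have "q2 = real (pq (k + 1)) * q1 + q0" by (simp add: q2_def q1_def q0_def j)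
    also have "\<dots> \<le> C2 * q1 + q1" using a(2) pos \<open>q0 \<le> q1\<close> by (intro add_mono mult_right_mono) auto
    finally show ?thesis by (simp add: algebra_simps)
  qed
  have e: "1 \<le> (C2 + 2) * q1 * \<bar>err k\<bar>"
  proof -
    have "1 \<le> (q2 + q1) * \<bar>err k\<bar>" using abs_err_lower[of k] by (simp add: q1_def q2_def del: cf_denom.simps)
    also have "\<dots> \<le> ((C2 + 2) * q1) * \<bar>err k\<bar>" using q2 by (intro mult_right_mono) (auto simp: algebra_simps)
    finally show ?thesis .
  qed
  define D where "D = (C1 + 1) * (C2 + 2) * C4"
  have D0: "0 < D" using C by (simp add: D_def)
  have m: "min q0 (q1 / C4) * ((C1 + 1) * C4) \<ge> q1"
  proof (cases "q0 \<le> q1 / C4")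
    case True
    have "q1 \<le> (C1 + 1) * q0 * 1" using q1 by simp
    also have "\<dots> \<le> (C1 + 1) * q0 * C4" using C pos by (intro mult_left_mono) auto
    finally show ?thesis using True by (simp add: min_def mult_ac)
  next
    case False
    have "q1 * 1 \<le> q1 * (C1 + 1)" using C pos by (intro mult_left_mono) auto
    then show ?thesis using False C by (simp add: min_def mult_ac)
  qed
  have "1 \<le> (C2 + 2) * q1 * \<bar>err k\<bar>" by (rule e)
  also have "\<dots> \<le> (C2 + 2) * (min q0 (q1 / C4) * ((C1 + 1) * C4)) * \<bar>err k\<bar>"
    using m C by (intro mult_right_mono mult_left_mono) auto
  also have "\<dots> = D * (min q0 (q1 / C4) * \<bar>err k\<bar>)" by (simp add: D_def mult_ac)
  finally have "1 / D \<le> min q0 (q1 / C4) * \<bar>err k\<bar>" using D0 by (simp add: field_simps)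
  also have "min q0 (q1 / C4) \<le> real (min (qn (k - 1)) (nat \<lceil>qn k / C4\<rceil>))"
  proof -
    have "q1 / C4 \<le> real (nat \<lceil>q1 / C4\<rceil>)" by linarith
    moreover have "k - 1 = Suc j" by (simp add: j)
    ultimately show ?thesis unfolding q0_def q1_def by (simp only: of_nat_min)
  qed
  finally show ?thesis by (simp add: D_def mult_right_mono)
qed

lemma separated_scales_of_assumptions:
  assumes "assumptions_A \<alpha> z"
  obtains k s \<kappa> where "separated_scales \<alpha> z T k s \<kappa>"
proof -
  obtain C1 C2 C3 C4 chat and cl :: "nat \<Rightarrow> real" and \<eta>0 where C: "1 < C1" "1 < C2" "1 < C4" and \<eta>0: "0 < \<eta>0"
    and all: "\<And>l \<eta>. 0 < \<eta> \<and> \<eta> < \<eta>0 \<Longrightarrow> chat \<eta> > 0 \<and> cl l > 0 \<and>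
      (\<forall>c. 0 < c \<and> c < cl l \<longrightarrow> (\<exists>kc L k. conditions_A \<alpha> z C1 C2 C3 C4 l \<eta> (chat \<eta>) c kc L k))"
    using assms unfolding assumptions_A_def by blast
  have "0 < \<eta>0 / 2 \<and> \<eta>0 / 2 < \<eta>0" using \<eta>0 by simp
  \<comment> \<open>A single choice of parameters suffices: \<open>l = 0\<close>, half the threshold
    for \<open>\<eta>\<close>, and half of \<open>cl 0\<close> for \<open>c\<close>.\<close>
  note a = all[OF this, of 0]
  define c where "c = cl 0 / 2"
  have c: "0 < c" "c < cl 0" using a by (auto simp: c_def)
  then obtain kc L k where cond: "conditions_A \<alpha> z C1 C2 C3 C4 0 (\<eta>0 / 2) (chat (\<eta>0 / 2)) c kc L k"
    using a by blast
  have A0: "\<And>i. real (qn (k i - 1)) < c * real (L i)" "\<And>i. c * real (L i) < real (qn (k i))"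
    and A1: "\<And>i. real (pq (k i)) < C1" and A2: "\<And>i. real (pq (k i + 1)) < C2"
    and A4: "\<And>i. vertical_length_ge \<alpha> (0, 0) (z, 0) (dist_to_int (real (qn (k i)) * \<alpha>)) (real (qn (k i)) / C4)"
      "\<And>i. vertical_length_ge \<alpha> (z, 0) (0, 0) (dist_to_int (real (qn (k i)) * \<alpha>)) (real (qn (k i)) / C4)"
    and A6: "(\<lambda>i. LINT x:{0..<1}|lborel. circle_dist ((rotation \<alpha> ^^ L i) x) x) \<longlonglongrightarrow> 0"
    using cond unfolding conditions_A_def Let_def by blast+
  have L0: "0 < L i" for i
    using A0(1)[of i] c by (cases "L i = 0") auto
  \<comment> \<open>(A6) makes \<open>L i\<close> eventually exceed every \<open>q_j\<close>, and
    (A0) bounds \<open>c * L i\<close> by \<open>q_{k_i}\<close>.\<close>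
  have k_lim: "filterlim k at_top sequentially"
    unfolding filterlim_at_top
  proof
    fix m
    obtain j :: nat where j: "qn m / c < j" using reals_Archimedean2 by blast
    show "eventually (\<lambda>i. m \<le> k i) sequentially"
      using rotation_times_unbounded[OF L0 A6, of j]
    proof eventually_elim
      case (elim i)
      have "qn m / c < real (L i)" using j elim qn_ge[of "Suc j"] by linarith
      then have "real (qn m) < c * real (L i)" using c by (simp add: field_simps)
      then have "qn m < qn (k i)" using A0(2)[of i] by linarith
      then show ?case using qn_mono'[of "k i" m] by linarith
    qed
  qed
  have "eventually (\<lambda>i. 2 \<le> k i) sequentially" using k_lim by (simp add: filterlim_at_top)
  then obtain n0 where n0: "\<And>i. n0 \<le> i \<Longrightarrow> 2 \<le> k i" by (auto simp: eventually_sequentially)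
  \<comment> \<open>Discards initial indices, since the spacing of orbit points is taken from the
    error of index \<open>k - 2\<close>.\<close>
  define k' where "k' i = k (i + n0)" for i
  \<comment> \<open>The first bound secures the spacing of orbit points, the second the range of
    (A4); with the ceiling, \<open>j < s i\<close> still gives \<open>j < q_k / C4\<close>.\<close>
  define s where "s i = min (qn (k' i - 1)) (nat \<lceil>qn (k' i) / C4\<rceil>)" for i
  show ?thesis
  proof (rule that[of k' s "1 / ((C1 + 1) * (C2 + 2) * C4)"], intro separated_scales.intro separated_scales_axioms.intro)
    show "induced_rotation \<alpha> z T" by (rule induced_rotation_axioms)
    show "filterlim k' at_top sequentially"
      unfolding k'_def by (rule filterlim_compose[OF k_lim filterlim_add_const_nat_at_top])
    show "0 < 1 / ((C1 + 1) * (C2 + 2) * C4)" using C by simp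
    fix i
    have k2: "2 \<le> k' i" by (simp add: k'_def n0)
    show "1 / ((C1 + 1) * (C2 + 2) * C4) \<le> real (s i) * \<bar>err (k' i)\<bar>"
      unfolding s_def using k2 C A1[of "i + n0"] A2[of "i + n0"] by (intro scale_lower_bound) (simp_all add: k'_def)
    show "separated_scale \<alpha> z T (k' i) (s i)"
    proof (intro separated_scale.intro separated_scale_axioms.intro)
      show "induced_rotation \<alpha> z T" by (rule induced_rotation_axioms)
      have "0 < qn (k' i) / C4" using qn_pos[of "k' i"] C by simp
      then show "0 < s i" using qn_pos by (simp add: s_def)
      show "s i \<le> qn (k' i - 1)" by (simp add: s_def)
      fix j and P :: int assume "j < s i"
      then have "j < nat \<lceil>qn (k' i) / C4\<rceil>" by (simp add: s_def)
      then have j: "real j < qn (k' i) / C4" by linarith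
      show "\<bar>err (k' i)\<bar> \<le> \<bar>real j * \<alpha> - z - P\<bar>" "\<bar>err (k' i)\<bar> \<le> \<bar>real j * \<alpha> + z - P\<bar>"
        using k2 A4[of "i + n0"] j
        by (intro vertical_length_separated[OF _ j]; simp add: k'_def)+
    qed (rule k2)
  qed
qed

end

theorem theorem1p7:
  fixes \<alpha> z :: real and T :: "real \<Rightarrow> real"
  assumes "\<alpha> \<in> {0<..<1}" and "\<alpha> \<notin> \<rat>"
    and "0 < z" and "{0..<z} \<subseteq> {0..<1}"
    and "\<And>x. x \<in> {0..<1} \<Longrightarrow> x \<notin> {0..<z} \<Longrightarrow> rotation \<alpha> x \<in> {0..<z}"
    and "\<And>x. x \<in> {0..<z} \<Longrightarrow> T x = first_return (rotation \<alpha>) {0..<z} x"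
    and "interval_exchange 3 z T"
    and "assumptions_A \<alpha> z"
  shows "\<exists>\<kappa>::real. \<kappa> > 1 \<and>
    (\<forall>n::nat. n > 0 \<longrightarrow>
      (\<forall>m1 \<in> nondisjoint_powers z T n. \<forall>m2 \<in> nondisjoint_powers z T n.
         m1 < m2 \<longrightarrow> real m2 / real m1 > \<kappa>))"
proof -
  have z1: "z \<le> 1"
    using assms(3) subsetD[OF assms(4), of 1] by (cases "z \<le> 1") auto
  interpret induced_rotation \<alpha> z T
  proof unfold_locales
    show "frac (x + \<alpha>) < z" if "z \<le> x" "x < 1" for x
      using assms(5)[of x] that assms(3) by (auto simp: rotation_def)
  qed (use assms z1 in auto)
  obtain k s \<kappa> where "separated_scales \<alpha> z T k s \<kappa>"
    using separated_scales_of_assumptions[OF assms(8)] by blast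
  then interpret separated_scales \<alpha> z T k s \<kappa> .
  have "nondisjoint_powers z T n = {}" for n
    using disjoint_powers by (auto simp: nondisjoint_powers_def)
  \<comment> \<open>The sets are empty, so any number above 1 serves as the ratio bound.\<close>
  then show ?thesis by (intro exI[of _ 2]) simp
qed

end
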